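(* Let $A,B>0$ with $A\neq B$, let $0<x_0<1$, let $P\in\mathbb{R}$ be a constant, let $g\in L^1([0,1])$ (extended by $0$ to $\mathbb{R}$), and let $a(x)=A\,H(x_0-x)+B\,H(x-x_0)$. If $u\in\dot{\mathcal D}'([0,1])$ is a solution to the problem $(a\cdot u)''+Pu=g$ on $[0,1]$, $u(0)=u(1)=0$, in the distributional sense defined in the context, then $u$ is a locally integrable function.
   Context: $H$ denotes the Heaviside function. $\dot{\mathcal D}'([0,1]):=\{v\in\mathcal D'(\mathbb{R}) : \operatorname{supp} v\subseteq[0,1]\}$. Model product: a model delta net is given by specifying $\varphi\in\mathcal D(\mathbb{R})$ with $\int\varphi=1$ and putting $\varphi_\varepsilon(x)=\varphi(x/\varepsilon)/\varepsilon$, $\varepsilon>0$. For $v,w\in\mathcal D'(\mathbb{R})$ the model product is $[v\cdot w]:=\lim_{\varepsilon\to0}(v*\varphi_\varepsilon)(w*\varphi_\varepsilon)$; it is said to exist if this limit exists in $\mathcal D'(\mathbb{R})$ for every model delta net and is independent of the choice of the model delta net. Solution: $u\in\dot{\mathcal D}'([0,1])$ is called a solution of the problem $(a\cdot u)''+Pu=g$ on $[0,1]$, $u(0)=u(1)=0$ (where $a(x)=A\,H(x_0-x)+B\,H(x-x_0)$ with $A,B>0$, $A\neq B$, $0<x_0<1$, $P\in\mathbb{R}$ is a constant, and $g\in L^1([0,1])$ is extended by $0$ to $\mathbb{R}$) if (A1) the model product $[a\cdot u]$ exists in $\mathcal D'(\mathbb{R})$, and (A2) the equation $([a\cdot u])''+Pu=g$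 holds in $\mathcal D'(\mathbb{R})$. (The boundary conditions are implemented through the support condition $u\in\dot{\mathcal D}'([0,1])$.) *)

theory Defs
  imports "HOL-Analysis.Analysis"
begin

text \<open>Distributions are complex valued and are represented as functionals on all functions
  \<^typ>\<open>real \<Rightarrow> complex\<close>; only their values on test functions are meaningful, so equality of two
  distributions always means agreement on all test functions.\<close>

definition vderiv :: "(real \<Rightarrow> complex) \<Rightarrow> real \<Rightarrow> complex" where
  "vderiv f = (\<lambda>x. vector_derivative f (at x))"

definition smooth :: "(real \<Rightarrow> complex) \<Rightarrow> bool" where
  "smooth f \<longleftrightarrow> (\<forall>n x. (vderiv ^^ n) f differentiable (at x))"

definition tsupp :: "(real \<Rightarrow> complex) \<Rightarrow> real set" where
  "tsupp f = closure {x. f x \<noteq> 0}"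

definition test_function :: "(real \<Rightarrow> complex) \<Rightarrow> bool" where
  "test_function \<phi> \<longleftrightarrow> smooth \<phi> \<and> compact (tsupp \<phi>)"

definition distribution :: "((real \<Rightarrow> complex) \<Rightarrow> complex) \<Rightarrow> bool" where
  "distribution u \<longleftrightarrow>
     (\<forall>\<phi> \<psi>. test_function \<phi> \<longrightarrow> test_function \<psi> \<longrightarrow> u (\<lambda>x. \<phi> x + \<psi> x) = u \<phi> + u \<psi>) \<and>
     (\<forall>c \<phi>. test_function \<phi> \<longrightarrow> u (\<lambda>x. c * \<phi> x) = c * u \<phi>) \<and>
     (\<forall>K. compact K \<longrightarrow>
        (\<exists>C N. \<forall>\<phi>. test_function \<phi> \<longrightarrow> tsupp \<phi> \<subseteq> K \<longrightarrow>
           norm (u \<phi>) \<le> C * (\<Sum>k\<le>(N::nat). SUP x. norm ((vderiv ^^ k) \<phi> x))))"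

definition dist_supp :: "((real \<Rightarrow> complex) \<Rightarrow> complex) \<Rightarrow> real set" where
  "dist_supp u = - \<Union>{U. open U \<and> (\<forall>\<phi>. test_function \<phi> \<longrightarrow> tsupp \<phi> \<subseteq> U \<longrightarrow> u \<phi> = 0)}"

definition dist_deriv :: "((real \<Rightarrow> complex) \<Rightarrow> complex) \<Rightarrow> (real \<Rightarrow> complex) \<Rightarrow> complex" where
  "dist_deriv u = (\<lambda>\<phi>. - u (vderiv \<phi>))"

definition locally_integrable :: "(real \<Rightarrow> complex) \<Rightarrow> bool" where
  "locally_integrable f \<longleftrightarrow> (\<forall>K. compact K \<longrightarrow> f absolutely_integrable_on K)"

definition regular_dist :: "(real \<Rightarrow> complex) \<Rightarrow> (real \<Rightarrow> complex) \<Rightarrow> complex" where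
  "regular_dist f = (\<lambda>\<phi>. LINT x|lebesgue. f x * \<phi> x)"

definition dist_conv :: "((real \<Rightarrow> complex) \<Rightarrow> complex) \<Rightarrow> (real \<Rightarrow> complex) \<Rightarrow> real \<Rightarrow> complex" where
  "dist_conv v \<phi> = (\<lambda>x. v (\<lambda>y. \<phi> (x - y)))"

definition scaled :: "(real \<Rightarrow> complex) \<Rightarrow> real \<Rightarrow> real \<Rightarrow> complex" where
  "scaled \<phi> \<epsilon> = (\<lambda>x. \<phi> (x / \<epsilon>) / of_real \<epsilon>)"

text \<open>\<open>has_model_product v w p\<close>: the model product of \<open>v\<close> and \<open>w\<close> exists and equals \<open>p\<close>. Since \<open>p\<close>
  is fixed before the mollifier \<open>\<phi>\<close>, this includes independence of the model delta net.\<close>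

definition has_model_product ::
  "((real \<Rightarrow> complex) \<Rightarrow> complex) \<Rightarrow> ((real \<Rightarrow> complex) \<Rightarrow> complex) \<Rightarrow>
   ((real \<Rightarrow> complex) \<Rightarrow> complex) \<Rightarrow> bool" where
  "has_model_product v w p \<longleftrightarrow> distribution p \<and>
     (\<forall>\<phi>. test_function \<phi> \<longrightarrow> (LINT x|lebesgue. \<phi> x) = 1 \<longrightarrow>
       (\<forall>\<psi>. test_function \<psi> \<longrightarrow>
         ((\<lambda>\<epsilon>. regular_dist (\<lambda>x. dist_conv v (scaled \<phi> \<epsilon>) x * dist_conv w (scaled \<phi> \<epsilon>) x) \<psi>)
            \<longlongrightarrow> p \<psi>) (at_right 0)))"

text \<open>The value at \<open>0\<close> is immaterial: only the induced distribution is used.\<close>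

definition heaviside :: "real \<Rightarrow> real" where
  "heaviside x = (if x < 0 then 0 else 1)"

definition jump_coeff :: "real \<Rightarrow> real \<Rightarrow> real \<Rightarrow> real \<Rightarrow> complex" where
  "jump_coeff A B x0 = (\<lambda>x. of_real (A * heaviside (x0 - x) + B * heaviside (x - x0)))"

definition zero_extension :: "(real \<Rightarrow> complex) \<Rightarrow> real \<Rightarrow> complex" where
  "zero_extension g = (\<lambda>x. if x \<in> {0..1} then g x else 0)"

text \<open>Solutions of \<open>(a \<cdot> u)'' + P u = g\<close> on \<open>[0,1]\<close>; the boundary conditions \<open>u(0) = u(1) = 0\<close> are
  encoded by the support condition.\<close>

definition is_solution ::
  "real \<Rightarrow> real \<Rightarrow> real \<Rightarrow> real \<Rightarrow> (real \<Rightarrow> complex) \<Rightarrow> ((real \<Rightarrow> complex) \<Rightarrow> complex) \<Rightarrow> bool" where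
  "is_solution A B x0 P g u \<longleftrightarrow>
     distribution u \<and> dist_supp u \<subseteq> {0..1} \<and>
     (\<exists>p. has_model_product (regular_dist (jump_coeff A B x0)) u p \<and>
        (\<forall>\<psi>. test_function \<psi> \<longrightarrow>
           dist_deriv (dist_deriv p) \<psi> + of_real P * u \<psi> = regular_dist (zero_extension g) \<psi>))"

end

theory Submission
  imports Defs
begin

text \<open>Off the jump at \<open>x0\<close> the coefficient is constant, so the product is \<open>A u\<close> on the left and
  \<open>B u\<close> on the right, and the equation becomes a linear second order equation with constant
  coefficients and locally integrable right-hand side. Its operator factors into two first order
  ones, and a distribution solving a first order equation of this kind is a continuous function
  (\<open>second_order_regularity\<close>). Hence \<open>u\<close> agrees off \<open>x0\<close> with a function \<open>f\<close> that is
  continuous up to the jump from either side, and \<open>u - f\<close>, being supported in a point, is a finite sum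
  \<open>\<Sum>k. c k \<phi>\<^sup>(\<^sup>k\<^sup>)(x0)\<close> of derivatives evaluated there (\<open>point_support_structure\<close>).

  It remains to show that all \<open>c k\<close> vanish. The functional \<open>\<phi> \<mapsto> \<phi>\<^sup>(\<^sup>k\<^sup>)(x0)\<close> is regularised to
  \<open>(-1)\<^sup>k \<epsilon>\<^sup>-\<^sup>k\<^sup>-\<^sup>1 b\<^sup>(\<^sup>k\<^sup>)((x - x0) / \<epsilon>)\<close> by the mollifier \<open>b\<close>, and the coefficient to
  \<open>\<alpha>((x - x0) / \<epsilon>)\<close> with a fixed smooth step \<open>\<alpha>\<close> from \<open>A\<close> to \<open>B\<close>. Tested against a function equal to
  \<open>(x - x0)\<^sup>j\<close> near \<open>x0\<close>, the regularised product is therefore, up to the bounded contribution of \<open>f\<close>,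
  a Laurent polynomial in \<open>\<epsilon>\<close> with terms \<open>\<plusminus> c k \<epsilon>\<^sup>j\<^sup>-\<^sup>k \<integral> y\<^sup>j \<alpha> b\<^sup>(\<^sup>k\<^sup>)\<close>
  (\<open>regularised_product_expansion\<close>). Let \<open>n \<ge> 1\<close> be the largest index with \<open>c n \<noteq> 0\<close>. Integration
  by parts turns this integral, for \<open>k = n\<close> and \<open>j = 0\<close> (\<open>n\<close> odd) or \<open>j = 1\<close> (\<open>n\<close> even), into a
  nonzero multiple of \<open>(B - A) \<integral> (b\<^sup>(\<^sup>m\<^sup>))\<^sup>2\<close>, so the product could not converge
  (\<open>no_delta_derivatives\<close>). Finally \<open>c 0 = 0\<close>: otherwise the product would contain the delta
  distribution with the factor \<open>c 0 (A + B) / 2\<close>, and its second derivative could not be balanced by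
  the other terms of the equation (\<open>no_delta\<close>).\<close>

section \<open>Smooth functions\<close>

lemma vderiv_I: "(f has_vector_derivative d) (at x) \<Longrightarrow> vderiv f x = d"
  by (simp add: vderiv_def vector_derivative_at)

lemma smooth_iff: "smooth f \<longleftrightarrow> (\<forall>x. f differentiable (at x)) \<and> smooth (vderiv f)"
proof
  assume f: "smooth f"
  have "(vderiv ^^ n) (vderiv f) differentiable (at x)" for n x
    using f[unfolded smooth_def, rule_format, of "Suc n" x] by (simp add: funpow_Suc_right del: funpow.simps)
  moreover have "f differentiable (at x)" for x
    using f[unfolded smooth_def, rule_format, of 0 x] by simp
  ultimately show "(\<forall>x. f differentiable (at x)) \<and> smooth (vderiv f)"
    by (simp add: smooth_def)
next
  assume f: "(\<forall>x. f differentiable (at x)) \<and> smooth (vderiv f)"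
  have "(vderiv ^^ n) f differentiable (at x)" for n x
  proof (cases n)
    case (Suc m)
    then show ?thesis using f by (simp add: smooth_def funpow_Suc_right del: funpow.simps)
  qed (use f in simp)
  then show "smooth f" by (simp add: smooth_def)
qed

lemma smooth_has_vderiv: "smooth f \<Longrightarrow> (f has_vector_derivative vderiv f x) (at x)"
  unfolding vderiv_def by (subst vector_derivative_works[symmetric]) (use smooth_iff in blast)

lemma smooth_has_vderiv_within: "smooth f \<Longrightarrow> (f has_vector_derivative vderiv f x) (at x within S)"
  using smooth_has_vderiv has_vector_derivative_at_within by blast

lemma smooth_vderiv: "smooth f \<Longrightarrow> smooth (vderiv f)"
  using smooth_iff by blast

lemma smooth_funpow: "smooth f \<Longrightarrow> smooth ((vderiv ^^ n) f)"
  by (induction n) (auto simp: smooth_vderiv)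

lemma smooth_continuous: "smooth f \<Longrightarrow> continuous_on S f"
  by (meson continuous_at_imp_continuous_on differentiable_imp_continuous_within smooth_iff)

lemma smooth_coinduct:
  assumes "f \<in> S" and "\<And>f. f \<in> S \<Longrightarrow> \<exists>f'\<in>S. \<forall>x. (f has_vector_derivative f' x) (at x)"
  shows "smooth f"
proof -
  have "(vderiv ^^ n) f \<in> S" for n
  proof (induction n)
    case (Suc n)
    obtain f' where "f' \<in> S" "\<forall>x. ((vderiv ^^ n) f has_vector_derivative f' x) (at x)"
      using assms(2)[OF Suc] by blast
    moreover from this have "vderiv ((vderiv ^^ n) f) = f'"
      by (auto intro!: ext vderiv_I)
    ultimately show ?case by simp
  qed (use assms in simp)
  then show ?thesis
    unfolding smooth_def using assms(2) differentiableI_vector by blast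
qed

text \<open>The algebra generated by a set of functions. A set of differentiable functions whose
  derivatives stay in the generated algebra consists of smooth functions; this one closure
  principle yields products, exponentials and the bump function.\<close>

inductive_set alg :: "(real \<Rightarrow> complex) set \<Rightarrow> (real \<Rightarrow> complex) set" for S where
  base: "f \<in> S \<Longrightarrow> f \<in> alg S"
| const: "(\<lambda>x. c) \<in> alg S"
| add: "f \<in> alg S \<Longrightarrow> g \<in> alg S \<Longrightarrow> (\<lambda>x. f x + g x) \<in> alg S"
| mult: "f \<in> alg S \<Longrightarrow> g \<in> alg S \<Longrightarrow> (\<lambda>x. f x * g x) \<in> alg S"

lemma smooth_alg:
  assumes "f \<in> alg S" and S: "\<And>f. f \<in> S \<Longrightarrow> \<exists>f'\<in>alg S. \<forall>x. (f has_vector_derivative f' x) (at x)"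
  shows "smooth f"
  using assms(1)
proof (rule smooth_coinduct)
  fix f assume "f \<in> alg S"
  then show "\<exists>f'\<in>alg S. \<forall>x. (f has_vector_derivative f' x) (at x)"
  proof induction
    case (const c)
    show ?case by (rule bexI[of _ "\<lambda>x. 0"]) (auto intro: alg.const)
  next
    case (add f g)
    then obtain f' g' where "f' \<in> alg S" "\<forall>x. (f has_vector_derivative f' x) (at x)"
      "g' \<in> alg S" "\<forall>x. (g has_vector_derivative g' x) (at x)" by blast
    then show ?case
      by (intro bexI[of _ "\<lambda>x. f' x + g' x"]) (auto intro: alg.add has_vector_derivative_add)
  next
    case (mult f g)
    then obtain f' g' where "f' \<in> alg S" "\<forall>x. (f has_vector_derivative f' x) (at x)"
      "g' \<in> alg S" "\<forall>x. (g has_vector_derivative g' x) (at x)" by blast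
    then show ?case using mult.hyps
      by (intro bexI[of _ "\<lambda>x. f x * g' x + f' x * g x"])
         (auto intro: alg.add alg.mult has_vector_derivative_mult)
  qed (rule S)
qed

lemma smooth_alg_smooth: "f \<in> alg (Collect smooth) \<Longrightarrow> smooth f"
proof (erule smooth_alg)
  fix f :: "real \<Rightarrow> complex" assume "f \<in> Collect smooth"
  then show "\<exists>f'\<in>alg (Collect smooth). \<forall>x. (f has_vector_derivative f' x) (at x)"
    by (intro bexI[of _ "vderiv f"] alg.base) (simp_all add: smooth_vderiv smooth_has_vderiv)
qed

lemma smooth_const [simp]: "smooth (\<lambda>x. c)"
  by (rule smooth_alg_smooth) (auto intro: alg.intros)
lemma smooth_add: "smooth f \<Longrightarrow> smooth g \<Longrightarrow> smooth (\<lambda>x. f x + g x)"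
  by (rule smooth_alg_smooth) (auto intro: alg.intros)
lemma smooth_mult: "smooth f \<Longrightarrow> smooth g \<Longrightarrow> smooth (\<lambda>x. f x * g x)"
  by (rule smooth_alg_smooth) (auto intro: alg.intros)
lemma smooth_minus: "smooth f \<Longrightarrow> smooth (\<lambda>x. - f x)"
  using smooth_mult[of "\<lambda>x. -1" f] by simp
lemma smooth_diff: "smooth f \<Longrightarrow> smooth g \<Longrightarrow> smooth (\<lambda>x. f x - g x)"
  using smooth_add[of f "\<lambda>x. - g x"] smooth_minus by simp

lemma smooth_of_real [simp]: "smooth of_real"
proof -
  have "smooth f" if "f \<in> alg {of_real}" for f
    using that
  proof (rule smooth_alg)
    fix f :: "real \<Rightarrow> complex" assume "f \<in> {of_real}"
    moreover have "(of_real has_vector_derivative (1::complex)) (at x)" for x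
      using has_vector_derivative_of_real[OF DERIV_ident] by simp
    ultimately show "\<exists>f'\<in>alg {of_real}. \<forall>x. (f has_vector_derivative f' x) (at x)"
      by (intro bexI[of _ "\<lambda>x. 1"] alg.const) simp
  qed
  then show ?thesis by (blast intro: alg.base)
qed

lemma smooth_exp [simp]: "smooth (\<lambda>x. exp (c * of_real x))"
proof -
  let ?e = "\<lambda>x::real. exp (c * of_real x)"
  have "smooth f" if "f \<in> alg {?e}" for f
    using that
  proof (rule smooth_alg)
    fix f assume "f \<in> {?e}"
    moreover have "(?e has_vector_derivative c * ?e x) (at x)" for x
    proof (rule has_vector_derivative_real_field)
      show "((\<lambda>z. exp (c * z)) has_field_derivative c * exp (c * of_real x)) (at (of_real x))"
        by (auto intro!: derivative_eq_intros)
    qed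
    ultimately show "\<exists>f'\<in>alg {?e}. \<forall>x. (f has_vector_derivative f' x) (at x)"
      by (intro bexI[of _ "\<lambda>x. c * ?e x"]) (auto intro: alg.intros)
  qed
  then show ?thesis by (blast intro: alg.base)
qed

lemma smooth_power: "smooth f \<Longrightarrow> smooth (\<lambda>x. f x ^ n)"
  by (induction n) (auto intro: smooth_mult)

lemma vderiv_add: "smooth f \<Longrightarrow> smooth g \<Longrightarrow> vderiv (\<lambda>x. f x + g x) = (\<lambda>x. vderiv f x + vderiv g x)"
  by (auto intro!: ext vderiv_I has_vector_derivative_add smooth_has_vderiv)

lemma vderiv_mult: "smooth f \<Longrightarrow> smooth g \<Longrightarrow> vderiv (\<lambda>x. f x * g x) = (\<lambda>x. f x * vderiv g x + vderiv f x * g x)"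
  by (auto intro!: ext vderiv_I has_vector_derivative_mult smooth_has_vderiv)

lemma vderiv_const [simp]: "vderiv (\<lambda>x. c) = (\<lambda>x. 0)"
  by (auto intro!: ext vderiv_I)

lemma vderiv_of_real [simp]: "vderiv of_real = (\<lambda>x. 1)"
  by (rule ext, rule vderiv_I) (use has_vector_derivative_of_real[OF DERIV_ident] in simp)

lemma vderiv_cmult: "smooth f \<Longrightarrow> vderiv (\<lambda>x. c * f x) = (\<lambda>x. c * vderiv f x)"
  using vderiv_mult[of "\<lambda>x. c" f] by simp

lemma funpow_vderiv_add: "smooth f \<Longrightarrow> smooth g \<Longrightarrow>
    (vderiv ^^ n) (\<lambda>x. f x + g x) = (\<lambda>x. (vderiv ^^ n) f x + (vderiv ^^ n) g x)"
  by (induction n) (auto simp: vderiv_add smooth_funpow)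

lemma funpow_vderiv_cmult: "smooth f \<Longrightarrow>
    (vderiv ^^ n) (\<lambda>x. c * f x) = (\<lambda>x. c * (vderiv ^^ n) f x)"
  by (induction n) (auto simp: vderiv_cmult smooth_funpow)

lemma has_vderiv_affine:
  assumes "\<And>x. (f has_vector_derivative f' x) (at x)"
  shows "((\<lambda>x. f (a * x + b)) has_vector_derivative of_real a * (f' (a * x + b) :: complex)) (at x)"
proof -
  have "((\<lambda>x. a * x + b) has_vector_derivative a) (at x)"
    by (auto intro!: derivative_eq_intros simp flip: has_real_derivative_iff_has_vector_derivative)
  from vector_diff_chain_at[OF this assms] show ?thesis
    by (simp add: o_def scaleR_conv_of_real)
qed

lemma smooth_affine:
  assumes "smooth f" shows "smooth (\<lambda>x. f (a * x + b))"
proof (rule smooth_coinduct[where S="{\<lambda>x. c * g (a * x + b) | c g. smooth g}"])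
  show "(\<lambda>x. f (a * x + b)) \<in> {\<lambda>x. c * g (a * x + b) | c g. smooth g}"
    using assms by (auto intro!: exI[of _ 1] exI[of _ f])
next
  fix h assume "h \<in> {\<lambda>x. c * g (a * x + b) | c g. smooth g}"
  then obtain c g where h: "h = (\<lambda>x. c * g (a * x + b))" and g: "smooth g" by blast
  have "(h has_vector_derivative (c * of_real a) * vderiv g (a * x + b)) (at x)" for x
    unfolding h
    using has_vector_derivative_mult_right[OF has_vderiv_affine[OF smooth_has_vderiv[OF g]], of c a b x]
    by (simp add: mult.assoc)
  then show "\<exists>f'\<in>{\<lambda>x. c * g (a * x + b) | c g. smooth g}. \<forall>x. (h has_vector_derivative f' x) (at x)"
    using smooth_vderiv[OF g]
    by (intro bexI[of _ "\<lambda>x. (c * of_real a) * vderiv g (a * x + b)"]) auto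
qed

lemma funpow_vderiv_affine:
  assumes "smooth f"
  shows "(vderiv ^^ n) (\<lambda>x. f (a * x + b)) = (\<lambda>x. of_real a ^ n * (vderiv ^^ n) f (a * x + b))"
proof (induction n)
  case (Suc n)
  have "vderiv (\<lambda>x. of_real a ^ n * (vderiv ^^ n) f (a * x + b)) x
      = of_real a ^ Suc n * (vderiv ^^ Suc n) f (a * x + b)" for x
    using has_vector_derivative_mult_right
      [OF has_vderiv_affine[OF smooth_has_vderiv[OF smooth_funpow[OF assms]]], of "of_real a ^ n" n a b x]
    by (intro vderiv_I) (simp add: mult_ac)
  then show ?case by (simp add: Suc)
qed simp

lemma funpow_vderiv_local:
  assumes "open U" and "\<And>x. x \<in> U \<Longrightarrow> f x = g x" and "x \<in> U"
  shows "(vderiv ^^ n) f x = (vderiv ^^ n) g x"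
  using assms(3)
proof (induction n arbitrary: x)
  case (Suc n)
  have "eventually (\<lambda>y. y \<in> U) (nhds x)" using assms(1) Suc.prems eventually_nhds by blast
  then have "eventually (\<lambda>y. (vderiv ^^ n) f y = (vderiv ^^ n) g y) (nhds x)"
    by eventually_elim (rule Suc.IH)
  then have "((vderiv ^^ n) f has_vector_derivative d) (at x) \<longleftrightarrow>
      ((vderiv ^^ n) g has_vector_derivative d) (at x)" for d
    by (intro has_vector_derivative_cong_ev) (auto simp: Suc)
  then have "vector_derivative ((vderiv ^^ n) f) (at x) = vector_derivative ((vderiv ^^ n) g) (at x)"
    unfolding vector_derivative_def by simp
  then show ?case
    by (simp add: vderiv_def[of "(vderiv ^^ n) _"])
qed (use assms in simp)

lemma funpow_vderiv_zero [simp]: "(vderiv ^^ n) (\<lambda>x. 0) = (\<lambda>x. 0)"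
  by (induction n) auto

lemma funpow_vderiv_eq_0:
  assumes "open U" and "\<And>x. x \<in> U \<Longrightarrow> f x = 0" and "x \<in> U"
  shows "(vderiv ^^ n) f x = 0"
  using funpow_vderiv_local[OF assms(1), of f "\<lambda>x. 0" x n] assms by simp

lemma funpow_vderiv_supp:
  assumes "\<And>x. x \<notin> {a..b} \<Longrightarrow> f x = 0" and "x \<notin> {a..b}"
  shows "(vderiv ^^ n) f x = 0"
  by (rule funpow_vderiv_eq_0[of "- {a..b}"]) (use assms in auto)

section \<open>Test functions\<close>

lemma tsupp_subset: "(\<And>x. x \<notin> {a..b} \<Longrightarrow> f x = 0) \<Longrightarrow> tsupp f \<subseteq> {a..b::real}"
  unfolding tsupp_def by (rule closure_minimal) (blast, simp)

lemma not_in_tsupp: "x \<notin> tsupp f \<Longrightarrow> f x = 0"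
  using closure_subset[of "{x. f x \<noteq> 0}"] by (auto simp: tsupp_def)

lemma test_functionI: "smooth f \<Longrightarrow> (\<And>x. x \<notin> {a..b} \<Longrightarrow> f x = 0) \<Longrightarrow> test_function f"
  unfolding test_function_def using tsupp_subset[of a b f] compact_Int_closed[of "{a..b}" "tsupp f"]
  by (simp add: tsupp_def Int_absorb1)

lemma test_functionE:
  assumes "test_function f"
  obtains R where "R > 0" "\<And>x. x \<notin> {-R..R} \<Longrightarrow> f x = 0" "tsupp f \<subseteq> {-R..R}"
proof -
  obtain R where R: "R > 0" "\<forall>x\<in>tsupp f. norm x \<le> R"
    using assms compact_imp_bounded bounded_pos unfolding test_function_def by metis
  have "f x = 0" if "x \<notin> {-R..R}" for x
    using R(2) that not_in_tsupp[of x f] by fastforce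
  moreover have "tsupp f \<subseteq> {-R..R}" using R by fastforce
  ultimately show ?thesis using R(1) that by blast
qed

lemma test_smooth: "test_function f \<Longrightarrow> smooth f" by (simp add: test_function_def)

lemma test_function_add:
  assumes "test_function f" "test_function g" shows "test_function (\<lambda>x. f x + g x)"
proof -
  obtain R where R: "\<And>x. x \<notin> {-R..R} \<Longrightarrow> f x = 0" using assms(1) test_functionE by metis
  obtain S where S: "\<And>x. x \<notin> {-S..S} \<Longrightarrow> g x = 0" using assms(2) test_functionE by metis
  show ?thesis
  proof (rule test_functionI[of _ "- max R S" "max R S"])
    show "smooth (\<lambda>x. f x + g x)" by (intro smooth_add assms[THEN test_smooth])
    show "f x + g x = 0" if "x \<notin> {- max R S..max R S}" for x 
    proof -
      have "x \<notin> {-R..R}" "x \<notin> {-S..S}" using that by auto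
      then show ?thesis by (simp add: R S)
    qed
  qed
qed

lemma test_function_mult:
  assumes "test_function f" "smooth g" shows "test_function (\<lambda>x. g x * f x)"
proof -
  obtain R where R: "\<And>x. x \<notin> {-R..R} \<Longrightarrow> f x = 0" using assms(1) test_functionE by metis
  show ?thesis
    by (rule test_functionI[of _ "- R" R]) (auto simp: R intro!: smooth_mult assms(2) test_smooth[OF assms(1)])
qed

lemma test_function_cmult: "test_function f \<Longrightarrow> test_function (\<lambda>x. c * f x)"
  by (rule test_function_mult) auto

lemma test_function_minus: "test_function f \<Longrightarrow> test_function (\<lambda>x. - f x)"
  using test_function_cmult[of f "-1"] by simp

lemma test_function_diff: "test_function f \<Longrightarrow> test_function g \<Longrightarrow> test_function (\<lambda>x. f x - g x)"
  using test_function_add[of f "\<lambda>x. - g x"] test_function_minus by simp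

lemma test_function_funpow:
  assumes "test_function f" shows "test_function ((vderiv ^^ n) f)"
proof -
  obtain R where R: "\<And>x. x \<notin> {-R..R} \<Longrightarrow> f x = 0" using assms(1) test_functionE by metis
  show ?thesis
    by (rule test_functionI[of _ "- R" R]) (intro smooth_funpow test_smooth[OF assms], rule funpow_vderiv_supp[OF R])
qed

lemma test_function_vderiv: "test_function f \<Longrightarrow> test_function (vderiv f)"
  using test_function_funpow[of f 1] by simp

lemma test_function_affine:
  assumes "test_function f" "a \<noteq> 0" shows "test_function (\<lambda>x. f (a * x + b))"
proof -
  obtain R where R: "\<And>x. x \<notin> {-R..R} \<Longrightarrow> f x = 0" using assms(1) test_functionE by metis
  have "f (a * x + b) = 0" if "x \<notin> {- ((R+\<bar>b\<bar>)/\<bar>a\<bar>) .. (R+\<bar>b\<bar>)/\<bar>a\<bar>}" for x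
  proof (rule R)
    have "\<not> \<bar>x\<bar> \<le> (R+\<bar>b\<bar>)/\<bar>a\<bar>" using that by (simp add: abs_le_iff minus_le_iff) (smt (verit) minus_divide_left)
    then have "\<bar>a * x\<bar> > R + \<bar>b\<bar>" using assms(2) by (simp add: field_simps abs_mult)
    then show "a * x + b \<notin> {-R..R}" by auto
  qed
  then show ?thesis
    by (intro test_functionI smooth_affine test_smooth[OF assms(1)])
qed

lemma tsupp_funpow_subset: "tsupp ((vderiv ^^ n) f) \<subseteq> tsupp f"
proof -
  have "(vderiv ^^ n) f x = 0" if "x \<notin> tsupp f" for x
  proof (rule funpow_vderiv_eq_0[of "- tsupp f"])
    show "open (- tsupp f)" by (simp add: open_Compl tsupp_def)
    show "x \<in> - tsupp f" using that by simp
    show "f y = 0" if "y \<in> - tsupp f" for y using that by (intro not_in_tsupp) simp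
  qed
  then have "{x. (vderiv ^^ n) f x \<noteq> 0} \<subseteq> tsupp f" by blast
  then show ?thesis unfolding tsupp_def[of "(vderiv ^^ n) f"]
    by (rule closure_minimal) (simp add: tsupp_def)
qed

lemma tsupp_vderiv_subset: "tsupp (vderiv f) \<subseteq> tsupp f"
  using tsupp_funpow_subset[of 1 f] by simp

lemma test_bounded:
  assumes "test_function f"
  obtains M where "M \<ge> 0" "\<And>x. norm (f x) \<le> M"
proof -
  obtain R where R: "\<And>x. x \<notin> {-R..R} \<Longrightarrow> f x = 0" using assms(1) test_functionE by metis
  have "compact (f ` {-R..R})" by (intro compact_continuous_image smooth_continuous test_smooth assms) auto
  then obtain M where "M > 0" "\<forall>y\<in>f ` {-R..R}. norm y \<le> M" using compact_imp_bounded bounded_pos by metis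
  then have "norm (f x) \<le> M" for x by (cases "x \<in> {-R..R}") (auto simp: R)
  with \<open>M > 0\<close> show ?thesis using that[of M] by simp
qed

section \<open>Integrals of compactly supported functions\<close>

lemma compact_support_integral:
  fixes f :: "real \<Rightarrow> complex"
  assumes "continuous_on {a..b} f" and "\<And>x. x \<notin> {a..b} \<Longrightarrow> f x = 0"
  shows "integrable lebesgue f" and "(LINT x|lebesgue. f x) = integral {a..b} f"
proof -
  have "f absolutely_integrable_on {a..b}" by (rule absolutely_integrable_continuous_real[OF assms(1)])
  moreover have "(\<lambda>x. indicator {a..b} x *\<^sub>R f x) = f"
    using assms(2) by (auto simp: indicator_def fun_eq_iff)
  ultimately show "integrable lebesgue f" "(LINT x|lebesgue. f x) = integral {a..b} f"
    using set_lebesgue_integral_eq_integral(2)[of "{a..b}" f]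
    by (simp_all add: set_integrable_def set_lebesgue_integral_def)
qed

lemma test_continuous: "test_function f \<Longrightarrow> continuous_on S f"
  by (rule smooth_continuous[OF test_smooth])

lemma test_integrable:
  assumes "test_function \<phi>" "continuous_on UNIV F"
  shows "integrable lebesgue (\<lambda>x. F x * \<phi> x)"
proof -
  obtain R where R: "\<And>x. x \<notin> {-R..R} \<Longrightarrow> \<phi> x = 0" using assms(1) test_functionE by metis
  show ?thesis
  proof (rule compact_support_integral(1)[of "-R" R])
    show "continuous_on {-R..R} (\<lambda>x. F x * \<phi> x)"
      by (intro continuous_on_mult test_continuous assms continuous_on_subset[OF assms(2)]) auto
  qed (simp add: R)
qed

lemma test_integrable1: "test_function \<phi> \<Longrightarrow> integrable lebesgue \<phi>"
  using test_integrable[of \<phi> "\<lambda>x. 1"] by simp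

lemma LINT_vderiv_eq_0:
  assumes "test_function f" shows "(LINT x|lebesgue. vderiv f x) = 0"
proof -
  obtain R where R: "R > 0" "\<And>x. x \<notin> {-R..R} \<Longrightarrow> f x = 0" using assms test_functionE by metis
  have s: "smooth f" using assms by (rule test_smooth)
  have "(LINT x|lebesgue. vderiv f x) = integral {-(R+1)..R+1} (vderiv f)"
    by (rule compact_support_integral(2))
       (use funpow_vderiv_supp[of "-R" R f _ 1] R in \<open>auto intro!: smooth_continuous smooth_vderiv s\<close>)
  also have "\<dots> = f (R+1) - f (-(R+1))"
    by (rule integral_unique, rule fundamental_theorem_of_calculus)
       (use R(1) in \<open>auto intro!: smooth_has_vderiv_within s\<close>)
  finally show ?thesis using R by simp
qed

lemma primitive_compact_support:
  fixes G :: "real \<Rightarrow> complex"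
  assumes cont: "continuous_on UNIV G" and supp: "\<And>x. x \<notin> {a..b} \<Longrightarrow> G x = 0"
  shows "((\<lambda>x. integral {a..x} G) has_vector_derivative G x) (at x)"
    and "x \<ge> b \<Longrightarrow> integral {a..x} G = (LINT y|lebesgue. G y)"
proof -
  have i: "G integrable_on {c..d}" for c d
    by (intro integrable_continuous_real continuous_on_subset[OF cont]) simp
  have z: "integral {c..d} G = 0" if "d \<le> a" for c d
  proof -
    have "integral {c..d} G = integral {c..d} (\<lambda>x. 0)"
    proof (rule integral_spike[of "{a}"])
      show "0 = G x" if "x \<in> {c..d} - {a}" for x
        using that \<open>d \<le> a\<close> by (simp add: supp)
    qed simp
    then show ?thesis by simp
  qed
  have eq: "integral {a..y} G = integral {c..y} G" if "c \<le> a" "c \<le> y" for c y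
  proof (cases "y < a")
    case False
    then show ?thesis
      using Henstock_Kurzweil_Integration.integral_combine[OF that(1) _ i, of y] z[of a c] by simp
  qed (simp add: z)
  define c where "c = min (x - 1) a"
  have "((\<lambda>u. integral {c..u} G) has_vector_derivative G x) (at x within {c..x+1})"
    by (rule integral_has_vector_derivative) (auto intro: continuous_on_subset[OF cont] simp: c_def)
  then have "((\<lambda>u. integral {c..u} G) has_vector_derivative G x) (at x)"
    by (subst (asm) at_within_interior) (auto simp: c_def min_def)
  then show "((\<lambda>x. integral {a..x} G) has_vector_derivative G x) (at x)"
    by (rule has_vector_derivative_transform_within_open[of _ _ _ "{c<..}"])
       (use eq[of c] in \<open>auto simp: c_def\<close>)
  show "integral {a..x} G = (LINT y|lebesgue. G y)" if "x \<ge> b"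
    by (rule compact_support_integral(2)[symmetric])
       (use that in \<open>auto intro: continuous_on_subset[OF cont] supp\<close>)
qed

lemma integral_by_parts_test:
  assumes F: "smooth F" and \<phi>: "test_function \<phi>"
  shows "(LINT x|lebesgue. F x * vderiv \<phi> x) = - (LINT x|lebesgue. vderiv F x * \<phi> x)"
proof -
  have "0 = (LINT x|lebesgue. vderiv (\<lambda>x. F x * \<phi> x) x)"
    using LINT_vderiv_eq_0[OF test_function_mult[OF \<phi> F]] by simp
  also have "\<dots> = (LINT x|lebesgue. F x * vderiv \<phi> x + vderiv F x * \<phi> x)"
    by (simp add: vderiv_mult F test_smooth[OF \<phi>])
  also have "\<dots> = (LINT x|lebesgue. F x * vderiv \<phi> x) + (LINT x|lebesgue. vderiv F x * \<phi> x)"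
    by (rule Bochner_Integration.integral_add)
       (intro test_integrable \<phi> test_function_vderiv smooth_continuous F smooth_vderiv)+
  finally show ?thesis by (simp add: eq_neg_iff_add_eq_0)
qed

lemma integral_by_parts_test_funpow:
  assumes "smooth F" and \<phi>: "test_function \<phi>"
  shows "(LINT x|lebesgue. F x * (vderiv ^^ (n + m)) \<phi> x)
       = (-1) ^ m * (LINT x|lebesgue. (vderiv ^^ m) F x * (vderiv ^^ n) \<phi> x)"
  using assms(1)
proof (induction m arbitrary: F)
  case (Suc m)
  have "(LINT x|lebesgue. F x * (vderiv ^^ (n + Suc m)) \<phi> x)
      = - (LINT x|lebesgue. vderiv F x * (vderiv ^^ (n + m)) \<phi> x)"
    using integral_by_parts_test[OF Suc.prems test_function_funpow[OF \<phi>], of "n + m"] by simp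
  also have "\<dots> = - ((-1) ^ m * (LINT x|lebesgue. (vderiv ^^ m) (vderiv F) x * (vderiv ^^ n) \<phi> x))"
    by (simp only: Suc.IH[OF smooth_vderiv[OF Suc.prems]])
  finally show ?case by (simp add: funpow_swap1)
qed simp

lemma norm_LINT_le_test:
  assumes \<psi>: "test_function \<psi>" and "\<And>x. \<psi> x \<noteq> 0 \<Longrightarrow> norm (F x) \<le> M" and "M \<ge> 0"
  shows "norm (LINT x|lebesgue. F x * \<psi> x) \<le> M * (LINT x|lebesgue. norm (\<psi> x))"
proof (cases "integrable lebesgue (\<lambda>x. F x * \<psi> x)")
  case True
  have "norm (LINT x|lebesgue. F x * \<psi> x) \<le> (LINT x|lebesgue. norm (F x * \<psi> x))"
    by (rule integral_norm_bound)
  also have "\<dots> \<le> (LINT x|lebesgue. M * norm (\<psi> x))"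
  proof (rule integral_mono)
    show "norm (F x * \<psi> x) \<le> M * norm (\<psi> x)" for x
      using assms(2)[of x] by (cases "\<psi> x = 0") (auto simp: norm_mult intro: mult_right_mono)
  qed (use True test_integrable1[OF \<psi>] in auto)
  finally show ?thesis by simp
next
  case False
  then show ?thesis using \<open>M \<ge> 0\<close> by (simp add: not_integrable_integral_eq)
qed

section \<open>A bump function and a smooth step\<close>

text \<open>The functions \<open>x\<^sup>-\<^sup>n exp (-1/x)\<close>, extended by \<open>0\<close> to the left half-line; their derivatives are
  linear combinations of functions of the same kind.\<close>

definition exp_decay :: "nat \<Rightarrow> real \<Rightarrow> real" where
  "exp_decay n x = (if x > 0 then (1 / x) ^ n * exp (- 1 / x) else 0)"

lemma exp_decay_limit_0: "(exp_decay n \<longlongrightarrow> 0) (at 0)"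
proof -
  have "((\<lambda>y. y ^ n / exp y) \<longlongrightarrow> (0::real)) at_top" by (rule tendsto_power_div_exp_0)
  then have "((\<lambda>x. inverse x ^ n / exp (inverse x)) \<longlongrightarrow> (0::real)) (at_right 0)"
    by (rule filterlim_compose[OF _ filterlim_inverse_at_top_right])
  then have "(exp_decay n \<longlongrightarrow> 0) (at_right 0)"
    by (rule Lim_transform_eventually)
       (auto simp: exp_decay_def eventually_at_filter exp_minus field_simps)
  moreover have "(exp_decay n \<longlongrightarrow> 0) (at_left 0)"
    by (rule Lim_transform_eventually[OF tendsto_const])
       (auto simp: exp_decay_def eventually_at_filter)
  ultimately show ?thesis by (simp add: filterlim_split_at)
qed

lemma exp_decay_deriv:
  "(exp_decay n has_real_derivative - real n * exp_decay (Suc n) x + exp_decay (Suc (Suc n)) x) (at x)"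
proof (cases x "0::real" rule: linorder_cases)
  case less
  have "((\<lambda>x. 0) has_real_derivative 0) (at x)" by simp
  moreover have "- real n * exp_decay (Suc n) x + exp_decay (Suc (Suc n)) x = 0"
    using less by (simp add: exp_decay_def)
  ultimately show ?thesis
    by (metis (no_types, lifting) DERIV_cong has_field_derivative_transform_within_open[of "\<lambda>x. 0" 0 x "{..<0}" "exp_decay n"]
        exp_decay_def lessThan_iff less less_asym open_lessThan)
next
  case equal
  have "((\<lambda>h. exp_decay n h / h) \<longlongrightarrow> 0) (at 0)"
    by (rule Lim_transform_eventually[OF exp_decay_limit_0[of "Suc n"]])
       (auto simp: exp_decay_def eventually_at_filter field_simps)
  then have "(exp_decay n has_real_derivative 0) (at 0)"
    by (simp add: DERIV_def exp_decay_def)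
  then show ?thesis using equal by (simp add: exp_decay_def)
next
  case greater
  have "((\<lambda>x. (1 / x) ^ n * exp (- 1 / x)) has_real_derivative
      - real n * exp_decay (Suc n) x + exp_decay (Suc (Suc n)) x) (at x)"
  proof -
    have "x ^ k = x * x ^ (k - Suc 0)" if "k > 0" for k
      using power_minus_mult[OF that, of x] by (simp add: mult.commute)
    then show ?thesis using greater
      by (cases n) (auto intro!: derivative_eq_intros simp: exp_decay_def field_simps power2_eq_square, blast)
  qed
  then show ?thesis
    by (rule has_field_derivative_transform_within_open[of _ _ _ "{0<..}"])
       (use greater in \<open>auto simp: exp_decay_def\<close>)
qed

lemma smooth_exp_decay: "smooth (\<lambda>x. of_real (exp_decay n x))"
proof -
  let ?S = "range (\<lambda>n x. of_real (exp_decay n x))"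
  have "smooth f" if "f \<in> alg ?S" for f
    using that
  proof (rule smooth_alg)
    fix f :: "real \<Rightarrow> complex" assume "f \<in> ?S"
    then obtain n where f: "f = (\<lambda>x. of_real (exp_decay n x))" by blast
    let ?g = "\<lambda>x. - of_nat n * of_real (exp_decay (Suc n) x) + of_real (exp_decay (Suc (Suc n)) x) :: complex"
    have "(f has_vector_derivative ?g x) (at x)" for x
      using has_vector_derivative_of_real[OF exp_decay_deriv[of n x]] unfolding f by simp
    moreover have "?g \<in> alg ?S"
      by (intro alg.add alg.mult alg.const alg.base) auto
    ultimately show "\<exists>f'\<in>alg ?S. \<forall>x. (f has_vector_derivative f' x) (at x)"
      by (intro bexI[of _ ?g] allI)
  qed
  then show ?thesis by (blast intro: alg.base)
qed

text \<open>A smooth function that is positive exactly on \<open>(-1,1)\<close>, not yet normalised.\<close>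

definition raw_bump :: "real \<Rightarrow> real" where
  "raw_bump x = exp_decay 0 (1 + x) * exp_decay 0 (1 - x)"

text \<open>A nonnegative test function with support in \<open>[-1,1]\<close> and integral \<open>1\<close>; it serves as the
  mollifier throughout.\<close>

definition bump :: "real \<Rightarrow> complex" where
  "bump x = of_real (raw_bump x / (LINT y|lebesgue. raw_bump y))"

text \<open>The primitive of \<^const>\<open>bump\<close> that vanishes on the left: a smooth step from \<open>0\<close> to \<open>1\<close>. For
  \<open>x < -1\<close> the interval is empty and the integral is \<open>0\<close>, as it should be.\<close>

definition step :: "real \<Rightarrow> complex" where
  "step x = integral {-1..x} bump"

lemma smooth_raw_bump: "smooth (\<lambda>x. of_real (raw_bump x))"
  using smooth_mult[OF smooth_affine[OF smooth_exp_decay, of 0 1 1] smooth_affine[OF smooth_exp_decay, of 0 "-1" 1]]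
  by (simp add: raw_bump_def add.commute)

lemma raw_bump_nonneg: "raw_bump x \<ge> 0"
  by (simp add: raw_bump_def exp_decay_def)

lemma raw_bump_eq_0_iff: "raw_bump x = 0 \<longleftrightarrow> x \<notin> {-1<..<1}"
  by (auto simp: raw_bump_def exp_decay_def)

lemma raw_bump_zero: "x \<notin> {-1..1} \<Longrightarrow> raw_bump x = 0"
  by (auto simp: raw_bump_eq_0_iff)

lemma raw_bump_integral:
  "(LINT y|lebesgue. raw_bump y) > 0"
proof -
  have c: "continuous_on S raw_bump" for S
    using continuous_on_Re[OF smooth_continuous[OF smooth_raw_bump, of S]] by simp
  have t: "test_function (\<lambda>x. of_real (raw_bump x))"
    by (rule test_functionI[OF smooth_raw_bump, of "-1" 1]) (simp add: raw_bump_zero)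
  have "complex_of_real (LINT y|lebesgue. raw_bump y) = (LINT y|lebesgue. of_real (raw_bump y))"
    by simp
  also have "\<dots> = integral {-1..1} (\<lambda>y. of_real (raw_bump y))"
    by (rule compact_support_integral(2)) (intro smooth_continuous smooth_raw_bump, simp add: raw_bump_zero)
  also have "\<dots> = of_real (integral {-1..1} raw_bump)"
    using integral_linear[OF integrable_continuous_real[OF c[of "{-1..1}"]] bounded_linear_of_real[where 'a = complex]]
    by (simp add: o_def)
  finally have eq: "(LINT y|lebesgue. raw_bump y) = integral {-1..1} raw_bump"
    using of_real_eq_iff by blast
  have "integral {-1..1} raw_bump \<ge> 0" by (simp add: integral_nonneg integrable_continuous_real[OF c] raw_bump_nonneg)
  moreover have "integral {-1..1} raw_bump \<noteq> 0"
    using integral_eq_0_iff[OF c, of "-1" 1] raw_bump_nonneg raw_bump_eq_0_iff[of 0]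
    by force
  ultimately show ?thesis by (simp add: eq)
qed

lemma smooth_bump: "smooth bump"
  using smooth_mult[OF smooth_const[of "of_real (inverse (LINT y|lebesgue. raw_bump y))"] smooth_raw_bump]
  by (simp add: bump_def[abs_def] field_simps)

lemma bump_zero: "x \<notin> {-1..1} \<Longrightarrow> bump x = 0"
  by (simp add: bump_def raw_bump_zero)

lemma test_bump: "test_function bump"
  by (rule test_functionI[OF smooth_bump bump_zero])

lemma LINT_bump: "(LINT x|lebesgue. bump x) = 1"
  using raw_bump_integral by (simp add: bump_def[abs_def] del: of_real_divide)

lemma bump_real: "bump x \<in> \<real>" by (simp add: bump_def)

lemma norm_bump: "norm (bump x) = Re (bump x)"
  using raw_bump_nonneg[of x] raw_bump_integral by (simp add: bump_def norm_divide)

lemma LINT_norm_bump: "(LINT x|lebesgue. norm (bump x)) = 1"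
proof -
  have "(LINT x|lebesgue. Re (bump x)) = Re (LINT x|lebesgue. bump x)"
    by (rule integral_Re) (rule test_integrable1[OF test_bump])
  then show ?thesis by (simp add: norm_bump LINT_bump)
qed

lemma step_deriv: "(step has_vector_derivative bump x) (at x)"
  unfolding step_def[abs_def]
  by (rule primitive_compact_support(1)[of bump "-1" 1]) (auto intro: test_continuous test_bump bump_zero)

lemma vderiv_step: "vderiv step = bump"
  by (intro ext vderiv_I step_deriv)

lemma smooth_step: "smooth step"
  by (subst smooth_iff) (use step_deriv differentiableI_vector in \<open>auto simp: vderiv_step smooth_bump\<close>)

lemma step_0: "x \<le> -1 \<Longrightarrow> step x = 0"
  by (cases "x = -1") (auto simp: step_def)

lemma step_1: "x \<ge> 1 \<Longrightarrow> step x = 1"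
  unfolding step_def
  by (subst primitive_compact_support(2)[OF test_continuous[OF test_bump] bump_zero]) (simp_all add: LINT_bump)

text \<open>Real-valuedness passes to derivatives; hence the squares below have positive integral.\<close>

lemma funpow_vderiv_real:
  assumes "smooth f" "\<And>x. f x \<in> \<real>" shows "(vderiv ^^ n) f x \<in> \<real>"
proof (induction n arbitrary: x)
  case (Suc n)
  have "((\<lambda>x. Im ((vderiv ^^ n) f x)) has_vector_derivative Im (vderiv ((vderiv ^^ n) f) x)) (at x)"
    using bounded_linear.has_vector_derivative[OF bounded_linear_Im smooth_has_vderiv[OF smooth_funpow[OF assms(1)]]] .
  moreover have "(\<lambda>x. Im ((vderiv ^^ n) f x)) = (\<lambda>x. 0)"
    using Suc by (auto simp: complex_is_Real_iff)
  ultimately have "Im (vderiv ((vderiv ^^ n) f) x) = 0"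
    by (metis has_vector_derivative_const vector_derivative_unique_at)
  then show ?case by (simp add: complex_is_Real_iff)
qed (use assms in simp)

lemma vderiv_eq_0_imp:
  assumes "test_function f" "\<And>x. vderiv f x = 0" shows "f x = 0"
proof -
  obtain R where R: "R > 0" "\<And>x. x \<notin> {-R..R} \<Longrightarrow> f x = 0" using assms(1) test_functionE by metis
  obtain c where "\<And>x. x \<in> UNIV \<Longrightarrow> f x = c"
    using has_derivative_zero_constant[of UNIV f] smooth_has_vderiv[OF test_smooth[OF assms(1)]]
    by (auto simp: has_vector_derivative_def assms(2))
  then show ?thesis using R(2)[of "R+1"] by simp
qed

lemma LINT_bump_deriv_sq: "(LINT x|lebesgue. (vderiv ^^ n) bump x * (vderiv ^^ n) bump x) \<noteq> 0"
proof -
  let ?f = "(vderiv ^^ n) bump"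
  let ?g = "\<lambda>x. Re (?f x) * Re (?f x)"
  have z: "?f x = 0" if "x \<notin> {-1..1}" for x by (rule funpow_vderiv_supp[OF bump_zero that])
  have c: "continuous_on S ?f" for S by (intro smooth_continuous smooth_funpow smooth_bump)
  have cg: "continuous_on S ?g" for S by (intro continuous_intros c)
  have eq: "?f x * ?f x = of_real (?g x)" for x
    using funpow_vderiv_real[OF smooth_bump bump_real, of n x] by (simp add: complex_is_Real_iff complex_eq_iff)
  have "(LINT x|lebesgue. ?f x * ?f x) = integral {-1..1} (\<lambda>x. ?f x * ?f x)"
    by (rule compact_support_integral(2)) (use z in \<open>auto intro!: continuous_intros c\<close>)
  also have "\<dots> = of_real (integral {-1..1} ?g)"
    unfolding eq
    using integral_linear[OF integrable_continuous_real[OF cg[of "{-1..1}"]] bounded_linear_of_real[where 'a = complex]]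
    by (simp add: o_def)
  finally have *: "(LINT x|lebesgue. ?f x * ?f x) = of_real (integral {-1..1} ?g)" .
  have "\<exists>x. ?f x \<noteq> 0"
  proof (induction n)
    case 0
    show ?case using raw_bump_eq_0_iff[of 0] raw_bump_integral by (auto simp: bump_def intro!: exI[of _ 0])
  next
    case (Suc n)
    then show ?case using vderiv_eq_0_imp[OF test_function_funpow[OF test_bump, of n]] by auto
  qed
  then obtain x where x: "?f x \<noteq> 0" by blast
  then have "x \<in> {-1..1}" using z by blast
  moreover have "?g x \<noteq> 0" using eq[of x] x by auto
  ultimately have "integral {-1..1} ?g \<noteq> 0"
    using integral_eq_0_iff[OF cg, of "-1" 1] by force
  then show ?thesis by (simp add: *)
qed

section \<open>Distributions acting on families of test functions\<close>

lemma distribution_add: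
  "distribution u \<Longrightarrow> test_function \<phi> \<Longrightarrow> test_function \<psi> \<Longrightarrow> u (\<lambda>x. \<phi> x + \<psi> x) = u \<phi> + u \<psi>"
  by (simp add: distribution_def)

lemma distribution_cmult: "distribution u \<Longrightarrow> test_function \<phi> \<Longrightarrow> u (\<lambda>x. c * \<phi> x) = c * u \<phi>"
  by (simp add: distribution_def)

lemma distribution_minus: "distribution u \<Longrightarrow> test_function \<phi> \<Longrightarrow> u (\<lambda>x. - \<phi> x) = - u \<phi>"
  using distribution_cmult[of u \<phi> "-1"] by simp

lemma distribution_diff:
  "distribution u \<Longrightarrow> test_function \<phi> \<Longrightarrow> test_function \<psi> \<Longrightarrow> u (\<lambda>x. \<phi> x - \<psi> x) = u \<phi> - u \<psi>"
  using distribution_add[of u \<phi> "\<lambda>x. - \<psi> x"] distribution_minus[of u \<psi>] test_function_minus[of \<psi>] by simp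

lemma test_zero: "test_function (\<lambda>x. 0)"
  by (rule test_functionI[of _ 0 0]) auto

lemma distribution_zero: "distribution u \<Longrightarrow> u (\<lambda>x. 0) = 0"
  using distribution_cmult[of u "\<lambda>x. 0" 0] test_zero by simp

text \<open>The seminorm estimate for supports in a fixed interval, with the sum of suprema replaced by one
  common bound \<open>M\<close> on the derivatives up to order \<open>N\<close>.\<close>

lemma distribution_bound:
  assumes "distribution u"
  obtains C N where "C \<ge> 0"
    "\<And>\<phi> M. test_function \<phi> \<Longrightarrow> (\<And>x. x \<notin> {-R..R} \<Longrightarrow> \<phi> x = 0) \<Longrightarrow>
       (\<And>k x. k \<le> N \<Longrightarrow> norm ((vderiv ^^ k) \<phi> x) \<le> M) \<Longrightarrow> norm (u \<phi>) \<le> C * M"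
proof -
  obtain C N where CN: "\<And>\<phi>. test_function \<phi> \<Longrightarrow> tsupp \<phi> \<subseteq> {-R..R} \<Longrightarrow>
      norm (u \<phi>) \<le> C * (\<Sum>k\<le>(N::nat). SUP x. norm ((vderiv ^^ k) \<phi> x))"
  proof -
    have "\<forall>K. compact K \<longrightarrow> (\<exists>C N. \<forall>\<phi>. test_function \<phi> \<longrightarrow> tsupp \<phi> \<subseteq> K \<longrightarrow>
           norm (u \<phi>) \<le> C * (\<Sum>k\<le>(N::nat). SUP x. norm ((vderiv ^^ k) \<phi> x)))"
      using assms unfolding distribution_def by (elim conjE)
    from this[rule_format, OF compact_Icc[of "-R" R]] show ?thesis using that by blast
  qed
  have "norm (u \<phi>) \<le> (\<bar>C\<bar> * (real N + 1)) * M"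
    if \<phi>: "test_function \<phi>" and supp: "\<And>x. x \<notin> {-R..R} \<Longrightarrow> \<phi> x = 0"
      and M: "\<And>k x. k \<le> N \<Longrightarrow> norm ((vderiv ^^ k) \<phi> x) \<le> M" for \<phi> M
  proof -
    let ?S = "\<Sum>k\<le>N. SUP x. norm ((vderiv ^^ k) \<phi> x)"
    have le: "(SUP x. norm ((vderiv ^^ k) \<phi> x)) \<le> M" if "k \<le> N" for k
      by (rule cSUP_least) (use M that in auto)
    have ge: "0 \<le> (SUP x. norm ((vderiv ^^ k) \<phi> x))" if "k \<le> N" for k
    proof -
      have "bdd_above (range (\<lambda>x. norm ((vderiv ^^ k) \<phi> x)))"
        using M[OF that] by (auto intro!: bdd_aboveI)
      then have "norm ((vderiv ^^ k) \<phi> 0) \<le> (SUP x. norm ((vderiv ^^ k) \<phi> x))"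
        by (rule cSUP_upper[rotated]) simp
      then show ?thesis by (rule order_trans[OF norm_ge_zero])
    qed
    have "norm (u \<phi>) \<le> C * ?S" using CN[OF \<phi> tsupp_subset[OF supp]] by simp
    also have "\<dots> \<le> \<bar>C\<bar> * ?S" by (intro mult_right_mono sum_nonneg ge) auto
    also have "\<dots> \<le> \<bar>C\<bar> * (\<Sum>k\<le>N. M)" by (intro mult_left_mono sum_mono le) auto
    finally show ?thesis by (simp add: mult.assoc add.commute)
  qed
  then show ?thesis using that[of "\<bar>C\<bar> * (real N + 1)" N] by simp
qed

text \<open>Finitely many constants, each of which may be enlarged, have a common upper bound.\<close>

lemma uniform_const:
  assumes "\<And>n. \<exists>L. P n (L::real)" and "\<And>n L L'. P n L \<Longrightarrow> L \<le> L' \<Longrightarrow> P n L'"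
  shows "\<exists>L\<ge>0. \<forall>n\<le>(N::nat). P n L"
proof (induction N)
  case 0
  obtain L where "P 0 L" using assms(1) by blast
  then have "P 0 \<bar>L\<bar>" using assms(2)[of 0 L "\<bar>L\<bar>"] by simp
  then show ?case by (intro exI[of _ "\<bar>L\<bar>"]) simp
next
  case (Suc N)
  then obtain L where L: "L \<ge> 0" "\<forall>n\<le>N. P n L" by blast
  obtain L' where L': "P (Suc N) L'" using assms(1) by blast
  have "P n (max L L')" if "n \<le> Suc N" for n
    using that L L' by (cases "n = Suc N") (auto intro: assms(2)[of _ L'] assms(2)[of _ L])
  then show ?case using L(1) by (intro exI[of _ "max L L'"]) auto
qed

lemma distribution_family_lipschitz:
  assumes u: "distribution u" and test: "\<And>t. t \<in> T \<Longrightarrow> test_function (\<Gamma> t)"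
    and supp: "\<And>t x. t \<in> T \<Longrightarrow> x \<notin> {-R..R} \<Longrightarrow> \<Gamma> t x = 0"
    and lip: "\<And>n. \<exists>L. \<forall>s\<in>T. \<forall>t\<in>T. \<forall>y. norm ((vderiv ^^ n) (\<Gamma> s) y - (vderiv ^^ n) (\<Gamma> t) y) \<le> L * \<bar>s - t\<bar>"
  shows "\<exists>K. \<forall>s\<in>T. \<forall>t\<in>T. norm (u (\<Gamma> s) - u (\<Gamma> t)) \<le> K * \<bar>s - t\<bar>"
proof -
  obtain C N where C: "C \<ge> 0" and bd: "\<And>\<phi> M. test_function \<phi> \<Longrightarrow> (\<And>x. x \<notin> {-R..R} \<Longrightarrow> \<phi> x = 0) \<Longrightarrow>
       (\<And>k x. k \<le> N \<Longrightarrow> norm ((vderiv ^^ k) \<phi> x) \<le> M) \<Longrightarrow> norm (u \<phi>) \<le> C * M"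
    using distribution_bound[OF u, of R] by metis
  have "\<exists>L\<ge>0. \<forall>n\<le>N. \<forall>s\<in>T. \<forall>t\<in>T. \<forall>y. norm ((vderiv ^^ n) (\<Gamma> s) y - (vderiv ^^ n) (\<Gamma> t) y) \<le> L * \<bar>s - t\<bar>"
    by (rule uniform_const[OF lip]) (meson abs_ge_zero mult_right_mono order_trans)
  then obtain L where L: "\<And>n s t y. n \<le> N \<Longrightarrow> s \<in> T \<Longrightarrow> t \<in> T \<Longrightarrow>
      norm ((vderiv ^^ n) (\<Gamma> s) y - (vderiv ^^ n) (\<Gamma> t) y) \<le> L * \<bar>s - t\<bar>" by blast
  have "norm (u (\<Gamma> s) - u (\<Gamma> t)) \<le> C * (L * \<bar>s - t\<bar>)" if "s \<in> T" "t \<in> T" for s t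
  proof -
    have "norm (u (\<lambda>x. \<Gamma> s x - \<Gamma> t x)) \<le> C * (L * \<bar>s - t\<bar>)"
    proof (rule bd)
      show "norm ((vderiv ^^ k) (\<lambda>x. \<Gamma> s x - \<Gamma> t x) x) \<le> L * \<bar>s - t\<bar>" if "k \<le> N" for k x
        using L[OF that \<open>s \<in> T\<close> \<open>t \<in> T\<close>]
          funpow_vderiv_add[OF test_smooth[OF test[OF \<open>s \<in> T\<close>]] smooth_minus[OF test_smooth[OF test[OF \<open>t \<in> T\<close>]]], of k]
          funpow_vderiv_cmult[OF test_smooth[OF test[OF \<open>t \<in> T\<close>]], of k "-1"] by simp
    qed (use that supp test_function_diff test in auto)
    then show ?thesis using distribution_diff[OF u test test] that by simp
  qed
  then show ?thesis by (intro exI[of _ "C * L"]) (simp add: mult.assoc)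
qed

text \<open>Differentiation of a distribution along a one-parameter family of test functions. A Lipschitz
  bound on the parameter derivative makes the difference quotients converge in all derivatives,
  uniformly in the space variable.\<close>

lemma distribution_family_deriv:
  fixes a b :: real
  assumes u: "distribution u" and test: "\<And>t. t \<in> {a..b} \<Longrightarrow> test_function (\<Gamma> t)"
    and test': "\<And>t. t \<in> {a..b} \<Longrightarrow> test_function (\<Gamma>' t)"
    and supp: "\<And>t x. t \<in> {a..b} \<Longrightarrow> x \<notin> {-R..R} \<Longrightarrow> \<Gamma> t x = 0"
    and supp': "\<And>t x. t \<in> {a..b} \<Longrightarrow> x \<notin> {-R..R} \<Longrightarrow> \<Gamma>' t x = 0"
    and deriv: "\<And>n t y. t \<in> {a..b} \<Longrightarrow>
       ((\<lambda>t. (vderiv ^^ n) (\<Gamma> t) y) has_vector_derivative (vderiv ^^ n) (\<Gamma>' t) y) (at t within {a..b})"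
    and lip: "\<And>n. \<exists>L. \<forall>s\<in>{a..b}. \<forall>t\<in>{a..b}. \<forall>y. norm ((vderiv ^^ n) (\<Gamma>' s) y - (vderiv ^^ n) (\<Gamma>' t) y) \<le> L * \<bar>s - t\<bar>"
    and t: "t \<in> {a..b}"
  shows "((\<lambda>t. u (\<Gamma> t)) has_vector_derivative u (\<Gamma>' t)) (at t within {a..b})"
proof -
  obtain C N where C: "C \<ge> 0" and bd: "\<And>\<phi> M. test_function \<phi> \<Longrightarrow> (\<And>x. x \<notin> {-R..R} \<Longrightarrow> \<phi> x = 0) \<Longrightarrow>
       (\<And>k x. k \<le> N \<Longrightarrow> norm ((vderiv ^^ k) \<phi> x) \<le> M) \<Longrightarrow> norm (u \<phi>) \<le> C * M"
    using distribution_bound[OF u, of R] by metis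
  have "\<exists>L\<ge>0. \<forall>n\<le>N. \<forall>s\<in>{a..b}. \<forall>t\<in>{a..b}. \<forall>y. norm ((vderiv ^^ n) (\<Gamma>' s) y - (vderiv ^^ n) (\<Gamma>' t) y) \<le> L * \<bar>s - t\<bar>"
    by (rule uniform_const[OF lip]) (meson abs_ge_zero mult_right_mono order_trans)
  then obtain L where L0: "L \<ge> 0" and L: "\<And>n s t y. n \<le> N \<Longrightarrow> s \<in> {a..b} \<Longrightarrow> t \<in> {a..b} \<Longrightarrow>
      norm ((vderiv ^^ n) (\<Gamma>' s) y - (vderiv ^^ n) (\<Gamma>' t) y) \<le> L * \<bar>s - t\<bar>" by blast
  have est: "norm (u (\<Gamma> s) - u (\<Gamma> t) - (s - t) *\<^sub>R u (\<Gamma>' t)) \<le> C * (L * \<bar>s - t\<bar> * \<bar>s - t\<bar>)" if s: "s \<in> {a..b}" for s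
  proof -
    let ?D = "\<lambda>x. (\<Gamma> s x - \<Gamma> t x) - of_real (s - t) * \<Gamma>' t x"
    have tD: "test_function ?D" by (intro test_function_diff test_function_cmult test test' s t)
    have uD: "u ?D = u (\<Gamma> s) - u (\<Gamma> t) - of_real (s - t) * u (\<Gamma>' t)"
      using distribution_diff[OF u test_function_diff[OF test[OF s] test[OF t]] test_function_cmult[OF test'[OF t]], of "of_real (s - t)"]
        distribution_diff[OF u test[OF s] test[OF t]] distribution_cmult[OF u test'[OF t], of "of_real (s - t)"]
      by simp
    have "norm (u ?D) \<le> C * (L * \<bar>s - t\<bar> * \<bar>s - t\<bar>)"
    proof (rule bd[OF tD])
      show "norm ((vderiv ^^ k) ?D x) \<le> L * \<bar>s - t\<bar> * \<bar>s - t\<bar>" if k: "k \<le> N" for k x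
      proof -
        have eq: "(vderiv ^^ k) ?D x = (vderiv ^^ k) (\<Gamma> s) x - (vderiv ^^ k) (\<Gamma> t) x - (s - t) *\<^sub>R (vderiv ^^ k) (\<Gamma>' t) x"
        proof -
          have sm: "smooth (\<Gamma> s)" "smooth (\<lambda>x. - 1 * \<Gamma> t x)" "smooth (\<lambda>x. (- of_real (s - t)) * \<Gamma>' t x)"
            by (intro smooth_mult smooth_const test_smooth test test' s t)+
          have "?D = (\<lambda>x. (\<Gamma> s x + - 1 * \<Gamma> t x) + (- of_real (s - t)) * \<Gamma>' t x)" by (auto simp: algebra_simps)
          then show ?thesis
            using funpow_vderiv_add[OF smooth_add[OF sm(1,2)] sm(3), of k] funpow_vderiv_add[OF sm(1,2), of k]
              funpow_vderiv_cmult[OF test_smooth[OF test[OF t]], of k "-1"]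
              funpow_vderiv_cmult[OF test_smooth[OF test'[OF t]], of k "- of_real (s - t)"]
            by (simp add: scaleR_conv_of_real del: of_real_diff)
        qed
        have seg: "closed_segment t s \<subseteq> {a..b}" using s t by (auto simp: closed_segment_eq_real_ivl)
        have "norm ((vderiv ^^ k) (\<Gamma> s) x - (vderiv ^^ k) (\<Gamma> t) x - (s - t) *\<^sub>R (vderiv ^^ k) (\<Gamma>' t) x)
            \<le> norm (s - t) * (L * \<bar>s - t\<bar>)"
        proof (rule vector_differentiable_bound_linearization[where S = "closed_segment t s"
              and f = "\<lambda>r. (vderiv ^^ k) (\<Gamma> r) x" and f' = "\<lambda>r. (vderiv ^^ k) (\<Gamma>' r) x"])
          show "((\<lambda>t. (vderiv ^^ k) (\<Gamma> t) x) has_vector_derivative (vderiv ^^ k) (\<Gamma>' r) x) (at r within closed_segment t s)"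
            if "r \<in> closed_segment t s" for r
            using has_vector_derivative_within_subset[OF deriv seg] seg that by blast
          show "norm ((vderiv ^^ k) (\<Gamma>' r) x - (vderiv ^^ k) (\<Gamma>' t) x) \<le> L * \<bar>s - t\<bar>"
            if "r \<in> closed_segment t s" for r
          proof -
            have "\<bar>r - t\<bar> \<le> \<bar>s - t\<bar>" using that by (auto simp: closed_segment_eq_real_ivl split: if_splits)
            then have "L * \<bar>r - t\<bar> \<le> L * \<bar>s - t\<bar>" using L0 by (rule mult_left_mono)
            moreover have "r \<in> {a..b}" using seg that by blast
            ultimately show ?thesis using L[OF k _ t] order_trans by blast
          qed
        qed auto
        then show ?thesis unfolding eq by (simp add: mult_ac)
      qed
    qed (use supp supp' s t in auto)
    then show ?thesis unfolding uD by (simp add: scaleR_conv_of_real del: of_real_diff)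
  qed
  define K where "K = C * L"
  have K: "K \<ge> 0" using C L0 by (simp add: K_def)
  show ?thesis
    unfolding has_vector_derivative_def has_derivative_within_alt
  proof (intro conjI allI impI)
    fix e :: real assume e: "e > 0"
    show "\<exists>d>0. \<forall>y\<in>{a..b}. norm (y - t) < d \<longrightarrow>
            norm (u (\<Gamma> y) - u (\<Gamma> t) - (y - t) *\<^sub>R u (\<Gamma>' t)) \<le> e * norm (y - t)"
    proof (intro exI[of _ "e / (K + 1)"] conjI ballI impI)
      show "0 < e / (K + 1)" using e K by simp
      fix s assume s: "s \<in> {a..b}" and d: "norm (s - t) < e / (K + 1)"
      have "K * \<bar>s - t\<bar> \<le> (K + 1) * \<bar>s - t\<bar>" by (intro mult_right_mono) auto
      also have "\<dots> \<le> e" using d K by (simp add: field_simps)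
      finally have "K * \<bar>s - t\<bar> * \<bar>s - t\<bar> \<le> e * \<bar>s - t\<bar>" by (rule mult_right_mono) simp
      then show "norm (u (\<Gamma> s) - u (\<Gamma> t) - (s - t) *\<^sub>R u (\<Gamma>' t)) \<le> e * norm (s - t)"
        using est[OF s] by (simp add: K_def mult.assoc)
    qed
  qed (rule bounded_linear_scaleR_left)
qed

lemma test_lipschitz:
  assumes "test_function f" shows "\<exists>L\<ge>0. \<forall>x y. norm (f x - f y) \<le> L * \<bar>x - y\<bar>"
proof -
  obtain M where M: "M \<ge> 0" "\<And>x. norm (vderiv f x) \<le> M" using test_bounded[OF test_function_vderiv[OF assms]] by metis
  have "norm (f x - f y) \<le> M * norm (x - y)" for x y
  proof (rule differentiable_bound[of UNIV f "\<lambda>x h. h *\<^sub>R vderiv f x"])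
    show "(f has_derivative (\<lambda>h. h *\<^sub>R vderiv f x)) (at x)" for x
      using smooth_has_vderiv[OF test_smooth[OF assms]] by (simp add: has_vector_derivative_def)
    show "onorm (\<lambda>h. h *\<^sub>R vderiv f x) \<le> M" for x
      by (rule onorm_le) (use M(2)[of x] in \<open>auto simp: mult.commute[of M] intro: mult_left_mono\<close>)
  qed auto
  then show ?thesis using M(1) by auto
qed

lemma continuous_on_section:
  assumes "continuous_on UNIV (\<lambda>(y, x). K y x)" shows "continuous_on A (K y)"
proof -
  have "continuous_on A (\<lambda>x. (\<lambda>(y, x). K y x) (y, x))"
    by (rule continuous_on_compose2[OF assms]) (auto intro: continuous_intros)
  then show ?thesis by simp
qed

lemma smooth_param_integral:
  fixes K :: "nat \<Rightarrow> real \<Rightarrow> real \<Rightarrow> complex"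
  assumes cont: "\<And>n. continuous_on UNIV (\<lambda>(y, x). K n y x)"
    and deriv: "\<And>n y x. ((\<lambda>y. K n y x) has_vector_derivative K (Suc n) y x) (at y)"
  shows "smooth (\<lambda>y. integral {a..b} (K 0 y))"
    and "(vderiv ^^ n) (\<lambda>y. integral {a..b} (K 0 y)) = (\<lambda>y. integral {a..b} (K n y))"
proof -
  have der: "((\<lambda>y. integral {a..b} (K n y)) has_vector_derivative integral {a..b} (K (Suc n) y)) (at y)" for n y
  proof -
    have "((\<lambda>y. integral (cbox a b) (K n y)) has_vector_derivative integral (cbox a b) (K (Suc n) y)) (at y within UNIV)"
    proof (rule leibniz_rule_vector_derivative)
      show "((\<lambda>y. K n y x) has_vector_derivative K (Suc n) y x) (at y within UNIV)" for y x
        using deriv by simp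
      show "K n y integrable_on cbox a b" for y
        by (rule integrable_continuous) (rule continuous_on_section[OF cont])
      show "continuous_on (UNIV \<times> cbox a b) (\<lambda>(y, x). K (Suc n) y x)"
        by (rule continuous_on_subset[OF cont]) simp
    qed auto
    then show ?thesis by simp
  qed
  show "smooth (\<lambda>y. integral {a..b} (K 0 y))"
    by (rule smooth_coinduct[of _ "range (\<lambda>n y. integral {a..b} (K n y))"]) (use der in auto)
  show "(vderiv ^^ n) (\<lambda>y. integral {a..b} (K 0 y)) = (\<lambda>y. integral {a..b} (K n y))"
  proof (induction n)
    case (Suc n)
    then show ?case using vderiv_I[OF der] by auto
  qed simp
qed

section \<open>Regularisation of distributions\<close>

lemma continuous_on_shift:
  assumes "continuous_on UNIV f" "continuous_on S g"
  shows "continuous_on S (\<lambda>x. f (g x))"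
  by (rule continuous_on_compose2[OF assms]) auto

text \<open>A distribution may be interchanged with integration over a parameter: as functions of the
  upper limit of integration, both sides have the same derivative.\<close>

lemma distribution_LINT:
  assumes u: "distribution u" and \<rho>: "test_function \<rho>" and \<psi>: "test_function \<psi>"
  shows "(LINT x|lebesgue. u (\<lambda>y. \<rho> (y - x)) * \<psi> x) = u (\<lambda>y. LINT x|lebesgue. \<rho> (y - x) * \<psi> x)"
    and "continuous_on UNIV (\<lambda>x. u (\<lambda>y. \<rho> (y - x)))"
proof -
  obtain R where R: "R > 0" "\<And>x. x \<notin> {-R..R} \<Longrightarrow> \<rho> x = 0" using \<rho> test_functionE by metis
  obtain S where S: "S > 0" "\<And>x. x \<notin> {-S..S} \<Longrightarrow> \<psi> x = 0" using \<psi> test_functionE by metis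
  have shift: "(vderiv ^^ n) (\<lambda>y. \<rho> (y - x)) = (\<lambda>y. (vderiv ^^ n) \<rho> (y - x))" for n x
    using funpow_vderiv_affine[OF test_smooth[OF \<rho>], of n 1 "-x"] by simp
  have test_shift: "test_function (\<lambda>y. \<rho> (y - x))" for x
    using test_function_affine[OF \<rho>, of 1 "-x"] by simp
  have lip: "\<exists>L\<ge>0. \<forall>x y. norm ((vderiv ^^ n) \<rho> x - (vderiv ^^ n) \<rho> y) \<le> L * \<bar>x - y\<bar>" for n
    by (rule test_lipschitz[OF test_function_funpow[OF \<rho>]])
  have cont: "continuous_on A (\<lambda>x. u (\<lambda>y. \<rho> (y - x)))" if A: "A = {-r<..<r}" for A r
  proof -
    have "\<exists>K. \<forall>s\<in>A. \<forall>t\<in>A. norm (u (\<lambda>y. \<rho> (y - s)) - u (\<lambda>y. \<rho> (y - t))) \<le> K * \<bar>s - t\<bar>"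
    proof (rule distribution_family_lipschitz[OF u test_shift])
      show "\<rho> (x - t) = 0" if "t \<in> A" "x \<notin> {- (R+r)..R+r}" for x t
        using that by (intro R(2)) (auto simp: A)
      show "\<exists>L. \<forall>s\<in>A. \<forall>t\<in>A. \<forall>y. norm ((vderiv ^^ n) (\<lambda>y. \<rho> (y - s)) y - (vderiv ^^ n) (\<lambda>y. \<rho> (y - t)) y) \<le> L * \<bar>s - t\<bar>" for n
      proof -
        obtain L where L: "\<And>x y. norm ((vderiv ^^ n) \<rho> x - (vderiv ^^ n) \<rho> y) \<le> L * \<bar>x - y\<bar>" using lip[of n] by blast
        have "norm ((vderiv ^^ n) \<rho> (y - s) - (vderiv ^^ n) \<rho> (y - t)) \<le> L * \<bar>s - t\<bar>" for s t y
          using L[of "y - s" "y - t"] by (simp add: abs_minus_commute)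
        then show ?thesis unfolding shift by blast
      qed
    qed
    then obtain K where K: "\<And>s t. s \<in> A \<Longrightarrow> t \<in> A \<Longrightarrow> norm (u (\<lambda>y. \<rho> (y - s)) - u (\<lambda>y. \<rho> (y - t))) \<le> K * \<bar>s - t\<bar>"
      by blast
    have "(max K 0)-lipschitz_on A (\<lambda>x. u (\<lambda>y. \<rho> (y - x)))"
    proof (rule lipschitz_onI)
      show "dist (u (\<lambda>y. \<rho> (y - s))) (u (\<lambda>y. \<rho> (y - t))) \<le> max K 0 * dist s t" if "s \<in> A" "t \<in> A" for s t
      proof -
        have "K * \<bar>s - t\<bar> \<le> max K 0 * \<bar>s - t\<bar>" by (intro mult_right_mono) auto
        with K[OF that] show ?thesis by (simp add: dist_norm)
      qed
    qed simp
    then show ?thesis by (rule lipschitz_on_continuous_on)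
  qed
  show contU: "continuous_on UNIV (\<lambda>x. u (\<lambda>y. \<rho> (y - x)))"
  proof (rule continuous_at_imp_continuous_on, rule ballI)
    fix x :: real
    have "x \<in> interior {-(\<bar>x\<bar>+1)<..<\<bar>x\<bar>+1}" by auto
    then show "isCont (\<lambda>x. u (\<lambda>y. \<rho> (y - x))) x"
      using continuous_on_interior[OF cont[OF refl]] by blast
  qed
  define K where "K = (\<lambda>n y x. (vderiv ^^ n) \<rho> (y - x) * \<psi> x)"
  have Kc: "continuous_on UNIV (\<lambda>(y, x). K n y x)" for n
    unfolding K_def split_def
    by (intro continuous_on_mult continuous_on_shift[OF smooth_continuous[OF smooth_funpow[OF test_smooth[OF \<rho>]]]]
        continuous_on_shift[OF test_continuous[OF \<psi>]] continuous_intros)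
  have Kd: "((\<lambda>y. K n y x) has_vector_derivative K (Suc n) y x) (at y)" for n y x
    using has_vector_derivative_mult_left[OF smooth_has_vderiv[OF smooth_funpow[OF test_smooth[OF test_shift[of x]], of n]], of "\<psi> x"]
    using shift[of "Suc n" x] by (simp add: K_def shift)
  define \<Gamma> where "\<Gamma> = (\<lambda>t y. integral {-S..t} (K 0 y))"
  define \<Gamma>' where "\<Gamma>' = (\<lambda>t y. \<psi> t * \<rho> (y - t))"
  have Gn: "(vderiv ^^ n) (\<Gamma> t) y = integral {-S..t} (K n y)" for n t y
    unfolding \<Gamma>_def using smooth_param_integral(2)[where K = K, OF Kc Kd] by simp
  have G'n: "(vderiv ^^ n) (\<Gamma>' t) y = K n y t" for n t y
    unfolding \<Gamma>'_def K_def using funpow_vderiv_cmult[OF test_smooth[OF test_shift]] by (simp add: shift)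
  have Gsupp: "\<Gamma> t y = 0" if "t \<in> {-S..S}" "y \<notin> {-(R+S)..R+S}" for t y
  proof -
    have "K 0 y x = 0" if "x \<in> {-S..t}" for x
      using that \<open>t \<in> {-S..S}\<close> \<open>y \<notin> {-(R+S)..R+S}\<close> R(2)[of "y - x"] by (auto simp: K_def)
    then show ?thesis unfolding \<Gamma>_def by (intro integral_unique has_integral_is_0)
  qed
  have G'supp: "\<Gamma>' t y = 0" if "t \<in> {-S..S}" "y \<notin> {-(R+S)..R+S}" for t y
    using that R(2)[of "y - t"] by (auto simp: \<Gamma>'_def)
  have "((\<lambda>t. u (\<Gamma> t)) has_vector_derivative u (\<Gamma>' t)) (at t within {-S..S})" if t: "t \<in> {-S..S}" for t
  proof (rule distribution_family_deriv[OF u _ _ Gsupp G'supp _ _ t])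
    show "test_function (\<Gamma> t)" if "t \<in> {-S..S}" for t
      by (rule test_functionI[OF _ Gsupp[OF that]]) (unfold \<Gamma>_def, rule smooth_param_integral(1)[where K = K, OF Kc Kd])
    show "test_function (\<Gamma>' t)" for t
      unfolding \<Gamma>'_def by (rule test_function_cmult[OF test_shift])
    show "((\<lambda>t. (vderiv ^^ n) (\<Gamma> t) y) has_vector_derivative (vderiv ^^ n) (\<Gamma>' t) y) (at t within {-S..S})"
      if "t \<in> {-S..S}" for n t y
      unfolding Gn G'n
      by (rule integral_has_vector_derivative[OF continuous_on_section[OF Kc] that])
    show "\<exists>L. \<forall>s\<in>{-S..S}. \<forall>t\<in>{-S..S}. \<forall>y. norm ((vderiv ^^ n) (\<Gamma>' s) y - (vderiv ^^ n) (\<Gamma>' t) y) \<le> L * \<bar>s - t\<bar>" for n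
    proof -
      obtain L where L: "L \<ge> 0" "\<And>x y. norm ((vderiv ^^ n) \<rho> x - (vderiv ^^ n) \<rho> y) \<le> L * \<bar>x - y\<bar>" using lip[of n] by blast
      obtain L' where L': "L' \<ge> 0" "\<And>x y. norm (\<psi> x - \<psi> y) \<le> L' * \<bar>x - y\<bar>" using test_lipschitz[OF \<psi>] by blast
      obtain M where M: "M \<ge> 0" "\<And>x. norm (\<psi> x) \<le> M" using test_bounded[OF \<psi>] by metis
      obtain M' where M': "M' \<ge> 0" "\<And>x. norm ((vderiv ^^ n) \<rho> x) \<le> M'" using test_bounded[OF test_function_funpow[OF \<rho>]] by metis
      have "norm (K n y s - K n y t) \<le> (L * M + M' * L') * \<bar>s - t\<bar>" for s t y
      proof -
        have "K n y s - K n y t = ((vderiv ^^ n) \<rho> (y - s) - (vderiv ^^ n) \<rho> (y - t)) * \<psi> s + (vderiv ^^ n) \<rho> (y - t) * (\<psi> s - \<psi> t)"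
          by (simp add: K_def algebra_simps)
        also have "norm \<dots> \<le> norm ((vderiv ^^ n) \<rho> (y - s) - (vderiv ^^ n) \<rho> (y - t)) * norm (\<psi> s) + norm ((vderiv ^^ n) \<rho> (y - t)) * norm (\<psi> s - \<psi> t)"
          using norm_triangle_ineq by (simp add: norm_mult[symmetric])
        also have "\<dots> \<le> (L * \<bar>s - t\<bar>) * M + M' * (L' * \<bar>s - t\<bar>)"
          using L(2)[of "y - s" "y - t"] L'(2)[of s t] M(2)[of s] M'(2)[of "y - t"] M(1) M'(1) L(1)
          by (intro add_mono mult_mono) (auto simp: abs_minus_commute)
        finally show ?thesis by (simp add: algebra_simps)
      qed
      then show ?thesis unfolding G'n by blast
    qed
  qed
  then have "((\<lambda>t. u (\<Gamma>' t)) has_integral u (\<Gamma> S) - u (\<Gamma> (-S))) {-S..S}"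
    using S(1) by (intro fundamental_theorem_of_calculus) auto
  moreover have "\<Gamma> (-S) = (\<lambda>y. 0)" by (simp add: \<Gamma>_def)
  moreover have "u (\<Gamma>' t) = u (\<lambda>y. \<rho> (y - t)) * \<psi> t" for t
    unfolding \<Gamma>'_def using distribution_cmult[OF u test_shift] by simp
  ultimately have "integral {-S..S} (\<lambda>t. u (\<lambda>y. \<rho> (y - t)) * \<psi> t) = u (\<Gamma> S)"
    using distribution_zero[OF u] by (simp add: integral_unique)
  moreover have "(LINT x|lebesgue. u (\<lambda>y. \<rho> (y - x)) * \<psi> x) = integral {-S..S} (\<lambda>t. u (\<lambda>y. \<rho> (y - t)) * \<psi> t)"
  proof (rule compact_support_integral(2))
    show "continuous_on {-S..S} (\<lambda>t. u (\<lambda>y. \<rho> (y - t)) * \<psi> t)"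
      by (intro continuous_on_mult test_continuous[OF \<psi>] continuous_on_subset[OF contU]) auto
  qed (simp add: S)
  moreover have "\<Gamma> S = (\<lambda>y. LINT x|lebesgue. \<rho> (y - x) * \<psi> x)"
  proof
    fix y
    show "\<Gamma> S y = (LINT x|lebesgue. \<rho> (y - x) * \<psi> x)"
      unfolding \<Gamma>_def
      by (subst compact_support_integral(2)[of "-S" S])
         (auto simp: K_def S intro!: continuous_on_mult test_continuous[OF \<psi>] continuous_on_shift[OF test_continuous[OF \<rho>]] continuous_intros)
  qed
  ultimately show "(LINT x|lebesgue. u (\<lambda>y. \<rho> (y - x)) * \<psi> x) = u (\<lambda>y. LINT x|lebesgue. \<rho> (y - x) * \<psi> x)"
    by simp
qed

lemma LINT_affine_scaleR:
  fixes f :: "real \<Rightarrow> 'a :: {banach, second_countable_topology}"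
  assumes "f \<in> borel_measurable borel" "c \<noteq> 0"
  shows "(LINT x|lebesgue. f x) = \<bar>c\<bar> *\<^sub>R (LINT x|lebesgue. f (t + c * x))"
proof -
  have "(LINT x|lebesgue. f x) = (LINT x|lborel. f x)"
    by (rule integral_completion) (use assms in simp)
  also have "\<dots> = \<bar>c\<bar> *\<^sub>R (LINT x|lborel. f (t + c * x))"
    by (rule lborel_integral_real_affine[OF assms(2)])
  also have "(LINT x|lborel. f (t + c * x)) = (LINT x|lebesgue. f (t + c * x))"
    by (rule integral_completion[symmetric]) (use assms(1) in measurable)
  finally show ?thesis .
qed

lemma LINT_affine:
  fixes f :: "real \<Rightarrow> complex"
  assumes "f \<in> borel_measurable borel" "c \<noteq> 0"
  shows "(LINT x|lebesgue. f x) = of_real \<bar>c\<bar> * (LINT x|lebesgue. f (t + c * x))"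
  using LINT_affine_scaleR[OF assms] by (simp add: scaleR_conv_of_real)

lemma test_borel: "test_function f \<Longrightarrow> f \<in> borel_measurable borel"
  by (rule borel_measurable_continuous_onI[OF test_continuous])

text \<open>The model delta net generated by the bump function.\<close>

definition moll :: "real \<Rightarrow> real \<Rightarrow> complex" where "moll \<epsilon> = scaled bump \<epsilon>"

lemma dist_conv_moll:
  assumes "distribution u" "\<epsilon> > 0"
  shows "dist_conv u (moll \<epsilon>) = (\<lambda>x. u (\<lambda>y. bump ((x - y) / \<epsilon>) / of_real \<epsilon>))"
  by (simp add: dist_conv_def moll_def scaled_def)

text \<open>The reflected mollifier \<open>y \<mapsto> b (-y / \<epsilon>) / \<epsilon>\<close>, a shift of which is paired with the distribution.\<close>

lemma test_reflected_moll:
  assumes "\<epsilon> > 0" shows "test_function (\<lambda>w. bump (- w / \<epsilon>) / of_real \<epsilon>)"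
  using test_function_cmult[OF test_function_affine[OF test_bump, of "- 1 / \<epsilon>" 0], of "1 / of_real \<epsilon>"] assms
  by simp

lemma continuous_dist_conv:
  assumes u: "distribution u" and "\<epsilon> > 0"
  shows "continuous_on UNIV (dist_conv u (moll \<epsilon>))"
  using distribution_LINT(2)[OF u test_reflected_moll[OF assms(2)] test_zero]
  by (simp add: dist_conv_moll[OF assms])

text \<open>Regularisations converge weakly to the distribution: after interchanging, the functional is
  applied to the mollified test functions, which depend in a Lipschitz way on \<open>\<epsilon>\<close>, up to \<open>\<epsilon> = 0\<close>.\<close>

lemma dist_conv_tendsto:
  assumes u: "distribution u" and \<psi>: "test_function \<psi>"
  shows "((\<lambda>\<epsilon>. LINT x|lebesgue. dist_conv u (moll \<epsilon>) x * \<psi> x) \<longlongrightarrow> u \<psi>) (at_right 0)"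
proof -
  obtain S where S: "S > 0" "\<And>x. x \<notin> {-S..S} \<Longrightarrow> \<psi> x = 0" using \<psi> test_functionE by metis
  define K where "K = (\<lambda>\<epsilon> n y z. bump z * (vderiv ^^ n) \<psi> (y + \<epsilon> * z))"
  define \<Gamma> where "\<Gamma> = (\<lambda>\<epsilon> y. integral {-1..1} (K \<epsilon> 0 y))"
  have Kc: "continuous_on UNIV (\<lambda>(y, x). K \<epsilon> n y x)" for n \<epsilon>
    unfolding K_def split_def
    by (intro continuous_on_mult continuous_on_shift[OF smooth_continuous[OF smooth_funpow[OF test_smooth[OF \<psi>]]]]
        continuous_on_shift[OF test_continuous[OF test_bump]] continuous_intros)
  have Kc1: "continuous_on A (K \<epsilon> n y)" for A \<epsilon> n y
    by (rule continuous_on_section[OF Kc])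
  have Kd: "((\<lambda>y. K \<epsilon> n y x) has_vector_derivative K \<epsilon> (Suc n) y x) (at y)" for n y x \<epsilon>
    unfolding K_def
    using has_vector_derivative_mult_right[OF has_vderiv_affine[OF smooth_has_vderiv[OF smooth_funpow[OF test_smooth[OF \<psi>]]], of n 1 "\<epsilon> * x" y], of "bump x"]
    by simp
  have Gn: "(vderiv ^^ n) (\<Gamma> t) y = integral {-1..1} (K t n y)" for n t y
    unfolding \<Gamma>_def using smooth_param_integral(2)[where K = "K t", OF Kc Kd] by simp
  have supp: "\<Gamma> t y = 0" if "t \<in> {0..1}" "y \<notin> {-(S+1)..S+1}" for t y
  proof -
    have "K t 0 y z = 0" if "z \<in> {-1..1}" for z
    proof -
      have "\<bar>t * z\<bar> \<le> 1 * 1" unfolding abs_mult by (rule mult_mono) (use that \<open>t \<in> {0..1}\<close> in auto)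
      then have "y + t * z \<notin> {-S..S}" using \<open>y \<notin> {-(S+1)..S+1}\<close> by auto
      then show ?thesis using S(2) by (simp add: K_def)
    qed
    then show ?thesis unfolding \<Gamma>_def by (intro integral_unique has_integral_is_0)
  qed
  have "\<exists>L. \<forall>s\<in>{0..1}. \<forall>t\<in>{0..1}. norm (u (\<Gamma> s) - u (\<Gamma> t)) \<le> L * \<bar>s - t\<bar>"
  proof (rule distribution_family_lipschitz[OF u _ supp])
    show "test_function (\<Gamma> t)" if "t \<in> {0..1}" for t
      by (rule test_functionI[OF _ supp[OF that]]) (unfold \<Gamma>_def, rule smooth_param_integral(1)[where K = "K t", OF Kc Kd])
    show "\<exists>L. \<forall>s\<in>{0..1}. \<forall>t\<in>{0..1}. \<forall>y. norm ((vderiv ^^ n) (\<Gamma> s) y - (vderiv ^^ n) (\<Gamma> t) y) \<le> L * \<bar>s - t\<bar>" for n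
    proof -
      obtain L where L: "L \<ge> 0" "\<And>x y. norm ((vderiv ^^ n) \<psi> x - (vderiv ^^ n) \<psi> y) \<le> L * \<bar>x - y\<bar>"
        using test_lipschitz[OF test_function_funpow[OF \<psi>]] by blast
      obtain M where M: "M \<ge> 0" "\<And>x. norm (bump x) \<le> M" using test_bounded[OF test_bump] by metis
      have "norm (integral {-1..1} (K s n y) - integral {-1..1} (K t n y)) \<le> 2 * M * L * \<bar>s - t\<bar>" for s t y
      proof -
        have i: "K s n y integrable_on {-1..1}" for s by (rule integrable_continuous_real[OF Kc1])
        have "norm (integral {-1..1} (\<lambda>z. K s n y z - K t n y z)) \<le> (M * (L * \<bar>s - t\<bar>)) * (1 - (-1))"
        proof (rule integral_bound)
          fix z :: real assume z: "z \<in> {-1..1}"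
          have "norm (K s n y z - K t n y z) = norm (bump z) * norm ((vderiv ^^ n) \<psi> (y + s * z) - (vderiv ^^ n) \<psi> (y + t * z))"
            by (simp add: K_def norm_mult[symmetric] algebra_simps)
          also have "\<dots> \<le> M * (L * \<bar>(y + s * z) - (y + t * z)\<bar>)"
            by (intro mult_mono L M) (use M in auto)
          also have "\<bar>(y + s * z) - (y + t * z)\<bar> = \<bar>s - t\<bar> * \<bar>z\<bar>"
            by (simp add: abs_mult[symmetric] algebra_simps)
          also have "M * (L * (\<bar>s - t\<bar> * \<bar>z\<bar>)) \<le> M * (L * (\<bar>s - t\<bar> * 1))"
            using z M(1) L(1) by (intro mult_left_mono) auto
          finally show "norm (K s n y z - K t n y z) \<le> M * (L * \<bar>s - t\<bar>)" by simp
        qed (auto intro!: continuous_on_diff Kc1)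
        then show ?thesis by (simp add: Henstock_Kurzweil_Integration.integral_diff[OF i i] mult_ac)
      qed
      then show ?thesis unfolding Gn by blast
    qed
  qed
  then obtain L where "\<forall>s\<in>{0..1}. \<forall>t\<in>{0..1}. norm (u (\<Gamma> s) - u (\<Gamma> t)) \<le> L * \<bar>s - t\<bar>" by blast
  then have L: "norm (u (\<Gamma> s) - u (\<Gamma> 0)) \<le> L * \<bar>s\<bar>" if "s \<in> {0..1}" for s
    using that by (force dest: bspec[of _ _ 0])
  have "\<Gamma> 0 y = \<psi> y" for y
  proof -
    have "\<Gamma> 0 y = integral {-1..1} (\<lambda>z. bump z * \<psi> y)" by (simp add: \<Gamma>_def K_def)
    also have "\<dots> = integral {-1..1} bump * \<psi> y" by simp
    also have "integral {-1..1} bump = (LINT x|lebesgue. bump x)"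
      by (rule compact_support_integral(2)[symmetric]) (auto intro: test_continuous test_bump bump_zero)
    finally show ?thesis by (simp add: LINT_bump)
  qed
  then have G0: "\<Gamma> 0 = \<psi>" by blast
  have "((\<lambda>\<epsilon>. u (\<Gamma> \<epsilon>) - u \<psi>) \<longlongrightarrow> 0) (at_right 0)"
  proof (rule Lim_null_comparison)
    show "eventually (\<lambda>\<epsilon>. norm (u (\<Gamma> \<epsilon>) - u \<psi>) \<le> L * \<bar>\<epsilon>\<bar>) (at_right 0)"
    proof (rule eventually_mono[OF eventually_at_right_real[of 0 "1::real"]])
      show "norm (u (\<Gamma> \<epsilon>) - u \<psi>) \<le> L * \<bar>\<epsilon>\<bar>" if "\<epsilon> \<in> {0<..<1}" for \<epsilon>
        using L[of \<epsilon>] that by (simp add: G0)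
    qed simp
    show "((\<lambda>\<epsilon>. L * \<bar>\<epsilon>\<bar>) \<longlongrightarrow> 0) (at_right 0)"
      by (rule tendsto_eq_intros refl)+ auto
  qed
  then have lim: "((\<lambda>\<epsilon>. u (\<Gamma> \<epsilon>)) \<longlongrightarrow> u \<psi>) (at_right 0)" by (simp add: LIM_zero_iff)
  have "(LINT x|lebesgue. dist_conv u (moll \<epsilon>) x * \<psi> x) = u (\<Gamma> \<epsilon>)" if \<epsilon>: "\<epsilon> > 0" for \<epsilon>
  proof -
    let ?\<rho> = "\<lambda>w. bump (- w / \<epsilon>) / of_real \<epsilon>"
    have "(LINT x|lebesgue. dist_conv u (moll \<epsilon>) x * \<psi> x) = (LINT x|lebesgue. u (\<lambda>y. ?\<rho> (y - x)) * \<psi> x)"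
      by (simp add: dist_conv_moll[OF u \<epsilon>])
    also have "\<dots> = u (\<lambda>y. LINT x|lebesgue. ?\<rho> (y - x) * \<psi> x)"
      by (rule distribution_LINT(1)[OF u test_reflected_moll[OF \<epsilon>] \<psi>])
    also have "(\<lambda>y. LINT x|lebesgue. ?\<rho> (y - x) * \<psi> x) = \<Gamma> \<epsilon>"
    proof
      fix y
      have m: "(\<lambda>x. ?\<rho> (y - x) * \<psi> x) \<in> borel_measurable borel"
        using test_borel[OF test_bump] test_borel[OF \<psi>] by measurable
      have "(LINT x|lebesgue. ?\<rho> (y - x) * \<psi> x) = of_real \<bar>\<epsilon>\<bar> * (LINT z|lebesgue. ?\<rho> (y - (y + \<epsilon> * z)) * \<psi> (y + \<epsilon> * z))"
        by (rule LINT_affine[OF m]) (use \<epsilon> in simp)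
      also have "\<dots> = (LINT z|lebesgue. bump z * \<psi> (y + \<epsilon> * z))"
        using \<epsilon> by simp
      also have "\<dots> = \<Gamma> \<epsilon> y"
        unfolding \<Gamma>_def
        by (subst compact_support_integral(2)[of "-1" 1]) (use Kc1[of _ \<epsilon> 0 y] in \<open>auto simp: K_def bump_zero\<close>)
      finally show "(LINT x|lebesgue. ?\<rho> (y - x) * \<psi> x) = \<Gamma> \<epsilon> y" .
    qed
    finally show ?thesis .
  qed
  then show ?thesis
    by (intro Lim_transform_eventually[OF lim]) (auto simp: eventually_at_filter)
qed

section \<open>The regularised coefficient\<close>

text \<open>In the variable \<open>(x - x0) / \<epsilon>\<close> the regularised coefficient does not depend on \<open>\<epsilon>\<close>.\<close>

definition coeff_profile :: "real \<Rightarrow> real \<Rightarrow> real \<Rightarrow> complex" where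
  "coeff_profile A B y = of_real A + of_real (B - A) * step y"

lemma smooth_coeff_profile: "smooth (coeff_profile A B)"
  unfolding coeff_profile_def[abs_def] by (intro smooth_add smooth_mult smooth_const smooth_step)

lemma integral_bump_interval: "a \<le> b \<Longrightarrow> integral {a..b} bump = step b - step a"
  by (rule integral_unique, rule fundamental_theorem_of_calculus)
     (simp_all add: has_vector_derivative_at_within[OF step_deriv])

lemma LINT_bump_interval:
  assumes "a \<le> b"
  shows "integrable lebesgue (\<lambda>z. indicator {a..b} z * bump z)"
    and "(LINT z|lebesgue. indicator {a..b} z * bump z) = step b - step a"
proof -
  have "bump absolutely_integrable_on {a..b}"
    by (intro absolutely_integrable_continuous_real test_continuous test_bump)
  moreover have "indicator {a..b} z *\<^sub>R bump z = indicator {a..b} z * bump z" for z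
    by (simp add: indicator_def)
  ultimately show "integrable lebesgue (\<lambda>z. indicator {a..b} z * bump z)"
    "(LINT z|lebesgue. indicator {a..b} z * bump z) = step b - step a"
    using set_lebesgue_integral_eq_integral(2)[of "{a..b}" bump] integral_bump_interval[OF assms]
    by (simp_all add: set_integrable_def set_lebesgue_integral_def)
qed

lemma heaviside_borel [measurable]: "heaviside \<in> borel_measurable borel"
  unfolding heaviside_def[abs_def] by measurable

lemma jump_coeff_borel: "jump_coeff A B x0 \<in> borel_measurable borel"
  unfolding jump_coeff_def by measurable

lemma dist_conv_jump_coeff:
  assumes \<epsilon>: "\<epsilon> > 0"
  shows "dist_conv (regular_dist (jump_coeff A B x0)) (moll \<epsilon>) x = coeff_profile A B ((x - x0) / \<epsilon>)"
proof -
  define s where "s = (x - x0) / \<epsilon>"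
  define M where "M = \<bar>s\<bar> + 1"
  have M: "-M \<le> s" "s \<le> M" "-M \<le> -1" "M \<ge> 1" by (auto simp: M_def)
  let ?a = "jump_coeff A B x0"
  have "dist_conv (regular_dist ?a) (moll \<epsilon>) x = (LINT y|lebesgue. ?a y * (bump ((x - y) / \<epsilon>) / of_real \<epsilon>))"
    by (simp add: dist_conv_def regular_dist_def moll_def scaled_def)
  also have "\<dots> = of_real \<bar>- \<epsilon>\<bar> * (LINT z|lebesgue. ?a (x + (- \<epsilon>) * z) * (bump ((x - (x + (- \<epsilon>) * z)) / \<epsilon>) / of_real \<epsilon>))"
    by (rule LINT_affine) (use \<epsilon> jump_coeff_borel[of A B x0] test_borel[OF test_bump] in \<open>auto intro!: borel_measurable_times borel_measurable_divide\<close>)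
  also have "\<dots> = (LINT z|lebesgue. ?a (x - \<epsilon> * z) * bump z)"
    using \<epsilon> by simp
  also have "\<dots> = (LINT z|lebesgue. of_real A * (indicator {s..M} z * bump z) + of_real B * (indicator {-M..s} z * bump z))"
  proof (rule Bochner_Integration.integral_cong)
    fix z
    show "?a (x - \<epsilon> * z) * bump z = of_real A * (indicator {s..M} z * bump z) + of_real B * (indicator {-M..s} z * bump z)"
    proof (cases "z \<in> {-1..1}")
      case True
      have "x0 - (x - \<epsilon> * z) < 0 \<longleftrightarrow> z < s" "x - \<epsilon> * z - x0 < 0 \<longleftrightarrow> z > s"
        using \<epsilon> by (auto simp: s_def field_simps)
      moreover have "z \<in> {s..M} \<longleftrightarrow> \<not> z < s" "z \<in> {-M..s} \<longleftrightarrow> \<not> z > s"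
        using True M by auto
      ultimately show ?thesis
        by (simp add: jump_coeff_def heaviside_def indicator_def algebra_simps del: atLeastAtMost_iff)
    qed (simp add: bump_zero)
  qed simp
  also have "\<dots> = of_real A * (step M - step s) + of_real B * (step s - step (-M))"
    using LINT_bump_interval[OF M(2)] LINT_bump_interval[OF M(1)] by simp
  also have "\<dots> = coeff_profile A B s"
    using step_0[of "-M"] step_1[of M] M by (simp add: coeff_profile_def algebra_simps)
  finally show ?thesis by (simp add: s_def)
qed

lemma model_product_moll:
  assumes "has_model_product (regular_dist (jump_coeff A B x0)) u p" and \<psi>: "test_function \<psi>"
  shows "((\<lambda>\<epsilon>. LINT x|lebesgue. coeff_profile A B ((x - x0) / \<epsilon>) * dist_conv u (moll \<epsilon>) x * \<psi> x) \<longlongrightarrow> p \<psi>) (at_right 0)"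
proof -
  have "((\<lambda>\<epsilon>. LINT x|lebesgue. dist_conv (regular_dist (jump_coeff A B x0)) (moll \<epsilon>) x * dist_conv u (moll \<epsilon>) x * \<psi> x) \<longlongrightarrow> p \<psi>) (at_right 0)"
    using assms(1)[unfolded has_model_product_def] test_bump LINT_bump \<psi>
    unfolding moll_def regular_dist_def by blast
  then show ?thesis
    by (rule Lim_transform_eventually) (auto simp: eventually_at_filter dist_conv_jump_coeff)
qed

text \<open>Away from the jump the coefficient is constant, and so the product is the obvious one.\<close>

lemma model_product_local:
  assumes mp: "has_model_product (regular_dist (jump_coeff A B x0)) u p"
    and u: "distribution u" and \<psi>: "test_function \<psi>" and "\<delta> > 0"
    and const: "\<And>\<epsilon> x. 0 < \<epsilon> \<Longrightarrow> \<epsilon> < \<delta> \<Longrightarrow> \<psi> x \<noteq> 0 \<Longrightarrow> coeff_profile A B ((x - x0) / \<epsilon>) = c"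
  shows "p \<psi> = c * u \<psi>"
proof (rule tendsto_unique[OF _ model_product_moll[OF mp \<psi>]])
  have "((\<lambda>\<epsilon>. c * (LINT x|lebesgue. dist_conv u (moll \<epsilon>) x * \<psi> x)) \<longlongrightarrow> c * u \<psi>) (at_right 0)"
    by (intro tendsto_mult tendsto_const dist_conv_tendsto u \<psi>)
  moreover have "eventually (\<lambda>\<epsilon>. c * (LINT x|lebesgue. dist_conv u (moll \<epsilon>) x * \<psi> x)
      = (LINT x|lebesgue. coeff_profile A B ((x - x0) / \<epsilon>) * dist_conv u (moll \<epsilon>) x * \<psi> x)) (at_right 0)"
  proof (rule eventually_mono[OF eventually_at_right_real[OF \<open>\<delta> > 0\<close>]])
    fix \<epsilon> assume "\<epsilon> \<in> {0<..<\<delta>}"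
    then have "(\<lambda>x. c * (dist_conv u (moll \<epsilon>) x * \<psi> x)) = (\<lambda>x. coeff_profile A B ((x - x0) / \<epsilon>) * dist_conv u (moll \<epsilon>) x * \<psi> x)"
      using const[of \<epsilon>] by (intro ext) (metis greaterThanLessThan_iff mult.assoc mult_zero_right)
    then show "c * (LINT x|lebesgue. dist_conv u (moll \<epsilon>) x * \<psi> x)
      = (LINT x|lebesgue. coeff_profile A B ((x - x0) / \<epsilon>) * dist_conv u (moll \<epsilon>) x * \<psi> x)"
      by (simp only: integral_mult_right_zero[symmetric])
  qed
  ultimately show "((\<lambda>\<epsilon>. LINT x|lebesgue. coeff_profile A B ((x - x0) / \<epsilon>) * dist_conv u (moll \<epsilon>) x * \<psi> x) \<longlongrightarrow> c * u \<psi>) (at_right 0)"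
    by (rule Lim_transform_eventually)
qed simp

lemma model_product_left:
  assumes mp: "has_model_product (regular_dist (jump_coeff A B x0)) u p"
    and u: "distribution u" and \<psi>: "test_function \<psi>" and supp: "tsupp \<psi> \<subseteq> {..<x0}"
  shows "p \<psi> = of_real A * u \<psi>"
proof -
  have "\<exists>\<delta>>0. \<forall>x\<in>tsupp \<psi>. x \<le> x0 - \<delta>"
  proof (cases "tsupp \<psi> = {}")
    case False
    then obtain m where "m \<in> tsupp \<psi>" "\<forall>x\<in>tsupp \<psi>. x \<le> m"
      using compact_attains_sup \<psi> by (metis test_function_def)
    then show ?thesis using supp by (intro exI[of _ "x0 - m"]) auto
  qed (auto intro: exI[of _ 1])
  then obtain \<delta> where \<delta>0: "\<delta> > 0" "\<forall>x\<in>tsupp \<psi>. x \<le> x0 - \<delta>" by blast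
  then have \<delta>: "x \<le> x0 - \<delta>" if "\<psi> x \<noteq> 0" for x
    using that not_in_tsupp[of x \<psi>] by auto
  show ?thesis
  proof (rule model_product_local[OF mp u \<psi> \<delta>0(1)])
    fix \<epsilon> x assume "0 < \<epsilon>" "\<epsilon> < \<delta>" "\<psi> x \<noteq> 0"
    then have "(x - x0) / \<epsilon> \<le> -1" using \<delta>[of x] by (simp add: field_simps)
    then show "coeff_profile A B ((x - x0) / \<epsilon>) = of_real A" by (simp add: coeff_profile_def step_0)
  qed
qed

lemma model_product_right:
  assumes mp: "has_model_product (regular_dist (jump_coeff A B x0)) u p"
    and u: "distribution u" and \<psi>: "test_function \<psi>" and supp: "tsupp \<psi> \<subseteq> {x0<..}"
  shows "p \<psi> = of_real B * u \<psi>"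
proof -
  have "\<exists>\<delta>>0. \<forall>x\<in>tsupp \<psi>. x \<ge> x0 + \<delta>"
  proof (cases "tsupp \<psi> = {}")
    case False
    then obtain m where "m \<in> tsupp \<psi>" "\<forall>x\<in>tsupp \<psi>. m \<le> x"
      using compact_attains_inf \<psi> by (metis test_function_def)
    then show ?thesis using supp by (intro exI[of _ "m - x0"]) auto
  qed (auto intro: exI[of _ 1])
  then obtain \<delta> where \<delta>0: "\<delta> > 0" "\<forall>x\<in>tsupp \<psi>. x \<ge> x0 + \<delta>" by blast
  then have \<delta>: "x \<ge> x0 + \<delta>" if "\<psi> x \<noteq> 0" for x
    using that not_in_tsupp[of x \<psi>] by auto
  show ?thesis
  proof (rule model_product_local[OF mp u \<psi> \<delta>0(1)])
    fix \<epsilon> x assume "0 < \<epsilon>" "\<epsilon> < \<delta>" "\<psi> x \<noteq> 0"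
    then have "(x - x0) / \<epsilon> \<ge> 1" using \<delta>[of x] by (simp add: field_simps)
    then show "coeff_profile A B ((x - x0) / \<epsilon>) = of_real B" by (simp add: coeff_profile_def step_1)
  qed
qed

section \<open>Regularity for first and second order equations\<close>

text \<open>Local integrability in the form of integrability over compact intervals; by
  \<open>loc_int_imp_locally_integrable\<close> below, it implies integrability over arbitrary compact sets.\<close>

definition loc_int :: "(real \<Rightarrow> complex) \<Rightarrow> bool" where
  "loc_int q \<longleftrightarrow> (\<forall>a b. q absolutely_integrable_on {a..b})"

lemma loc_int_continuous: "continuous_on UNIV F \<Longrightarrow> loc_int F"
  unfolding loc_int_def
  by (intro allI absolutely_integrable_continuous_real) (rule continuous_on_subset, auto)

lemma loc_int_mult_continuous:
  assumes "continuous_on UNIV F" "loc_int q" shows "loc_int (\<lambda>x. F x * q x)"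
  unfolding loc_int_def
proof (intro allI, rule absolutely_integrable_bounded_measurable_product[where h = "(*)"])
  fix a b :: real
  have F: "continuous_on {a..b} F" using assms(1) continuous_on_subset by blast
  show "F \<in> borel_measurable (lebesgue_on {a..b})"
    by (rule continuous_imp_measurable_on_sets_lebesgue[OF F]) simp
  show "bounded (F ` {a..b})"
    by (rule compact_imp_bounded[OF compact_continuous_image[OF F]]) simp
  show "q absolutely_integrable_on {a..b}" using assms(2) by (simp add: loc_int_def)
  show "bilinear ((*) :: complex \<Rightarrow> _)" by (rule bilinear_times)
qed auto

text \<open>The indefinite integral from \<open>0\<close>; one of the two intervals is always empty or a point.\<close>

definition prim :: "(real \<Rightarrow> complex) \<Rightarrow> real \<Rightarrow> complex" where
  "prim q x = integral {0..x} q - integral {x..0} q"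

lemma prim_diff:
  assumes "loc_int q" "a \<le> s"
  shows "prim q s = prim q a + integral {a..s} q"
proof -
  have i: "q integrable_on {c..d}" for c d
    using assms(1) by (auto simp: loc_int_def intro: set_lebesgue_integral_eq_integral(1))
  have comb: "integral {c..d} q + integral {d..e} q = integral {c..e} q" if "c \<le> d" "d \<le> e" for c d e
    by (rule Henstock_Kurzweil_Integration.integral_combine[OF that i])
  have z: "integral {c..d} q = 0" if "d \<le> c" for c d
    using that by (cases "c = d") auto
  consider "0 \<le> a" | "a \<le> 0" "0 \<le> s" | "s \<le> 0" by linarith
  then show ?thesis
  proof cases
    case 1 then show ?thesis using comb[of 0 a s] assms(2) by (simp add: prim_def z)
  next
    case 2 then show ?thesis using comb[of a 0 s] by (simp add: prim_def z algebra_simps)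
  next
    case 3 then show ?thesis using comb[of a s 0] assms(2) by (simp add: prim_def z algebra_simps)
  qed
qed

lemma continuous_prim:
  assumes "loc_int q" shows "continuous_on UNIV (prim q)"
proof (rule continuous_at_imp_continuous_on, rule ballI)
  fix x :: real
  define r where "r = \<bar>x\<bar> + 1"
  have i: "q integrable_on {-r..r}"
    using assms by (auto simp: loc_int_def intro: set_lebesgue_integral_eq_integral(1))
  have "continuous_on {-r..r} (\<lambda>x. prim q (-r) + integral {-r..x} q)"
    by (intro continuous_intros indefinite_integral_continuous_1 i)
  then have "continuous_on {-r..r} (prim q)"
    by (rule continuous_on_eq) (simp add: prim_diff[OF assms, symmetric])
  moreover have "x \<in> interior {-r..r}" by (auto simp: r_def)
  ultimately show "isCont (prim q) x" using continuous_on_interior by blast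
qed

lemma pair_sigma_finite_lebesgue:
  "pair_sigma_finite (lebesgue :: real measure) (lebesgue :: real measure)"
proof -
  have "sigma_finite_measure (lebesgue :: real measure)"
  proof
    let ?A = "range (\<lambda>n::nat. {- real n..real n})"
    have "\<Union>?A = UNIV"
    proof -
      have "x \<in> \<Union>?A" for x :: real
      proof -
        obtain n :: nat where "\<bar>x\<bar> \<le> real n" using real_arch_simple by blast
        then show ?thesis by (auto intro!: exI[of _ n])
      qed
      then show ?thesis by blast
    qed
    then show "\<exists>A. countable A \<and> A \<subseteq> sets lebesgue \<and> \<Union>A = space (lebesgue :: real measure) \<and>
        (\<forall>a\<in>A. emeasure lebesgue a \<noteq> \<infinity>)"
      by (intro exI[of _ ?A]) auto
  qed
  then show ?thesis by (simp add: pair_sigma_finite_def)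
qed

text \<open>Integration by parts for an indefinite Lebesgue integral, by Fubini's theorem.\<close>

lemma prim_by_parts:
  assumes q: "loc_int q" and ab: "a \<le> b"
    and E: "\<And>x. (E has_vector_derivative e x) (at x)" and e: "continuous_on UNIV e"
    and supp: "\<And>x. x \<notin> {a..b} \<Longrightarrow> E x = 0" "\<And>x. x \<notin> {a..b} \<Longrightarrow> e x = 0" and Eab: "E a = 0" "E b = 0"
  shows "(LINT x|lebesgue. q x * E x) = - (LINT x|lebesgue. prim q x * e x)"
proof -
  interpret pair_sigma_finite "lebesgue :: real measure" "lebesgue :: real measure"
    by (rule pair_sigma_finite_lebesgue)
  define q' where "q' = (\<lambda>t. indicator {a..b} t * q t)"
  have qi: "q absolutely_integrable_on {c..d}" for c d using q by (simp add: loc_int_def)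
  have ind: "indicator S t *\<^sub>R z = indicator S t * (z::complex)" for S and t :: real and z
    by (simp add: indicator_def)
  have q': "integrable lebesgue q'"
    using qi[of a b] unfolding q'_def set_integrable_def ind .
  have ei: "integrable lebesgue e"
    by (rule compact_support_integral(1)[of a b]) (use e supp in \<open>auto intro: continuous_on_subset\<close>)
  have FTC: "integral {c..d} e = E d - E c" if "c \<le> d" for c d
    by (rule integral_unique, rule fundamental_theorem_of_calculus[OF that])
       (rule has_vector_derivative_at_within[OF E])
  have LINT_set: "(LINT t|lebesgue. indicator {c..d} t * f t) = integral {c..d} f"
    if "f absolutely_integrable_on {c..d}" for c d and f :: "real \<Rightarrow> complex"
    using set_lebesgue_integral_eq_integral(2)[OF that] by (simp add: set_lebesgue_integral_def ind)
  have e0: "(LINT x|lebesgue. e x) = 0"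
    using compact_support_integral(2)[of a b e] e supp FTC[OF ab] Eab by (auto intro: continuous_on_subset)
  define f where "f = (\<lambda>t s. if t \<le> s then q' t * e s else 0)"
  have meas: "case_prod f \<in> borel_measurable (lebesgue \<Otimes>\<^sub>M lebesgue)"
  proof -
    have id: "(\<lambda>x. x) \<in> borel_measurable (lebesgue :: real measure)"
      by (rule measurable_completion) simp
    have [measurable]: "fst \<in> borel_measurable ((lebesgue :: real measure) \<Otimes>\<^sub>M (lebesgue :: real measure))"
      "snd \<in> borel_measurable ((lebesgue :: real measure) \<Otimes>\<^sub>M (lebesgue :: real measure))"
      by (rule measurable_compose[OF measurable_fst id]) (rule measurable_compose[OF measurable_snd id])
    have [measurable]: "(\<lambda>p. q' (fst p)) \<in> borel_measurable (lebesgue \<Otimes>\<^sub>M (lebesgue :: real measure))"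
      "(\<lambda>p. e (snd p)) \<in> borel_measurable ((lebesgue :: real measure) \<Otimes>\<^sub>M lebesgue)"
      by (rule measurable_compose[OF measurable_fst borel_measurable_integrable[OF q']])
         (rule measurable_compose[OF measurable_snd borel_measurable_integrable[OF ei]])
    show ?thesis unfolding f_def split_def by measurable
  qed
  have "integrable (lebesgue \<Otimes>\<^sub>M lebesgue) (\<lambda>p. q' (fst p) * e (snd p))"
  proof (rule Fubini_integrable)
    show "(\<lambda>p. q' (fst p) * e (snd p)) \<in> borel_measurable (lebesgue \<Otimes>\<^sub>M lebesgue)"
      by (rule borel_measurable_times[OF measurable_compose[OF measurable_fst borel_measurable_integrable[OF q']]
            measurable_compose[OF measurable_snd borel_measurable_integrable[OF ei]]])
  qed (use q' ei in \<open>auto simp: norm_mult\<close>)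
  then have int: "integrable (lebesgue \<Otimes>\<^sub>M lebesgue) (case_prod f)"
    by (rule Bochner_Integration.integrable_bound) (use meas in \<open>auto simp: f_def\<close>)
  have left: "(LINT s|lebesgue. f t s) = - (q t * E t)" for t
  proof (cases "t \<in> {a..b}")
    case True
    \<comment> \<open>beyond \<open>b\<close> the function \<open>e\<close> vanishes, so the half-line \<open>s \<ge> t\<close> may be cut at \<open>b\<close>\<close>
    have "f t s = q t * (indicator {t..b} s * e s)" for s
      using True supp(2)[of s] by (auto simp: f_def q'_def indicator_def)
    then have "(LINT s|lebesgue. f t s) = q t * integral {t..b} e"
      by (simp add: LINT_set absolutely_integrable_continuous_real continuous_on_subset[OF e])
    then show ?thesis using True FTC[of t b] Eab by simp
  next
    case False
    then have "f t s = 0" for s by (simp add: f_def q'_def)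
    then show ?thesis using supp(1)[OF False] by simp
  qed
  have right: "(LINT t|lebesgue. f t s) = (prim q s - prim q a) * e s" for s
  proof (cases "s \<in> {a..b}")
    case True
    have "f t s = (indicator {a..s} t * q t) * e s" for t
      using True by (auto simp: f_def q'_def indicator_def)
    then have "(LINT t|lebesgue. f t s) = integral {a..s} q * e s"
      by (simp add: LINT_set qi)
    then show ?thesis using prim_diff[OF q, of a s] True by simp
  next
    case False
    then have "f t s = 0" for t by (simp add: f_def supp(2))
    then show ?thesis using supp(2)[OF False] by simp
  qed
  have i1: "integrable lebesgue (\<lambda>s. prim q s * e s)"
    by (rule compact_support_integral(1)[of a b])
       (use supp in \<open>auto intro!: continuous_on_mult intro: continuous_on_subset[OF e] continuous_on_subset[OF continuous_prim[OF q]]\<close>)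
  have "- (LINT t|lebesgue. q t * E t) = (LINT t|lebesgue. LINT s|lebesgue. f t s)"
    by (simp add: left)
  also have "\<dots> = (LINT s|lebesgue. LINT t|lebesgue. f t s)"
    by (rule Fubini_integral[OF int, symmetric])
  also have "\<dots> = (LINT s|lebesgue. prim q s * e s - prim q a * e s)"
    by (simp add: right algebra_simps)
  also have "\<dots> = (LINT s|lebesgue. prim q s * e s) - (LINT s|lebesgue. prim q a * e s)"
    by (rule Bochner_Integration.integral_diff[OF i1]) (use ei in simp)
  also have "(LINT s|lebesgue. prim q a * e s) = 0" using e0 by simp
  finally show ?thesis by (metis diff_zero minus_minus)
qed

lemma compact_subset_interval:
  fixes I :: "real set"
  assumes "is_interval I" "I \<noteq> {}" "compact K" "K \<subseteq> I"
  obtains a b where "a \<le> b" "K \<subseteq> {a..b}" "{a..b} \<subseteq> I"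
proof (cases "K = {}")
  case True
  obtain c where "c \<in> I" using assms(2) by blast
  then show ?thesis using that[of c c] True by simp
next
  case False
  obtain a where a: "a \<in> K" "\<forall>x\<in>K. a \<le> x" using compact_attains_inf[OF assms(3) False] by blast
  obtain b where b: "b \<in> K" "\<forall>x\<in>K. x \<le> b" using compact_attains_sup[OF assms(3) False] by blast
  have "{a..b} \<subseteq> I"
  proof
    fix x assume "x \<in> {a..b}"
    moreover have "a \<in> I" "b \<in> I" using assms(4) a(1) b(1) by auto
    ultimately show "x \<in> I" using assms(1)[unfolded is_interval_1] by (metis atLeastAtMost_iff)
  qed
  moreover have "a \<le> b" "K \<subseteq> {a..b}" using a b by auto
  ultimately show ?thesis using that by blast
qed

text \<open>A functional that satisfies a first order equation with locally integrable right-hand side on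
  an interval is a continuous function there. Test functions orthogonal to the homogeneous solution
  \<open>exp (l x)\<close> are of the form \<open>\<eta>' + l \<eta>\<close>, and on those the functional is known; a single test function
  \<open>\<theta>\<close> complements them.\<close>

lemma first_order_regularity:
  fixes v :: "(real \<Rightarrow> complex) \<Rightarrow> complex" and l :: complex
  assumes I: "open I" "is_interval I" "I \<noteq> {}"
    and add: "\<And>\<phi> \<psi>. test_function \<phi> \<Longrightarrow> test_function \<psi> \<Longrightarrow> v (\<lambda>x. \<phi> x + \<psi> x) = v \<phi> + v \<psi>"
    and cmult: "\<And>c \<phi>. test_function \<phi> \<Longrightarrow> v (\<lambda>x. c * \<phi> x) = c * v \<phi>"
    and h: "loc_int h"
    and eq: "\<And>\<psi>. test_function \<psi> \<Longrightarrow> tsupp \<psi> \<subseteq> I \<Longrightarrow> - v (vderiv \<psi>) - l * v \<psi> = (LINT x|lebesgue. h x * \<psi> x)"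
  shows "\<exists>F. continuous_on UNIV F \<and> (\<forall>\<psi>. test_function \<psi> \<longrightarrow> tsupp \<psi> \<subseteq> I \<longrightarrow> v \<psi> = (LINT x|lebesgue. F x * \<psi> x))"
proof -
  let ?e = "\<lambda>x::real. exp (l * of_real x)" and ?d = "\<lambda>x::real. exp ((- l) * of_real x)"
  have ed: "?e x * ?d x = 1" for x by (simp flip: exp_add)
  obtain c where "c \<in> I" using I by blast
  then obtain r where r: "r > 0" "cball c r \<subseteq> I" using I(1) open_contains_cball by blast
  define \<beta> where "\<beta> = (\<lambda>x. bump ((x - c) / r) / of_real r)"
  define \<theta> where "\<theta> = (\<lambda>x. ?d x * \<beta> x)"
  have \<beta>: "test_function \<beta>"
    using test_function_cmult[OF test_function_affine[OF test_bump, of "1/r" "-c/r"], of "1/of_real r"] r(1)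
    by (simp add: \<beta>_def diff_divide_distrib)
  have \<theta>: "test_function \<theta>" unfolding \<theta>_def by (rule test_function_mult[OF \<beta> smooth_exp])
  have \<theta>0: "\<theta> x = 0" if "x \<notin> {c-r..c+r}" for x
  proof -
    have "(x - c) / r \<notin> {-1..1}" using that r(1) by (auto simp: field_simps)
    then show ?thesis by (simp add: \<theta>_def \<beta>_def bump_zero)
  qed
  have \<theta>I: "{c-r..c+r} \<subseteq> I" using r(2) by (simp add: cball_eq_atLeastAtMost)
  have e\<theta>: "(LINT x|lebesgue. ?e x * \<theta> x) = 1"
  proof -
    have "(LINT x|lebesgue. ?e x * \<theta> x) = (LINT x|lebesgue. \<beta> x)"
      unfolding \<theta>_def mult.assoc[symmetric] ed by simp
    also have "\<dots> = of_real \<bar>r\<bar> * (LINT x|lebesgue. \<beta> (c + r * x))"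
      by (rule LINT_affine[OF test_borel[OF \<beta>]]) (use r in simp)
    also have "\<dots> = 1" using r(1) by (simp add: \<beta>_def LINT_bump)
    finally show ?thesis .
  qed
  define q where "q = (\<lambda>x. ?d x * h x)"
  have q: "loc_int q" unfolding q_def by (rule loc_int_mult_continuous[OF smooth_continuous[OF smooth_exp] h])
  define F0 where "F0 = (\<lambda>x. prim q x * ?e x)"
  have F0: "continuous_on UNIV F0"
    unfolding F0_def by (intro continuous_on_mult continuous_prim q smooth_continuous smooth_exp)
  define m where "m = (LINT x|lebesgue. F0 x * \<theta> x)"
  define F where "F = (\<lambda>x. F0 x + (v \<theta> - m) * ?e x)"
  have F: "continuous_on UNIV F"
    unfolding F_def by (intro continuous_on_add continuous_on_mult F0 smooth_continuous[OF smooth_exp] continuous_on_const)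
  have "v \<psi> = (LINT x|lebesgue. F x * \<psi> x)" if \<psi>: "test_function \<psi>" and sub: "tsupp \<psi> \<subseteq> I" for \<psi>
  proof -
    define k where "k = (LINT x|lebesgue. ?e x * \<psi> x)"
    \<comment> \<open>subtracting a multiple of \<open>\<theta>\<close> makes the integral against \<open>exp (l x)\<close> vanish\<close>
    define \<psi>1 where "\<psi>1 = (\<lambda>x. \<psi> x + (- k) * \<theta> x)"
    have \<psi>1: "test_function \<psi>1" unfolding \<psi>1_def by (intro test_function_add test_function_cmult \<psi> \<theta>)
    have "compact (tsupp \<psi> \<union> {c-r..c+r})" "tsupp \<psi> \<union> {c-r..c+r} \<subseteq> I"
      using \<psi> sub \<theta>I by (auto simp: test_function_def)
    then obtain a b where ab: "a \<le> b" "tsupp \<psi> \<union> {c-r..c+r} \<subseteq> {a..b}" "{a..b} \<subseteq> I"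
      using compact_subset_interval[OF I(2,3)] by metis
    define G where "G = (\<lambda>x. ?e x * \<psi>1 x)"
    have G: "test_function G" unfolding G_def by (rule test_function_mult[OF \<psi>1 smooth_exp])
    have Gc: "continuous_on UNIV G" by (rule test_continuous[OF G])
    have G0: "G x = 0" if "x \<notin> {a..b}" for x
    proof -
      have "x \<notin> tsupp \<psi>" "x \<notin> {c-r..c+r}" using that ab(2) by blast+
      then have "\<psi> x = 0" "\<theta> x = 0" using not_in_tsupp \<theta>0 by blast+
      then show ?thesis by (simp add: G_def \<psi>1_def)
    qed
    have LG: "(LINT x|lebesgue. G x) = 0"
    proof -
      have "(LINT x|lebesgue. G x) = (LINT x|lebesgue. ?e x * \<psi> x + (- k) * (?e x * \<theta> x))"
        by (simp add: G_def \<psi>1_def algebra_simps)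
      also have "\<dots> = (LINT x|lebesgue. ?e x * \<psi> x) + (LINT x|lebesgue. (- k) * (?e x * \<theta> x))"
        by (intro Bochner_Integration.integral_add integrable_mult_right test_integrable \<psi> \<theta> smooth_continuous smooth_exp)
      also have "\<dots> = k + (- k) * 1"
        unfolding integral_mult_right_zero e\<theta> by (simp add: k_def)
      finally show ?thesis by simp
    qed
    \<comment> \<open>the primitive has compact support because its integrand has integral \<open>0\<close>\<close>
    define E where "E = (\<lambda>x. integral {a..x} G)"
    have Ed: "(E has_vector_derivative G x) (at x)" for x
      unfolding E_def by (rule primitive_compact_support(1)[OF Gc G0])
    have Er: "E x = 0" if "x \<ge> b" for x
      unfolding E_def using primitive_compact_support(2)[OF Gc G0 that] LG by simp
    have El: "E x = 0" if "x \<le> a" for x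
      unfolding E_def using that by (cases "x = a") auto
    have E0: "E x = 0" if "x \<notin> {a..b}" for x using El[of x] Er[of x] that by auto
    have vE: "vderiv E = G" by (intro ext vderiv_I Ed)
    have sE: "smooth E"
      by (subst smooth_iff) (use Ed differentiableI_vector in \<open>auto simp: vE test_smooth[OF G]\<close>)
    have E: "test_function E" by (rule test_functionI[OF sE E0])
    define \<eta> where "\<eta> = (\<lambda>x. ?d x * E x)"
    have \<eta>: "test_function \<eta>" unfolding \<eta>_def by (rule test_function_mult[OF E smooth_exp])
    have "tsupp \<eta> \<subseteq> {a..b}" by (rule tsupp_subset) (simp add: \<eta>_def E0)
    then have \<eta>I: "tsupp \<eta> \<subseteq> I" using ab(3) by blast
    have vd: "vderiv ?d = (\<lambda>x. (- l) * ?d x)"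
    proof (intro ext vderiv_I)
      fix x :: real
      show "(?d has_vector_derivative (- l) * ?d x) (at x)"
      proof (rule has_vector_derivative_real_field)
        show "((\<lambda>z. exp ((- l) * z)) has_field_derivative (- l) * ?d x) (at (of_real x))"
          by (auto intro!: derivative_eq_intros)
      qed
    qed
    have "\<psi>1 x = vderiv \<eta> x + l * \<eta> x" for x
    proof -
      have "vderiv \<eta> x = ?d x * G x + ((- l) * ?d x) * E x"
        unfolding \<eta>_def vderiv_mult[OF smooth_exp sE] vd vE ..
      moreover have "?d x * G x = \<psi>1 x" unfolding G_def mult.assoc[symmetric] mult.commute[of "?d x"] ed by simp
      ultimately show ?thesis by (simp add: \<eta>_def)
    qed
    then have "\<psi>1 = (\<lambda>x. vderiv \<eta> x + l * \<eta> x)" by blast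
    then have "v \<psi>1 = v (vderiv \<eta>) + l * v \<eta>"
      using add[OF test_function_vderiv[OF \<eta>] test_function_cmult[OF \<eta>], of l] cmult[OF \<eta>, of l]
      by simp
    also have "\<dots> = - (LINT x|lebesgue. h x * \<eta> x)" 
      using arg_cong[OF eq[OF \<eta> \<eta>I], of uminus] by (simp add: add.commute)
    also have "(LINT x|lebesgue. h x * \<eta> x) = (LINT x|lebesgue. q x * E x)"
      by (simp add: q_def \<eta>_def mult_ac)
    also have "\<dots> = - (LINT x|lebesgue. prim q x * G x)"
      by (rule prim_by_parts[OF q ab(1) Ed Gc E0 G0 El Er]) auto
    finally have "v \<psi>1 = (LINT x|lebesgue. prim q x * G x)" by simp
    also have "\<dots> = (LINT x|lebesgue. F0 x * \<psi> x + (- k) * (F0 x * \<theta> x))"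
      by (simp add: F0_def G_def \<psi>1_def algebra_simps)
    also have "\<dots> = (LINT x|lebesgue. F0 x * \<psi> x) + (LINT x|lebesgue. (- k) * (F0 x * \<theta> x))"
      by (intro Bochner_Integration.integral_add integrable_mult_right test_integrable \<psi> \<theta> F0)
    also have "\<dots> = (LINT x|lebesgue. F0 x * \<psi> x) - k * m"
      unfolding integral_mult_right_zero by (simp add: m_def)
    finally have v1: "v \<psi>1 = (LINT x|lebesgue. F0 x * \<psi> x) - k * m" .
    have "v \<psi>1 = v \<psi> + (- k) * v \<theta>"
      unfolding \<psi>1_def add[OF \<psi> test_function_cmult[OF \<theta>]] cmult[OF \<theta>] ..
    with v1 have "v \<psi> = (LINT x|lebesgue. F0 x * \<psi> x) + (v \<theta> - m) * k" by (simp add: algebra_simps)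
    also have "\<dots> = (LINT x|lebesgue. F0 x * \<psi> x) + (LINT x|lebesgue. (v \<theta> - m) * (?e x * \<psi> x))"
      unfolding integral_mult_right_zero by (simp add: k_def)
    also have "\<dots> = (LINT x|lebesgue. F0 x * \<psi> x + (v \<theta> - m) * (?e x * \<psi> x))"
      by (intro Bochner_Integration.integral_add[symmetric] integrable_mult_right test_integrable \<psi> F0 smooth_continuous smooth_exp)
    finally show ?thesis by (simp add: F_def algebra_simps)
  qed
  with F show ?thesis by blast
qed

text \<open>The second order operator factors as \<open>a (D - l) (D + l)\<close> with \<open>l\<^sup>2 = - P / a\<close>.\<close>

lemma second_order_regularity:
  fixes u :: "(real \<Rightarrow> complex) \<Rightarrow> complex" and a P :: complex
  assumes I: "open I" "is_interval I" "I \<noteq> {}" and u: "distribution u" and a: "a \<noteq> 0" and g: "loc_int g"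
    and eq: "\<And>\<psi>. test_function \<psi> \<Longrightarrow> tsupp \<psi> \<subseteq> I \<Longrightarrow>
      a * u (vderiv (vderiv \<psi>)) + P * u \<psi> = (LINT x|lebesgue. g x * \<psi> x)"
  shows "\<exists>F. continuous_on UNIV F \<and> (\<forall>\<psi>. test_function \<psi> \<longrightarrow> tsupp \<psi> \<subseteq> I \<longrightarrow> u \<psi> = (LINT x|lebesgue. F x * \<psi> x))"
proof -
  define l where "l = csqrt (- P / a)"
  have l: "l * l = - P / a" unfolding l_def using power2_csqrt[of "- P / a"] by (simp only: power2_eq_square)
  define v where "v = (\<lambda>\<psi>. - u (vderiv \<psi>) + l * u \<psi>)"
  have "\<exists>F. continuous_on UNIV F \<and> (\<forall>\<psi>. test_function \<psi> \<longrightarrow> tsupp \<psi> \<subseteq> I \<longrightarrow> v \<psi> = (LINT x|lebesgue. F x * \<psi> x))"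
  proof (rule first_order_regularity[OF I])
    show "v (\<lambda>x. \<phi> x + \<psi> x) = v \<phi> + v \<psi>" if "test_function \<phi>" "test_function \<psi>" for \<phi> \<psi>
      unfolding v_def vderiv_add[OF test_smooth[OF that(1)] test_smooth[OF that(2)]]
        distribution_add[OF u test_function_vderiv[OF that(1)] test_function_vderiv[OF that(2)]] distribution_add[OF u that]
      by (simp add: algebra_simps)
    show "v (\<lambda>x. c * \<phi> x) = c * v \<phi>" if "test_function \<phi>" for c \<phi>
      unfolding v_def vderiv_cmult[OF test_smooth[OF that]]
        distribution_cmult[OF u test_function_vderiv[OF that]] distribution_cmult[OF u that]
      by (simp add: algebra_simps)
    show "loc_int (\<lambda>x. (1 / a) * g x)" by (rule loc_int_mult_continuous[OF _ g]) simp
    show "- v (vderiv \<psi>) - l * v \<psi> = (LINT x|lebesgue. (1 / a) * g x * \<psi> x)" if "test_function \<psi>" "tsupp \<psi> \<subseteq> I" for \<psi>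
    proof -
      have "- v (vderiv \<psi>) - l * v \<psi> = u (vderiv (vderiv \<psi>)) - (l * l) * u \<psi>"
        by (simp add: v_def algebra_simps)
      also have "\<dots> = (1 / a) * (LINT x|lebesgue. g x * \<psi> x)"
        unfolding eq[OF that, symmetric] l using a by (simp add: field_simps)
      also have "\<dots> = (LINT x|lebesgue. (1 / a) * (g x * \<psi> x))" by (rule integral_mult_right_zero[symmetric])
      finally show ?thesis by (simp only: mult.assoc)
    qed
  qed
  then obtain F1 where F1: "continuous_on UNIV F1"
    "\<And>\<psi>. test_function \<psi> \<Longrightarrow> tsupp \<psi> \<subseteq> I \<Longrightarrow> v \<psi> = (LINT x|lebesgue. F1 x * \<psi> x)" by blast
  show ?thesis
  proof (rule first_order_regularity[OF I _ _ loc_int_continuous[OF F1(1)]])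
    show "- u (vderiv \<psi>) - (- l) * u \<psi> = (LINT x|lebesgue. F1 x * \<psi> x)" if "test_function \<psi>" "tsupp \<psi> \<subseteq> I" for \<psi>
      using F1(2)[OF that] by (simp add: v_def)
  qed (use distribution_add[OF u] distribution_cmult[OF u] in auto)
qed

section \<open>Regular distributions\<close>

lemma loc_int_imp_locally_integrable: "loc_int f \<Longrightarrow> locally_integrable f"
  unfolding locally_integrable_def
proof (intro allI impI)
  fix K :: "real set" assume f: "loc_int f" and K: "compact K"
  then obtain a where "K \<subseteq> {-a..a}" using compact_imp_bounded bounded_subset_cbox_symmetric by (metis box_real(2))
  moreover have "f absolutely_integrable_on {-a..a}" using f by (simp add: loc_int_def)
  ultimately show "f absolutely_integrable_on K"
    by (rule set_integrable_subset[rotated 2]) (use K in \<open>simp add: lmeasurable_compact fmeasurableD\<close>)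
qed

lemma loc_int_test_integrable:
  assumes f: "loc_int f" and \<psi>: "test_function \<psi>"
  shows "integrable lebesgue (\<lambda>x. f x * \<psi> x)"
proof -
  obtain R where R: "\<And>x. x \<notin> {-R..R} \<Longrightarrow> \<psi> x = 0" using \<psi> test_functionE by metis
  have "(\<lambda>x. \<psi> x * f x) absolutely_integrable_on {-R..R}"
    using loc_int_mult_continuous[OF test_continuous[OF \<psi>] f] by (simp add: loc_int_def)
  then have "integrable lebesgue (\<lambda>x. indicator {-R..R} x *\<^sub>R (\<psi> x * f x))" by (simp add: set_integrable_def)
  moreover have "indicator {-R..R} x *\<^sub>R (\<psi> x * f x) = f x * \<psi> x" for x
    using R[of x] by (auto simp: indicator_def)
  ultimately show ?thesis by simp
qed

text \<open>Conversely, such estimates on all intervals characterise distributions among linear functionals.\<close>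

lemma distributionI:
  assumes "\<And>\<phi> \<psi>. test_function \<phi> \<Longrightarrow> test_function \<psi> \<Longrightarrow> u (\<lambda>x. \<phi> x + \<psi> x) = u \<phi> + u \<psi>"
    and "\<And>c \<phi>. test_function \<phi> \<Longrightarrow> u (\<lambda>x. c * \<phi> x) = c * u \<phi>"
    and bd: "\<And>R. \<exists>C\<ge>0. \<exists>N. \<forall>\<phi> M. test_function \<phi> \<longrightarrow> (\<forall>x. x \<notin> {-R..R} \<longrightarrow> \<phi> x = 0) \<longrightarrow>
       (\<forall>k\<le>N. \<forall>x. norm ((vderiv ^^ k) \<phi> x) \<le> M) \<longrightarrow> norm (u \<phi>) \<le> C * M"
  shows "distribution u"
  unfolding distribution_def
proof (intro conjI allI impI assms(1,2))
  fix K :: "real set" assume "compact K"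
  then obtain R where R: "K \<subseteq> {-R..R}" using compact_imp_bounded bounded_subset_cbox_symmetric by (metis box_real(2))
  obtain C N where C: "C \<ge> 0" "\<forall>\<phi> M. test_function \<phi> \<longrightarrow> (\<forall>x. x \<notin> {-R..R} \<longrightarrow> \<phi> x = 0) \<longrightarrow>
       (\<forall>k\<le>N. \<forall>x. norm ((vderiv ^^ k) \<phi> x) \<le> M) \<longrightarrow> norm (u \<phi>) \<le> C * M"
    using bd[of R] by blast
  show "\<exists>C N. \<forall>\<phi>. test_function \<phi> \<longrightarrow> tsupp \<phi> \<subseteq> K \<longrightarrow>
           norm (u \<phi>) \<le> C * (\<Sum>k\<le>(N::nat). SUP x. norm ((vderiv ^^ k) \<phi> x))"
  proof (intro exI[of _ C] exI[of _ N] allI impI)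
    fix \<phi> assume \<phi>: "test_function \<phi>" and sub: "tsupp \<phi> \<subseteq> K"
    let ?S = "\<lambda>k. SUP x. norm ((vderiv ^^ k) \<phi> x)"
    have le: "norm ((vderiv ^^ k) \<phi> x) \<le> ?S k" for k x
    proof -
      obtain B where "\<And>x. norm ((vderiv ^^ k) \<phi> x) \<le> B" using test_bounded[OF test_function_funpow[OF \<phi>]] by metis
      then have "bdd_above (range (\<lambda>x. norm ((vderiv ^^ k) \<phi> x)))" by (auto intro!: bdd_aboveI)
      then show ?thesis by (rule cSUP_upper[rotated]) simp
    qed
    have ge: "0 \<le> ?S k" for k using le[of k 0] by (rule order_trans[OF norm_ge_zero])
    have "norm ((vderiv ^^ k) \<phi> x) \<le> (\<Sum>k\<le>N. ?S k)" if "k \<le> N" for k x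
    proof (rule order_trans[OF le])
      show "?S k \<le> (\<Sum>k\<le>N. ?S k)" by (rule member_le_sum) (use ge that in auto)
    qed
    moreover have "\<phi> x = 0" if "x \<notin> {-R..R}" for x
      using that R sub not_in_tsupp[of x \<phi>] by blast
    ultimately show "norm (u \<phi>) \<le> C * (\<Sum>k\<le>N. ?S k)" using C(2) \<phi> by blast
  qed
qed

lemma regular_dist_bound:
  assumes f: "loc_int f"
  obtains C where "C \<ge> 0"
    "\<And>\<phi> M. test_function \<phi> \<Longrightarrow> (\<And>x. x \<notin> {-R..R} \<Longrightarrow> \<phi> x = 0) \<Longrightarrow> (\<And>x. norm (\<phi> x) \<le> M) \<Longrightarrow>
       norm (regular_dist f \<phi>) \<le> C * M"
proof -
  define C where "C = (LINT x|lebesgue. norm (indicator {-R..R} x *\<^sub>R f x))"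
  have i: "integrable lebesgue (\<lambda>x. norm (indicator {-R..R} x *\<^sub>R f x))"
    using f unfolding loc_int_def set_integrable_def by (intro integrable_norm) blast
  have "norm (regular_dist f \<phi>) \<le> C * M"
    if t: "test_function \<phi>" and supp: "\<And>x. x \<notin> {-R..R} \<Longrightarrow> \<phi> x = 0" and M: "\<And>x. norm (\<phi> x) \<le> M" for \<phi> M
  proof -
    have "norm (regular_dist f \<phi>) \<le> (LINT x|lebesgue. norm (f x * \<phi> x))"
      unfolding regular_dist_def by (rule integral_norm_bound)
    also have "\<dots> \<le> (LINT x|lebesgue. norm (indicator {-R..R} x *\<^sub>R f x) * M)"
    proof (rule integral_mono)
      show "norm (f x * \<phi> x) \<le> norm (indicator {-R..R} x *\<^sub>R f x) * M" for x
      proof (cases "x \<in> {-R..R}")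
        case True
        then show ?thesis using M by (simp add: norm_mult mult_left_mono)
      next
        case False
        then show ?thesis using supp[OF False] by simp
      qed
    qed (use i loc_int_test_integrable[OF f t] in auto)
    finally show ?thesis by (simp add: C_def)
  qed
  moreover have "C \<ge> 0" unfolding C_def by (rule integral_nonneg_AE) simp
  ultimately show ?thesis using that by blast
qed

lemma distribution_regular:
  assumes f: "loc_int f" shows "distribution (regular_dist f)"
proof (rule distributionI)
  fix \<phi> \<psi> :: "real \<Rightarrow> complex" assume t: "test_function \<phi>" "test_function \<psi>"
  show "regular_dist f (\<lambda>x. \<phi> x + \<psi> x) = regular_dist f \<phi> + regular_dist f \<psi>"
    unfolding regular_dist_def distrib_left
    by (intro Bochner_Integration.integral_add loc_int_test_integrable f t)
next
  fix c :: complex and \<phi> :: "real \<Rightarrow> complex" assume t: "test_function \<phi>"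
  have "(\<lambda>x. f x * (c * \<phi> x)) = (\<lambda>x. c * (f x * \<phi> x))" by (simp add: mult_ac)
  then show "regular_dist f (\<lambda>x. c * \<phi> x) = c * regular_dist f \<phi>"
    unfolding regular_dist_def by (simp only: integral_mult_right_zero)
next
  fix R :: real
  obtain C where "C \<ge> 0" "\<And>\<phi> M. test_function \<phi> \<Longrightarrow> (\<And>x. x \<notin> {-R..R} \<Longrightarrow> \<phi> x = 0) \<Longrightarrow>
      (\<And>x. norm (\<phi> x) \<le> M) \<Longrightarrow> norm (regular_dist f \<phi>) \<le> C * M"
    using regular_dist_bound[OF f, of R] by metis
  then show "\<exists>C\<ge>0. \<exists>N. \<forall>\<phi> M. test_function \<phi> \<longrightarrow> (\<forall>x. x \<notin> {-R..R} \<longrightarrow> \<phi> x = 0) \<longrightarrow>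
       (\<forall>k\<le>N. \<forall>x. norm ((vderiv ^^ k) \<phi> x) \<le> M) \<longrightarrow> norm (regular_dist f \<phi>) \<le> C * M"
    by (intro exI[of _ C] conjI exI[of _ 0]) auto
qed

lemma distribution_minus_distribution:
  assumes u: "distribution u" and w: "distribution w" shows "distribution (\<lambda>\<phi>. u \<phi> - w \<phi>)"
proof (rule distributionI)
  fix R :: real
  obtain C N where C: "C \<ge> 0" "\<And>\<phi> M. test_function \<phi> \<Longrightarrow> (\<And>x. x \<notin> {-R..R} \<Longrightarrow> \<phi> x = 0) \<Longrightarrow>
       (\<And>k x. k \<le> N \<Longrightarrow> norm ((vderiv ^^ k) \<phi> x) \<le> M) \<Longrightarrow> norm (u \<phi>) \<le> C * M"
    using distribution_bound[OF u, of R] by metis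
  obtain C' N' where C': "C' \<ge> 0" "\<And>\<phi> M. test_function \<phi> \<Longrightarrow> (\<And>x. x \<notin> {-R..R} \<Longrightarrow> \<phi> x = 0) \<Longrightarrow>
       (\<And>k x. k \<le> N' \<Longrightarrow> norm ((vderiv ^^ k) \<phi> x) \<le> M) \<Longrightarrow> norm (w \<phi>) \<le> C' * M"
    using distribution_bound[OF w, of R] by metis
  have "norm (u \<phi> - w \<phi>) \<le> (C + C') * M"
    if "test_function \<phi>" "\<forall>x. x \<notin> {-R..R} \<longrightarrow> \<phi> x = 0" "\<forall>k\<le>max N N'. \<forall>x. norm ((vderiv ^^ k) \<phi> x) \<le> M" for \<phi> M
  proof -
    have "norm (u \<phi>) \<le> C * M" by (rule C(2)) (use that in auto)
    moreover have "norm (w \<phi>) \<le> C' * M" by (rule C'(2)) (use that in auto)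
    ultimately show ?thesis using norm_triangle_ineq4[of "u \<phi>" "w \<phi>"] by (simp add: distrib_right)
  qed
  then show "\<exists>C\<ge>0. \<exists>N. \<forall>\<phi> M. test_function \<phi> \<longrightarrow> (\<forall>x. x \<notin> {-R..R} \<longrightarrow> \<phi> x = 0) \<longrightarrow>
       (\<forall>k\<le>N. \<forall>x. norm ((vderiv ^^ k) \<phi> x) \<le> M) \<longrightarrow> norm (u \<phi> - w \<phi>) \<le> C * M"
    using C(1) C'(1) by (intro exI[of _ "C + C'"] conjI exI[of _ "max N N'"]) auto
qed (simp_all add: distribution_add[OF u] distribution_add[OF w] distribution_cmult[OF u] distribution_cmult[OF w] algebra_simps)

lemma loc_int_piecewise:
  assumes "loc_int f1" "loc_int f2" shows "loc_int (\<lambda>x. if x < x0 then f1 x else f2 x)"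
  unfolding loc_int_def
proof (intro allI)
  fix a b :: real
  have "set_integrable lebesgue ({a..b} \<inter> {..<x0}) f1" "set_integrable lebesgue ({a..b} \<inter> {x0..}) f2"
    by (rule set_integrable_subset[where A = "{a..b}"], use assms loc_int_def in blast, simp, blast)+
  then have "integrable lebesgue (\<lambda>x. indicator ({a..b} \<inter> {..<x0}) x *\<^sub>R f1 x + indicator ({a..b} \<inter> {x0..}) x *\<^sub>R f2 x)"
    unfolding set_integrable_def by (rule Bochner_Integration.integrable_add)
  moreover have "indicator ({a..b} \<inter> {..<x0}) x *\<^sub>R f1 x + indicator ({a..b} \<inter> {x0..}) x *\<^sub>R f2 x
      = indicator {a..b} x *\<^sub>R (if x < x0 then f1 x else f2 x)" for x
    by (auto simp: indicator_def)
  ultimately show "(\<lambda>x. if x < x0 then f1 x else f2 x) absolutely_integrable_on {a..b}"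
    by (simp add: set_integrable_def)
qed

section \<open>Distributions supported in a point\<close>

text \<open>A test function that is \<open>1\<close> on \<open>[-1,1]\<close> and \<open>0\<close> outside \<open>[-3,3]\<close>. Written additively in terms of
  steps, it splits a test function into a left, a right and a central part.\<close>

definition cutoff :: "real \<Rightarrow> complex" where
  "cutoff y = step (y + 2) + step (2 - y) - 1"

lemma cutoff_1: "\<bar>y\<bar> \<le> 1 \<Longrightarrow> cutoff y = 1"
  by (simp add: cutoff_def step_1)

lemma cutoff_0: "\<bar>y\<bar> \<ge> 3 \<Longrightarrow> cutoff y = 0"
  by (cases "y \<ge> 0") (simp_all add: cutoff_def step_1 step_0)

lemma smooth_step_affine: "smooth (\<lambda>y. step (a * y + b))"
  by (rule smooth_affine[OF smooth_step])

lemma test_cutoff: "test_function cutoff"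
proof (rule test_functionI[of _ "-3" 3])
  show "smooth cutoff"
    using smooth_diff[OF smooth_add[OF smooth_step_affine[of 1 2] smooth_step_affine[of "-1" 2]] smooth_const[of 1]]
    by (simp add: cutoff_def[abs_def])
  show "cutoff x = 0" if "x \<notin> {-3..3}" for x using that by (intro cutoff_0) auto
qed

lemma test_cutoff_scaled:
  assumes "r > 0" shows "test_function (\<lambda>x. cutoff ((x - x0) / r))"
  using test_function_affine[OF test_cutoff, of "1/r" "-x0/r"] assms by (simp add: diff_divide_distrib)

text \<open>If the \<open>k\<close>-th derivatives of both factors grow like \<open>r\<^sup>k\<close>, then so do those of the product; with
  \<open>r\<close> the reciprocal of a scale this replaces the Leibniz formula.\<close>

lemma funpow_vderiv_mult_bound:
  assumes "smooth f" "smooth g" "F \<ge> 0" "G \<ge> 0" "r \<ge> 0"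
    and "\<And>k. k \<le> n \<Longrightarrow> norm ((vderiv ^^ k) f x) \<le> F * r ^ k"
    and "\<And>k. k \<le> n \<Longrightarrow> norm ((vderiv ^^ k) g x) \<le> G * r ^ k"
  shows "norm ((vderiv ^^ n) (\<lambda>x. f x * g x) x) \<le> 2 ^ n * F * G * r ^ n"
  using assms
proof (induction n arbitrary: f g F G)
  case 0
  have "norm (f x) * norm (g x) \<le> F * G" by (intro mult_mono) (use 0 in auto)
  then show ?case by (simp add: norm_mult)
next
  case (Suc n)
  have fn: "norm ((vderiv ^^ k) f x) \<le> F * r ^ k" "norm ((vderiv ^^ k) (vderiv f) x) \<le> (F * r) * r ^ k"
    "norm ((vderiv ^^ k) g x) \<le> G * r ^ k" "norm ((vderiv ^^ k) (vderiv g) x) \<le> (G * r) * r ^ k" if "k \<le> n" for k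
    using Suc.prems(6,7)[of k] Suc.prems(6,7)[of "Suc k"] that
    by (simp_all add: funpow_Suc_right mult.assoc del: funpow.simps)
  have "(vderiv ^^ Suc n) (\<lambda>x. f x * g x) x
      = (vderiv ^^ n) (\<lambda>x. f x * vderiv g x) x + (vderiv ^^ n) (\<lambda>x. vderiv f x * g x) x"
    by (simp add: funpow_Suc_right vderiv_mult funpow_vderiv_add smooth_mult smooth_vderiv Suc.prems(1,2) del: funpow.simps)
  also have "norm \<dots> \<le> 2 ^ n * F * (G * r) * r ^ n + 2 ^ n * (F * r) * G * r ^ n"
    by (intro norm_triangle_mono Suc.IH) (use Suc.prems fn in \<open>auto intro: smooth_vderiv\<close>)
  finally show ?case by (simp add: algebra_simps)
qed

text \<open>Taylor estimate for a test function with vanishing derivatives up to order \<open>N\<close> at \<open>x0\<close>, by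
  descending induction on the order of the derivative.\<close>

lemma jet_bound:
  assumes \<phi>: "test_function \<phi>" and jet: "\<And>k. k \<le> N \<Longrightarrow> (vderiv ^^ k) \<phi> x0 = 0"
  shows "\<exists>M\<ge>0. \<forall>k\<le>Suc N. \<forall>x. norm ((vderiv ^^ k) \<phi> x) \<le> M * \<bar>x - x0\<bar> ^ (Suc N - k)"
proof -
  obtain M where M: "M \<ge> 0" "\<And>x. norm ((vderiv ^^ Suc N) \<phi> x) \<le> M"
    using test_bounded[OF test_function_funpow[OF \<phi>]] by metis
  have "norm ((vderiv ^^ (Suc N - j)) \<phi> x) \<le> M * \<bar>x - x0\<bar> ^ j" if "j \<le> Suc N" for j x
    using that
  proof (induction j arbitrary: x)
    case 0
    then show ?case using M by simp
  next
    case (Suc j)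
    define f where "f = (vderiv ^^ (Suc N - Suc j)) \<phi>"
    have f': "vderiv f = (vderiv ^^ (Suc N - j)) \<phi>"
      using Suc.prems by (simp add: f_def Suc_diff_le)
    have "norm (f x - f x0) \<le> (M * \<bar>x - x0\<bar> ^ j) * norm (x - x0)"
    proof (rule differentiable_bound[of "closed_segment x0 x" f "\<lambda>y h. h *\<^sub>R vderiv f y"])
      fix y assume y: "y \<in> closed_segment x0 x"
      show "(f has_derivative (\<lambda>h. h *\<^sub>R vderiv f y)) (at y within closed_segment x0 x)"
        using smooth_has_vderiv_within[OF smooth_funpow[OF test_smooth[OF \<phi>]]] by (simp add: f_def has_vector_derivative_def)
      have "\<bar>y - x0\<bar> \<le> \<bar>x - x0\<bar>" using y by (auto simp: closed_segment_eq_real_ivl split: if_splits)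
      then have "M * \<bar>y - x0\<bar> ^ j \<le> M * \<bar>x - x0\<bar> ^ j" by (intro mult_left_mono power_mono M) auto
      then have "norm (vderiv f y) \<le> M * \<bar>x - x0\<bar> ^ j"
        using Suc.IH[of y] Suc.prems unfolding f' by simp
      then have "\<bar>h\<bar> * norm (vderiv f y) \<le> \<bar>h\<bar> * (M * \<bar>x - x0\<bar> ^ j)" for h by (rule mult_left_mono) simp
      then show "onorm (\<lambda>h. h *\<^sub>R vderiv f y) \<le> M * \<bar>x - x0\<bar> ^ j"
        by (intro onorm_le) (simp add: mult.commute)
    qed auto
    moreover have "f x0 = 0" unfolding f_def using Suc.prems by (intro jet) simp
    ultimately show ?case unfolding f_def by (simp add: mult_ac)
  qed
  from this[of "Suc N - k" for k] have "norm ((vderiv ^^ k) \<phi> x) \<le> M * \<bar>x - x0\<bar> ^ (Suc N - k)" if "k \<le> Suc N" for k x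
    using that by (metis diff_diff_cancel diff_le_self)
  then show ?thesis using M(1) by blast
qed

lemma point_support_cutoff:
  assumes v: "distribution v"
    and left: "\<And>\<psi>. test_function \<psi> \<Longrightarrow> tsupp \<psi> \<subseteq> {..<x0} \<Longrightarrow> v \<psi> = 0"
    and right: "\<And>\<psi>. test_function \<psi> \<Longrightarrow> tsupp \<psi> \<subseteq> {x0<..} \<Longrightarrow> v \<psi> = 0"
    and \<psi>: "test_function \<psi>" and r: "r > 0"
  shows "v \<psi> = v (\<lambda>x. cutoff ((x - x0) / r) * \<psi> x)"
proof -
  define L where "L = (\<lambda>x. (1 - step ((x - x0) / r + 2)) * \<psi> x)"
  define T where "T = (\<lambda>x. (1 - step (2 - (x - x0) / r)) * \<psi> x)"
  have sm: "smooth (\<lambda>x. 1 - step ((x - x0) / r + 2))" "smooth (\<lambda>x. 1 - step (2 - (x - x0) / r))"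
    using smooth_diff[OF smooth_const[of 1] smooth_step_affine[of "1/r" "2 - x0/r"]]
      smooth_diff[OF smooth_const[of 1] smooth_step_affine[of "-1/r" "2 + x0/r"]]
    by (simp_all add: diff_divide_distrib algebra_simps)
  have tL: "test_function L" and tT: "test_function T"
    unfolding L_def T_def by (rule test_function_mult[OF \<psi> sm(1)], rule test_function_mult[OF \<psi> sm(2)])
  have tC: "test_function (\<lambda>x. cutoff ((x - x0) / r) * \<psi> x)"
    by (rule test_function_mult[OF \<psi> test_smooth[OF test_cutoff_scaled[OF r]]])
  have "L x = 0" if "x > x0 - r" for x
  proof -
    have "(x - x0) / r + 2 \<ge> 1" using that r by (simp add: field_simps)
    then show ?thesis by (simp add: L_def step_1)
  qed
  then have "{x. L x \<noteq> 0} \<subseteq> {..x0 - r}" by (force simp: not_less[symmetric])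
  then have "tsupp L \<subseteq> {..x0 - r}" unfolding tsupp_def by (rule closure_minimal) simp
  moreover have "{..x0 - r} \<subseteq> {..<x0}" using r by auto
  ultimately have vL: "v L = 0" by (intro left tL) blast
  have "T x = 0" if "x < x0 + r" for x
  proof -
    have "2 - (x - x0) / r \<ge> 1" using that r by (simp add: field_simps)
    then show ?thesis by (simp add: T_def step_1)
  qed
  then have "{x. T x \<noteq> 0} \<subseteq> {x0 + r..}" by (force simp: not_less[symmetric])
  then have "tsupp T \<subseteq> {x0 + r..}" unfolding tsupp_def by (rule closure_minimal) simp
  moreover have "{x0 + r..} \<subseteq> {x0<..}" using r by auto
  ultimately have vT: "v T = 0" by (intro right tT) blast
  have "\<psi> = (\<lambda>x. (L x + T x) + cutoff ((x - x0) / r) * \<psi> x)"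
    by (auto simp: L_def T_def cutoff_def algebra_simps)
  then have "v \<psi> = v (\<lambda>x. (L x + T x) + cutoff ((x - x0) / r) * \<psi> x)" by (rule arg_cong)
  also have "\<dots> = v L + v T + v (\<lambda>x. cutoff ((x - x0) / r) * \<psi> x)"
    by (simp only: distribution_add[OF v test_function_add[OF tL tT] tC] distribution_add[OF v tL tT])
  finally show ?thesis using vL vT by simp
qed

text \<open>A distribution of order \<open>N\<close> supported in \<open>x0\<close> vanishes on test functions whose derivatives up to
  order \<open>N\<close> vanish there: cut off at distance \<open>r\<close> from \<open>x0\<close>, such a function has derivatives up to
  order \<open>N\<close> of size \<open>O(r)\<close>.\<close>

lemma point_support_jet:
  assumes v: "distribution v"
    and left: "\<And>\<psi>. test_function \<psi> \<Longrightarrow> tsupp \<psi> \<subseteq> {..<x0} \<Longrightarrow> v \<psi> = 0"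
    and right: "\<And>\<psi>. test_function \<psi> \<Longrightarrow> tsupp \<psi> \<subseteq> {x0<..} \<Longrightarrow> v \<psi> = 0"
  shows "\<exists>N. \<forall>\<psi>. test_function \<psi> \<longrightarrow> (\<forall>k\<le>N. (vderiv ^^ k) \<psi> x0 = 0) \<longrightarrow> v \<psi> = 0"
proof -
  define R where "R = \<bar>x0\<bar> + 3"
  obtain C N where C: "C \<ge> 0" and bd: "\<And>\<phi> M. test_function \<phi> \<Longrightarrow> (\<And>x. x \<notin> {-R..R} \<Longrightarrow> \<phi> x = 0) \<Longrightarrow>
       (\<And>k x. k \<le> N \<Longrightarrow> norm ((vderiv ^^ k) \<phi> x) \<le> M) \<Longrightarrow> norm (v \<phi>) \<le> C * M"
    using distribution_bound[OF v, of R] by metis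
  have "\<exists>X\<ge>0. \<forall>k\<le>N. \<forall>y. norm ((vderiv ^^ k) cutoff y) \<le> X"
    by (rule uniform_const) (metis test_bounded test_function_funpow test_cutoff, meson order_trans)
  then obtain X where X: "X \<ge> 0" "\<And>k y. k \<le> N \<Longrightarrow> norm ((vderiv ^^ k) cutoff y) \<le> X" by blast
  have "v \<psi> = 0" if \<psi>: "test_function \<psi>" and jet: "\<And>k. k \<le> N \<Longrightarrow> (vderiv ^^ k) \<psi> x0 = 0" for \<psi>
  proof -
    obtain M where M: "M \<ge> 0" "\<And>k x. k \<le> Suc N \<Longrightarrow> norm ((vderiv ^^ k) \<psi> x) \<le> M * \<bar>x - x0\<bar> ^ (Suc N - k)"
      using jet_bound[OF \<psi> jet] by blast
    define K where "K = 2 ^ N * X * (M * 3 ^ Suc N)"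
    have K: "K \<ge> 0" using X M by (simp add: K_def)
    have est: "norm (v \<psi>) \<le> C * (K * r)" if r: "0 < r" "r \<le> 1" for r
    proof -
      let ?c = "\<lambda>x. cutoff ((x - x0) / r)"
      have tc: "test_function ?c" by (rule test_cutoff_scaled[OF r(1)])
      have c0: "?c x = 0" if "x \<notin> {x0 - 3 * r..x0 + 3 * r}" for x
      proof (rule cutoff_0)
        have "\<bar>x - x0\<bar> \<ge> 3 * r" using that by auto
        then show "\<bar>(x - x0) / r\<bar> \<ge> 3" using r by (simp add: abs_divide field_simps)
      qed
      have ck: "norm ((vderiv ^^ k) ?c x) \<le> X * (1 / r) ^ k" if "k \<le> N" for k x
      proof -
        have "(vderiv ^^ k) ?c x = of_real (1 / r) ^ k * (vderiv ^^ k) cutoff ((x - x0) / r)"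
          using funpow_vderiv_affine[OF test_smooth[OF test_cutoff], of k "1/r" "-x0/r"] by (simp add: diff_divide_distrib)
        then have "norm ((vderiv ^^ k) ?c x) = (1 / r) ^ k * norm ((vderiv ^^ k) cutoff ((x - x0) / r))"
          using r by (simp add: norm_mult norm_power norm_divide power_divide)
        also have "\<dots> \<le> (1 / r) ^ k * X" by (intro mult_left_mono X that) (use r in auto)
        finally show ?thesis by (simp add: mult.commute)
      qed
      have "norm (v (\<lambda>x. ?c x * \<psi> x)) \<le> C * (K * r)"
      proof (rule bd)
        show "test_function (\<lambda>x. ?c x * \<psi> x)" by (rule test_function_mult[OF \<psi> test_smooth[OF tc]])
        show "?c x * \<psi> x = 0" if "x \<notin> {-R..R}" for x
        proof -
          have "x \<notin> {x0 - 3 * r..x0 + 3 * r}" using that r by (auto simp: R_def)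
          then show ?thesis using c0 by simp
        qed
        show "norm ((vderiv ^^ k) (\<lambda>x. ?c x * \<psi> x) x) \<le> K * r" if k: "k \<le> N" for k x
        proof (cases "x \<in> {x0 - 3 * r..x0 + 3 * r}")
          case False
          then have "(vderiv ^^ k) (\<lambda>x. ?c x * \<psi> x) x = 0"
            by (intro funpow_vderiv_supp[of "x0 - 3 * r" "x0 + 3 * r"]) (simp_all only: c0 mult_zero_left not_False_eq_True)
          then show ?thesis using K r by simp
        next
          case True
          then have x: "\<bar>x - x0\<bar> \<le> 3 * r" by auto
          have \<psi>k: "norm ((vderiv ^^ i) \<psi> x) \<le> (M * (3 ^ Suc N * r ^ Suc N)) * (1 / r) ^ i" if i: "i \<le> N" for i
          proof -
            have "\<bar>x - x0\<bar> ^ (Suc N - i) \<le> (3 * r) ^ (Suc N - i)" by (rule power_mono[OF x]) simp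
            also have "\<dots> = 3 ^ (Suc N - i) * r ^ (Suc N - i)" by (rule power_mult_distrib)
            also have "\<dots> \<le> 3 ^ Suc N * r ^ (Suc N - i)"
              by (intro mult_right_mono power_increasing) (use r in auto)
            also have "r ^ (Suc N - i) = r ^ Suc N * (1 / r) ^ i"
              using i r by (simp add: power_diff power_divide del: power_Suc)
            finally have "M * \<bar>x - x0\<bar> ^ (Suc N - i) \<le> M * (3 ^ Suc N * (r ^ Suc N * (1 / r) ^ i))"
              using M(1) by (rule mult_left_mono)
            then show ?thesis using M(2)[of i x] i by (simp add: mult.assoc del: power_Suc)
          qed
          have "norm ((vderiv ^^ k) (\<lambda>x. ?c x * \<psi> x) x) \<le> 2 ^ k * X * (M * (3 ^ Suc N * r ^ Suc N)) * (1 / r) ^ k"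
          proof (rule funpow_vderiv_mult_bound)
            show "norm ((vderiv ^^ i) ?c x) \<le> X * (1 / r) ^ i" if "i \<le> k" for i
              by (rule ck) (use that k in simp)
            show "norm ((vderiv ^^ i) \<psi> x) \<le> (M * (3 ^ Suc N * r ^ Suc N)) * (1 / r) ^ i" if "i \<le> k" for i
              by (rule \<psi>k) (use that k in simp)
          qed (use M X r test_smooth[OF tc] test_smooth[OF \<psi>] in auto)
          also have "\<dots> = (2 ^ k * X * (M * 3 ^ Suc N)) * (r ^ Suc N * (1 / r) ^ k)"
            by (simp add: mult_ac)
          also have "r ^ Suc N * (1 / r) ^ k = r ^ (Suc N - k)"
            using k r by (simp add: power_diff power_divide del: power_Suc)
          also have "(2 ^ k * X * (M * 3 ^ Suc N)) * r ^ (Suc N - k) \<le> K * r"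
          proof (rule mult_mono)
            show "2 ^ k * X * (M * 3 ^ Suc N) \<le> K" unfolding K_def
              by (intro mult_right_mono power_increasing) (use k X M in auto)
            show "r ^ (Suc N - k) \<le> r" using power_decreasing[of 1 "Suc N - k" r] k r by simp
          qed (use r K in auto)
          finally show ?thesis .
        qed
      qed
      then show ?thesis using point_support_cutoff[OF v left right \<psi> r(1)] by simp
    qed
    have "((\<lambda>r. C * (K * r)) \<longlongrightarrow> 0) (at_right 0)"
      by (rule tendsto_eq_intros refl)+ auto
    moreover have "eventually (\<lambda>r. norm (v \<psi>) \<le> C * (K * r)) (at_right 0)"
      by (rule eventually_mono[OF eventually_at_right_real[of 0 1]]) (auto intro!: est)
    ultimately have "norm (v \<psi>) \<le> 0"
      by (rule tendsto_lowerbound[where F = "at_right (0::real)"]) simp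
    then show ?thesis by simp
  qed
  then show ?thesis by blast
qed

text \<open>Linear algebra: a functional vanishing on the common kernel of finitely many functionals is a
  linear combination of them.\<close>

lemma functional_in_span:
  fixes v :: "(real \<Rightarrow> complex) \<Rightarrow> complex" and l :: "nat \<Rightarrow> (real \<Rightarrow> complex) \<Rightarrow> complex"
  assumes V: "\<And>\<phi> \<psi> c. V \<phi> \<Longrightarrow> V \<psi> \<Longrightarrow> V (\<lambda>x. \<phi> x + c * \<psi> x)"
    and v: "\<And>\<phi> \<psi> c. V \<phi> \<Longrightarrow> V \<psi> \<Longrightarrow> v (\<lambda>x. \<phi> x + c * \<psi> x) = v \<phi> + c * v \<psi>"
    and l: "\<And>k \<phi> \<psi> c. V \<phi> \<Longrightarrow> V \<psi> \<Longrightarrow> l k (\<lambda>x. \<phi> x + c * \<psi> x) = l k \<phi> + c * l k \<psi>"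
    and ker: "\<And>\<phi>. V \<phi> \<Longrightarrow> (\<And>k. k < n \<Longrightarrow> l k \<phi> = 0) \<Longrightarrow> v \<phi> = 0"
  shows "\<exists>c. \<forall>\<phi>. V \<phi> \<longrightarrow> v \<phi> = (\<Sum>k<n. c k * l k \<phi>)"
  using v ker
proof (induction n arbitrary: v)
  case 0
  then show ?case by simp
next
  case (Suc n)
  \<comment> \<open>\<open>w\<close> is dual to the last functional; without such a \<open>w\<close> that functional is redundant and gets coefficient \<open>0\<close>\<close>
  define d where "d = (if \<exists>w. V w \<and> (\<forall>k<n. l k w = 0) \<and> l n w \<noteq> 0
      then (let w = SOME w. V w \<and> (\<forall>k<n. l k w = 0) \<and> l n w \<noteq> 0 in v w / l n w) else 0)"
  have "\<exists>c. \<forall>\<phi>. V \<phi> \<longrightarrow> v \<phi> - d * l n \<phi> = (\<Sum>k<n. c k * l k \<phi>)"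
  proof (rule Suc.IH)
    show "v (\<lambda>x. \<phi> x + c * \<psi> x) - d * l n (\<lambda>x. \<phi> x + c * \<psi> x) = v \<phi> - d * l n \<phi> + c * (v \<psi> - d * l n \<psi>)"
      if "V \<phi>" "V \<psi>" for \<phi> \<psi> c
      unfolding Suc.prems(1)[OF that] l[OF that] by (simp add: algebra_simps)
    fix \<phi> assume \<phi>: "V \<phi>" "\<And>k. k < n \<Longrightarrow> l k \<phi> = 0"
    show "v \<phi> - d * l n \<phi> = 0"
    proof (cases "\<exists>w. V w \<and> (\<forall>k<n. l k w = 0) \<and> l n w \<noteq> 0")
      case True
      define w where "w = (SOME w. V w \<and> (\<forall>k<n. l k w = 0) \<and> l n w \<noteq> 0)"
      have w: "V w" "\<And>k. k < n \<Longrightarrow> l k w = 0" "l n w \<noteq> 0"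
        using someI_ex[OF True] unfolding w_def by blast+
      have d: "d = v w / l n w" using True by (simp add: d_def w_def Let_def)
      have "v (\<lambda>x. \<phi> x + (- l n \<phi> / l n w) * w x) = 0"
      proof (rule Suc.prems(2)[OF V[OF \<phi>(1) w(1)]])
        fix k assume "k < Suc n"
        then show "l k (\<lambda>x. \<phi> x + (- l n \<phi> / l n w) * w x) = 0"
          unfolding l[OF \<phi>(1) w(1)] using \<phi>(2) w(2,3) by (cases "k = n") auto
      qed
      then show ?thesis unfolding Suc.prems(1)[OF \<phi>(1) w(1)] d using w(3) by (simp add: field_simps)
    next
      case False
      then have "l k \<phi> = 0" if "k < Suc n" for k using \<phi> that less_Suc_eq by blast
      then have "v \<phi> = 0" using Suc.prems(2)[OF \<phi>(1)] by blast
      moreover have "d = 0" using False by (auto simp: d_def)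
      ultimately show ?thesis by simp
    qed
  qed
  then obtain c where c: "\<And>\<phi>. V \<phi> \<Longrightarrow> v \<phi> - d * l n \<phi> = (\<Sum>k<n. c k * l k \<phi>)" by blast
  have "v \<phi> = (\<Sum>k<Suc n. (c(n := d)) k * l k \<phi>)" if "V \<phi>" for \<phi>
    using c[OF that] by (simp add: algebra_simps)
  then show ?case by blast
qed

lemma point_support_structure:
  assumes v: "distribution v"
    and left: "\<And>\<psi>. test_function \<psi> \<Longrightarrow> tsupp \<psi> \<subseteq> {..<x0} \<Longrightarrow> v \<psi> = 0"
    and right: "\<And>\<psi>. test_function \<psi> \<Longrightarrow> tsupp \<psi> \<subseteq> {x0<..} \<Longrightarrow> v \<psi> = 0"
  shows "\<exists>N c. \<forall>\<psi>. test_function \<psi> \<longrightarrow> v \<psi> = (\<Sum>k\<le>(N::nat). c k * (vderiv ^^ k) \<psi> x0)"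
proof -
  obtain N where N: "\<And>\<psi>. test_function \<psi> \<Longrightarrow> (\<And>k. k \<le> N \<Longrightarrow> (vderiv ^^ k) \<psi> x0 = 0) \<Longrightarrow> v \<psi> = 0"
    using point_support_jet[OF v left right] by blast
  have "\<exists>c. \<forall>\<phi>. test_function \<phi> \<longrightarrow> v \<phi> = (\<Sum>k<Suc N. c k * (vderiv ^^ k) \<phi> x0)"
  proof (rule functional_in_span)
    fix \<phi> \<psi> :: "real \<Rightarrow> complex" and c assume t: "test_function \<phi>" "test_function \<psi>"
    show "test_function (\<lambda>x. \<phi> x + c * \<psi> x)" by (intro test_function_add test_function_cmult t)
    show "v (\<lambda>x. \<phi> x + c * \<psi> x) = v \<phi> + c * v \<psi>"
      by (simp only: distribution_add[OF v t(1) test_function_cmult[OF t(2)]] distribution_cmult[OF v t(2)])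
    show "(vderiv ^^ k) (\<lambda>x. \<phi> x + c * \<psi> x) x0 = (vderiv ^^ k) \<phi> x0 + c * (vderiv ^^ k) \<psi> x0" for k
      by (simp only: funpow_vderiv_add[OF test_smooth[OF t(1)] test_smooth[OF test_function_cmult[OF t(2)]]]
          funpow_vderiv_cmult[OF test_smooth[OF t(2)]])
  next
    show "v \<phi> = 0" if "test_function \<phi>" "\<And>k. k < Suc N \<Longrightarrow> (vderiv ^^ k) \<phi> x0 = 0" for \<phi>
      using N[OF that(1)] that(2) by simp
  qed
  then show ?thesis unfolding lessThan_Suc_atMost by blast
qed

section \<open>Moments of the profile against derivatives of the bump function\<close>

text \<open>The integrals of \<open>y\<^sup>j \<alpha> b\<^sup>(\<^sup>k\<^sup>)\<close>, where \<open>\<alpha>\<close> is the profile of the regularised coefficient and \<open>b\<close> the bump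
  function.\<close>

definition moment :: "real \<Rightarrow> real \<Rightarrow> nat \<Rightarrow> nat \<Rightarrow> complex" where
  "moment A B j k = (LINT y|lebesgue. (of_real y ^ j * coeff_profile A B y) * (vderiv ^^ k) bump y)"

lemma vderiv_coeff_profile: "vderiv (coeff_profile A B) = (\<lambda>y. of_real (B - A) * bump y)"
  unfolding coeff_profile_def[abs_def]
  by (simp only: vderiv_add[OF smooth_const smooth_mult[OF smooth_const smooth_step]] vderiv_cmult[OF smooth_step] vderiv_step
      vderiv_const add_0)

lemma funpow_vderiv_coeff_profile:
  "(vderiv ^^ Suc m) (coeff_profile A B) = (\<lambda>y. of_real (B - A) * (vderiv ^^ m) bump y)"
  unfolding funpow_Suc_right o_apply vderiv_coeff_profile by (rule funpow_vderiv_cmult[OF smooth_bump])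

lemma funpow_vderiv_id_mult:
  assumes "smooth f"
  shows "(vderiv ^^ Suc m) (\<lambda>y. of_real y * f y)
       = (\<lambda>y. of_real y * (vderiv ^^ Suc m) f y + of_nat (Suc m) * (vderiv ^^ m) f y)"
proof (induction m)
  case 0
  show ?case by (simp add: vderiv_mult[OF smooth_of_real assms])
next
  case (Suc m)
  have sm: "smooth (\<lambda>y. of_real y * (vderiv ^^ Suc m) f y)" "smooth (\<lambda>y. of_nat (Suc m) * (vderiv ^^ m) f y)"
    by (intro smooth_mult smooth_of_real smooth_const smooth_funpow assms)+
  have "(vderiv ^^ Suc (Suc m)) (\<lambda>y. of_real y * f y)
      = vderiv (\<lambda>y. of_real y * (vderiv ^^ Suc m) f y + of_nat (Suc m) * (vderiv ^^ m) f y)"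
    by (subst funpow.simps(2)) (simp only: o_apply Suc)
  also have "\<dots> = (\<lambda>y. (of_real y * (vderiv ^^ Suc (Suc m)) f y + 1 * (vderiv ^^ Suc m) f y) + of_nat (Suc m) * (vderiv ^^ Suc m) f y)"
    unfolding vderiv_add[OF sm] vderiv_mult[OF smooth_of_real smooth_funpow[OF assms]] vderiv_of_real
      vderiv_cmult[OF smooth_funpow[OF assms]] by simp
  finally show ?case by (simp add: algebra_simps)
qed

lemma moment_odd:
  assumes "A \<noteq> B" shows "moment A B 0 (m + Suc m) \<noteq> 0"
proof -
  have "moment A B 0 (m + Suc m) = (-1) ^ Suc m * (LINT x|lebesgue. (vderiv ^^ Suc m) (coeff_profile A B) x * (vderiv ^^ m) bump x)"
    using integral_by_parts_test_funpow[OF smooth_coeff_profile test_bump, of A B m "Suc m"] by (simp only: moment_def power_0 mult_1)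
  also have "\<dots> = (-1) ^ Suc m * (of_real (B - A) * (LINT x|lebesgue. (vderiv ^^ m) bump x * (vderiv ^^ m) bump x))"
    unfolding funpow_vderiv_coeff_profile mult.assoc integral_mult_right_zero ..
  finally show ?thesis using assms LINT_bump_deriv_sq[of m] by simp
qed

lemma moment_even:
  assumes "A \<noteq> B" shows "moment A B 1 (Suc m + Suc m) \<noteq> 0"
proof -
  let ?\<phi> = "(vderiv ^^ m) bump" and ?\<alpha> = "coeff_profile A B"
  define J where "J = (LINT x|lebesgue. ?\<phi> x * ?\<phi> x)"
  define X where "X = (LINT x|lebesgue. (of_real x * ?\<phi> x) * vderiv ?\<phi> x)"
  define Y where "Y = (LINT x|lebesgue. (vderiv ^^ m) ?\<alpha> x * vderiv ?\<phi> x)"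
  have \<phi>: "test_function ?\<phi>" by (rule test_function_funpow[OF test_bump])
  have s\<phi>: "smooth ?\<phi>" by (rule test_smooth[OF \<phi>])
  have sx: "smooth (\<lambda>x. of_real x * ?\<phi> x)" by (intro smooth_mult smooth_of_real s\<phi>)
  have "X = - (LINT x|lebesgue. vderiv (\<lambda>x. of_real x * ?\<phi> x) x * ?\<phi> x)"
    unfolding X_def by (rule integral_by_parts_test[OF sx \<phi>])
  also have "\<dots> = - (LINT x|lebesgue. (of_real x * ?\<phi> x) * vderiv ?\<phi> x + ?\<phi> x * ?\<phi> x)"
    unfolding vderiv_mult[OF smooth_of_real s\<phi>] by (simp add: algebra_simps)
  also have "(LINT x|lebesgue. (of_real x * ?\<phi> x) * vderiv ?\<phi> x + ?\<phi> x * ?\<phi> x) = X + J"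
    unfolding X_def J_def
    by (intro Bochner_Integration.integral_add test_integrable \<phi> test_function_vderiv smooth_continuous sx s\<phi>)
  finally have X: "2 * X = - J" by (simp add: algebra_simps)
  have "Y = - (LINT x|lebesgue. vderiv ((vderiv ^^ m) ?\<alpha>) x * ?\<phi> x)"
    unfolding Y_def by (rule integral_by_parts_test[OF smooth_funpow[OF smooth_coeff_profile] \<phi>])
  also have "vderiv ((vderiv ^^ m) ?\<alpha>) = (\<lambda>y. of_real (B - A) * ?\<phi> y)"
    using funpow_vderiv_coeff_profile[of m A B] by simp
  also have "(LINT x|lebesgue. of_real (B - A) * ?\<phi> x * ?\<phi> x) = of_real (B - A) * J"
    unfolding J_def mult.assoc integral_mult_right_zero ..
  finally have Y: "Y = - (of_real (B - A) * J)" .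
  have "moment A B 1 (Suc m + Suc m)
      = (-1) ^ Suc m * (LINT x|lebesgue. (vderiv ^^ Suc m) (\<lambda>y. of_real y * ?\<alpha> y) x * (vderiv ^^ Suc m) bump x)"
    unfolding moment_def power_one_right
    by (rule integral_by_parts_test_funpow[OF smooth_mult[OF smooth_of_real smooth_coeff_profile] test_bump])
  also have "(LINT x|lebesgue. (vderiv ^^ Suc m) (\<lambda>y. of_real y * ?\<alpha> y) x * (vderiv ^^ Suc m) bump x)
      = (LINT x|lebesgue. of_real (B - A) * ((of_real x * ?\<phi> x) * vderiv ?\<phi> x) + of_nat (Suc m) * ((vderiv ^^ m) ?\<alpha> x * vderiv ?\<phi> x))"
    unfolding funpow_vderiv_id_mult[OF smooth_coeff_profile] funpow_vderiv_coeff_profile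
    by (simp add: algebra_simps)
  also have "\<dots> = (LINT x|lebesgue. of_real (B - A) * ((of_real x * ?\<phi> x) * vderiv ?\<phi> x)) + (LINT x|lebesgue. of_nat (Suc m) * ((vderiv ^^ m) ?\<alpha> x * vderiv ?\<phi> x))"
    by (intro Bochner_Integration.integral_add integrable_mult_right test_integrable test_function_vderiv \<phi> smooth_continuous sx
        smooth_funpow smooth_coeff_profile)
  also have "\<dots> = of_real (B - A) * X + of_nat (Suc m) * Y"
    unfolding integral_mult_right_zero X_def Y_def ..
  also have "\<dots> = - (of_real (B - A) * (1 / 2 + of_nat (Suc m)) * J)"
  proof -
    have X': "X = - J / 2" using X by (simp add: field_simps)
    show ?thesis unfolding Y X' by (simp add: field_simps)
  qed
  finally have eq: "moment A B 1 (Suc m + Suc m) = (-1) ^ Suc m * - (of_real (B - A) * (1 / 2 + of_nat (Suc m)) * J)" .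
  have "1 / 2 + of_nat (Suc m) \<noteq> (0::complex)"
  proof
    assume "1 / 2 + of_nat (Suc m) = (0::complex)"
    then have "Re (1 / 2 + of_nat (Suc m)) = 0" by (metis zero_complex.sel(1))
    then show False by simp
  qed
  then show ?thesis unfolding eq using assms LINT_bump_deriv_sq[of m] by (simp add: J_def)
qed

text \<open>For every order \<open>n \<ge> 1\<close> there is a power \<open>j < n\<close> for which the moment does not vanish: \<open>j = 0\<close> for
  odd and \<open>j = 1\<close> for even \<open>n\<close>. For even \<open>n\<close> the power \<open>j = 0\<close> would not do, since then the moment is
  a multiple of \<open>\<integral> b\<^sup>(\<^sup>m\<^sup>) b\<^sup>(\<^sup>m\<^sup>+\<^sup>1\<^sup>) = 0\<close>.\<close>

lemma moment_exists:
  assumes "A \<noteq> B" "n \<ge> 1" shows "\<exists>j<n. moment A B j n \<noteq> 0"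
proof (cases "even n")
  case True
  then obtain m where "n = 2 * m" by blast
  moreover from this assms(2) obtain m' where "m = Suc m'" by (cases m) auto
  ultimately have "n = Suc m' + Suc m'" by simp
  then show ?thesis using moment_even[OF assms(1), of m'] by (intro exI[of _ 1]) auto
next
  case False
  then obtain m where "n = 2 * m + 1" using oddE by blast
  then have "n = m + Suc m" by simp
  then show ?thesis using moment_odd[OF assms(1), of m] by (intro exI[of _ 0]) auto
qed

lemma moment_0_0: "moment A B 0 0 = of_real (A + B) / 2"
proof -
  have "(LINT y|lebesgue. step y * bump y) = integral {-1..1} (\<lambda>y. step y * bump y)"
    by (rule compact_support_integral(2))
       (auto simp: bump_zero intro!: continuous_on_mult smooth_continuous[OF smooth_step] smooth_continuous[OF smooth_bump])
  also have "\<dots> = step 1 * step 1 / 2 - step (-1) * step (-1) / 2"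
  proof (rule integral_unique, rule fundamental_theorem_of_calculus)
    fix y :: real
    have "((\<lambda>y. step y * step y / 2) has_vector_derivative (step y * bump y + bump y * step y) / 2) (at y within {-1..1})"
      by (intro has_vector_derivative_divide has_vector_derivative_mult has_vector_derivative_at_within[OF step_deriv])
    then show "((\<lambda>y. step y * step y / 2) has_vector_derivative step y * bump y) (at y within {-1..1})"
      by (simp add: mult.commute)
  qed simp
  finally have s: "(LINT y|lebesgue. step y * bump y) = 1 / 2" by (simp add: step_1 step_0)
  have "moment A B 0 0 = (LINT y|lebesgue. of_real A * bump y + of_real (B - A) * (step y * bump y))"
    by (simp add: moment_def coeff_profile_def algebra_simps)
  also have "\<dots> = (LINT y|lebesgue. of_real A * bump y) + (LINT y|lebesgue. of_real (B - A) * (step y * bump y))"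
    by (intro Bochner_Integration.integral_add integrable_mult_right test_integrable test_integrable1 test_bump smooth_continuous smooth_step)
  also have "\<dots> = of_real A + of_real (B - A) / 2"
    unfolding integral_mult_right_zero s LINT_bump by simp
  finally show ?thesis by (simp add: field_simps)
qed

section \<open>Excluding distributions supported at the jump\<close>

lemma coeff_profile_bounded: "\<exists>M\<ge>0. \<forall>y. norm (coeff_profile A B y) \<le> M"
proof -
  have "compact (coeff_profile A B ` {-1..1})"
    by (intro compact_continuous_image smooth_continuous smooth_coeff_profile) simp
  then obtain M where M: "\<forall>z\<in>coeff_profile A B ` {-1..1}. norm z \<le> M" using compact_imp_bounded bounded_iff by blast
  have "norm (coeff_profile A B y) \<le> max M 0 + \<bar>A\<bar> + \<bar>B\<bar>" for y
  proof -
    consider "y \<in> {-1..1}" | "y \<le> -1" | "y \<ge> 1" by fastforce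
    then show ?thesis
    proof cases
      case 1
      then have "norm (coeff_profile A B y) \<le> M" using M by blast
      then show ?thesis by linarith
    qed (simp_all add: coeff_profile_def step_0 step_1)
  qed
  then show ?thesis by (intro exI[of _ "max M 0 + \<bar>A\<bar> + \<bar>B\<bar>"]) auto
qed

lemma test_moll_shift:
  assumes "\<epsilon> > 0" shows "test_function (\<lambda>y. bump ((x - y) / \<epsilon>) / of_real \<epsilon>)"
  using test_function_cmult[OF test_function_affine[OF test_bump, of "-1/\<epsilon>" "x/\<epsilon>"], of "1/of_real \<epsilon>"] assms
  by (simp add: diff_divide_distrib)

lemma funpow_vderiv_moll_shift:
  "(vderiv ^^ k) (\<lambda>y. bump ((x - y) / \<epsilon>) / of_real \<epsilon>) y
     = (-1) ^ k * (1 / of_real \<epsilon>) ^ Suc k * (vderiv ^^ k) bump ((x - y) / \<epsilon>)"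
proof -
  have "(\<lambda>y. bump ((x - y) / \<epsilon>) / of_real \<epsilon>) = (\<lambda>y. (1 / of_real \<epsilon>) * bump ((-1/\<epsilon>) * y + x / \<epsilon>))"
    by (simp add: diff_divide_distrib)
  then have "(vderiv ^^ k) (\<lambda>y. bump ((x - y) / \<epsilon>) / of_real \<epsilon>) y
      = (1 / of_real \<epsilon>) * (of_real (-1/\<epsilon>) ^ k * (vderiv ^^ k) bump ((-1/\<epsilon>) * y + x / \<epsilon>))"
    by (simp only: funpow_vderiv_cmult[OF smooth_affine[OF smooth_bump]] funpow_vderiv_affine[OF smooth_bump])
  also have "of_real (-1/\<epsilon>) = (-1) * (1 / complex_of_real \<epsilon>)" by simp
  also have "((-1) * (1 / complex_of_real \<epsilon>)) ^ k = (-1) ^ k * (1 / of_real \<epsilon>) ^ k" by (rule power_mult_distrib)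
  finally show ?thesis by (simp add: diff_divide_distrib mult_ac)
qed

lemma dist_conv_regular_bound:
  assumes \<epsilon>: "\<epsilon> > 0" and M: "M \<ge> 0" "\<And>y. \<bar>x - y\<bar> \<le> \<epsilon> \<Longrightarrow> norm (f y) \<le> M"
  shows "norm (dist_conv (regular_dist f) (moll \<epsilon>) x) \<le> M"
proof -
  let ?b = "\<lambda>y. bump ((x - y) / \<epsilon>) / of_real \<epsilon>"
  have "norm (LINT y|lebesgue. f y * ?b y) \<le> M * (LINT y|lebesgue. norm (?b y))"
  proof (rule norm_LINT_le_test[OF test_moll_shift[OF \<epsilon>] _ M(1)])
    fix y assume "?b y \<noteq> 0"
    then have "(x - y) / \<epsilon> \<in> {-1..1}" using bump_zero by fastforce
    then have "\<bar>x - y\<bar> \<le> \<epsilon>" using \<epsilon> by (auto simp: field_simps)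
    then show "norm (f y) \<le> M" by (rule M(2))
  qed
  also have "(LINT y|lebesgue. norm (?b y)) = \<bar>- \<epsilon>\<bar> *\<^sub>R (LINT z|lebesgue. norm (?b (x + (- \<epsilon>) * z)))"
    by (rule LINT_affine_scaleR) (use \<epsilon> test_borel[OF test_moll_shift[OF \<epsilon>]] in \<open>simp_all add: borel_measurable_norm\<close>)
  also have "\<dots> = 1" using \<epsilon> LINT_norm_bump by (simp add: norm_divide)
  finally show ?thesis by (simp add: dist_conv_def regular_dist_def moll_def scaled_def)
qed

text \<open>The regularised product of the coefficient with a distribution \<open>\<psi> \<mapsto> \<integral> f \<psi> + \<Sum>k. c k \<psi>\<^sup>(\<^sup>k\<^sup>)(x0)\<close>, tested against a function that equals
  \<open>(x - x0)\<^sup>j\<close> near the jump: up to a bounded error, a Laurent polynomial in \<open>\<epsilon>\<close>.\<close>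

lemma regularised_product_expansion:
  fixes f :: "real \<Rightarrow> complex" and c :: "nat \<Rightarrow> complex"
  assumes u: "distribution u" and f: "loc_int f"
    and uf: "\<And>\<psi>. test_function \<psi> \<Longrightarrow> u \<psi> = regular_dist f \<psi> + (\<Sum>k\<le>N. c k * (vderiv ^^ k) \<psi> x0)"
    and Mf: "Mf \<ge> 0" "\<And>y. \<bar>y - x0\<bar> \<le> 4 \<Longrightarrow> norm (f y) \<le> Mf"
    and Ma: "Ma \<ge> 0" "\<And>y. norm (coeff_profile A B y) \<le> Ma"
    and \<psi>: "test_function \<psi>" "\<And>x. \<bar>x - x0\<bar> > 3 \<Longrightarrow> \<psi> x = 0"
    and \<psi>j: "\<And>x. \<bar>x - x0\<bar> < \<rho> \<Longrightarrow> \<psi> x = of_real (x - x0) ^ j"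
    and \<epsilon>: "0 < \<epsilon>" "\<epsilon> < \<rho>" "\<epsilon> < 1"
  shows "norm ((LINT x|lebesgue. coeff_profile A B ((x - x0) / \<epsilon>) * dist_conv u (moll \<epsilon>) x * \<psi> x)
      - (\<Sum>k\<le>N. c k * (-1) ^ k * moment A B j k * (of_real \<epsilon> ^ j * (1 / of_real \<epsilon>) ^ k)))
      \<le> Ma * Mf * (LINT x|lebesgue. norm (\<psi> x))"
proof -
  let ?\<alpha> = "\<lambda>x. coeff_profile A B ((x - x0) / \<epsilon>)"
  let ?F = "dist_conv (regular_dist f) (moll \<epsilon>)"
  define D where "D = (\<lambda>k x. (1 / of_real \<epsilon>) ^ Suc k * (vderiv ^^ k) bump ((x - x0) / \<epsilon>))"
  have conv: "dist_conv u (moll \<epsilon>) x = ?F x + (\<Sum>k\<le>N. c k * (-1) ^ k * D k x)" for x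
  proof -
    have "dist_conv u (moll \<epsilon>) x = u (\<lambda>y. bump ((x - y) / \<epsilon>) / of_real \<epsilon>)"
      by (simp add: dist_conv_moll[OF u \<epsilon>(1)])
    also have "\<dots> = regular_dist f (\<lambda>y. bump ((x - y) / \<epsilon>) / of_real \<epsilon>) + (\<Sum>k\<le>N. c k * (-1) ^ k * D k x)"
      unfolding uf[OF test_moll_shift[OF \<epsilon>(1)]] funpow_vderiv_moll_shift by (simp add: D_def mult.assoc)
    finally show ?thesis by (simp add: dist_conv_def moll_def scaled_def)
  qed
  have \<alpha>c: "continuous_on UNIV ?\<alpha>"
    by (rule continuous_on_shift[OF smooth_continuous[OF smooth_coeff_profile]]) (use \<epsilon> in \<open>auto intro!: continuous_intros\<close>)
  have Fc: "continuous_on UNIV ?F" by (rule continuous_dist_conv[OF distribution_regular[OF f] \<epsilon>(1)])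
  have Dc: "continuous_on UNIV (D k)" for k
    unfolding D_def
    by (intro continuous_on_mult continuous_on_const continuous_on_shift[OF smooth_continuous[OF smooth_funpow[OF smooth_bump]]])
       (use \<epsilon> in \<open>auto intro!: continuous_intros\<close>)
  have Dint: "(LINT x|lebesgue. ?\<alpha> x * D k x * \<psi> x) = moment A B j k * (of_real \<epsilon> ^ j * (1 / of_real \<epsilon>) ^ k)" for k
  proof -
    have "(LINT x|lebesgue. ?\<alpha> x * D k x * \<psi> x)
        = of_real \<bar>\<epsilon>\<bar> * (LINT y|lebesgue. ?\<alpha> (x0 + \<epsilon> * y) * D k (x0 + \<epsilon> * y) * \<psi> (x0 + \<epsilon> * y))"
    proof (rule LINT_affine)
      show "(\<lambda>x. ?\<alpha> x * D k x * \<psi> x) \<in> borel_measurable borel"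
        by (intro borel_measurable_continuous_onI continuous_on_mult \<alpha>c Dc test_continuous[OF \<psi>(1)])
    qed (use \<epsilon> in simp)
    also have "(\<lambda>y. ?\<alpha> (x0 + \<epsilon> * y) * D k (x0 + \<epsilon> * y) * \<psi> (x0 + \<epsilon> * y))
        = (\<lambda>y. ((1 / of_real \<epsilon>) ^ Suc k * of_real \<epsilon> ^ j) * ((of_real y ^ j * coeff_profile A B y) * (vderiv ^^ k) bump y))"
    proof
      fix y
      show "?\<alpha> (x0 + \<epsilon> * y) * D k (x0 + \<epsilon> * y) * \<psi> (x0 + \<epsilon> * y)
        = ((1 / of_real \<epsilon>) ^ Suc k * of_real \<epsilon> ^ j) * ((of_real y ^ j * coeff_profile A B y) * (vderiv ^^ k) bump y)"
      proof (cases "y \<in> {-1..1}")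
        case True
        then have "\<bar>\<epsilon> * y\<bar> \<le> \<epsilon> * 1" using \<epsilon> unfolding abs_mult by (intro mult_mono) auto
        then have "\<bar>(x0 + \<epsilon> * y) - x0\<bar> < \<rho>" using \<epsilon> by simp
        from \<psi>j[OF this] have "\<psi> (x0 + \<epsilon> * y) = of_real \<epsilon> ^ j * of_real y ^ j"
          by (simp add: power_mult_distrib)
        then show ?thesis using \<epsilon> by (simp add: D_def mult_ac)
      next
        case False
        have "(vderiv ^^ k) bump y = 0" by (rule funpow_vderiv_supp[OF bump_zero False])
        then show ?thesis using \<epsilon> by (simp add: D_def)
      qed
    qed
    also have "(LINT y|lebesgue. ((1 / of_real \<epsilon>) ^ Suc k * of_real \<epsilon> ^ j) * ((of_real y ^ j * coeff_profile A B y) * (vderiv ^^ k) bump y))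
        = ((1 / of_real \<epsilon>) ^ Suc k * of_real \<epsilon> ^ j) * moment A B j k"
      unfolding integral_mult_right_zero moment_def ..
    finally show ?thesis using \<epsilon> by (simp add: field_simps)
  qed
  have intF: "integrable lebesgue (\<lambda>x. (?\<alpha> x * ?F x) * \<psi> x)"
    by (intro test_integrable \<psi>(1) continuous_on_mult \<alpha>c Fc)
  have intD: "integrable lebesgue (\<lambda>x. (c k * (-1) ^ k) * ((?\<alpha> x * D k x) * \<psi> x))" for k
    by (intro integrable_mult_right test_integrable \<psi>(1) continuous_on_mult \<alpha>c Dc)
  have "(LINT x|lebesgue. ?\<alpha> x * dist_conv u (moll \<epsilon>) x * \<psi> x)
      = (LINT x|lebesgue. (?\<alpha> x * ?F x) * \<psi> x + (\<Sum>k\<le>N. (c k * (-1) ^ k) * ((?\<alpha> x * D k x) * \<psi> x)))"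
    unfolding conv by (simp add: distrib_left distrib_right sum_distrib_left sum_distrib_right mult_ac)
  also have "\<dots> = (LINT x|lebesgue. (?\<alpha> x * ?F x) * \<psi> x) + (LINT x|lebesgue. (\<Sum>k\<le>N. (c k * (-1) ^ k) * ((?\<alpha> x * D k x) * \<psi> x)))"
    by (intro Bochner_Integration.integral_add intF Bochner_Integration.integrable_sum intD)
  also have "(LINT x|lebesgue. (\<Sum>k\<le>N. (c k * (-1) ^ k) * ((?\<alpha> x * D k x) * \<psi> x)))
      = (\<Sum>k\<le>N. (LINT x|lebesgue. (c k * (-1) ^ k) * ((?\<alpha> x * D k x) * \<psi> x)))"
    by (rule Bochner_Integration.integral_sum) (rule intD)
  also have "\<dots> = (\<Sum>k\<le>N. c k * (-1) ^ k * moment A B j k * (of_real \<epsilon> ^ j * (1 / of_real \<epsilon>) ^ k))"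
    unfolding integral_mult_right_zero Dint by (simp only: mult.assoc)
  finally have eq: "(LINT x|lebesgue. ?\<alpha> x * dist_conv u (moll \<epsilon>) x * \<psi> x)
      - (\<Sum>k\<le>N. c k * (-1) ^ k * moment A B j k * (of_real \<epsilon> ^ j * (1 / of_real \<epsilon>) ^ k))
      = (LINT x|lebesgue. (?\<alpha> x * ?F x) * \<psi> x)" by simp
  show ?thesis unfolding eq
  proof (rule norm_LINT_le_test[OF \<psi>(1)])
    fix x assume "\<psi> x \<noteq> 0"
    then have x: "\<bar>x - x0\<bar> \<le> 3" using \<psi>(2) not_le by blast
    have "norm (?F x) \<le> Mf"
      by (rule dist_conv_regular_bound[OF \<epsilon>(1) Mf(1)], rule Mf(2)) (use x \<epsilon> in auto)
    then show "norm (?\<alpha> x * ?F x) \<le> Ma * Mf"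
      unfolding norm_mult using Ma by (intro mult_mono) auto
  qed (use Ma Mf in simp)
qed

text \<open>Existence of the product excludes derivatives of the delta distribution: the
  coefficient of the most singular power of \<open>\<epsilon>\<close> must vanish.\<close>

lemma no_delta_derivatives:
  fixes f :: "real \<Rightarrow> complex" and c :: "nat \<Rightarrow> complex"
  assumes AB: "A \<noteq> B" and mp: "has_model_product (regular_dist (jump_coeff A B x0)) u p"
    and u: "distribution u" and f: "loc_int f"
    and uf: "\<And>\<psi>. test_function \<psi> \<Longrightarrow> u \<psi> = regular_dist f \<psi> + (\<Sum>k\<le>N. c k * (vderiv ^^ k) \<psi> x0)"
    and Mf: "Mf \<ge> 0" "\<And>y. \<bar>y - x0\<bar> \<le> 4 \<Longrightarrow> norm (f y) \<le> Mf"
    and n: "1 \<le> n" "n \<le> N" and top: "\<And>k. n < k \<Longrightarrow> k \<le> N \<Longrightarrow> c k = 0"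
  shows "c n = 0"
proof -
  obtain j where j: "j < n" "moment A B j n \<noteq> 0" using moment_exists[OF AB n(1)] by blast
  obtain Ma where Ma: "Ma \<ge> 0" "\<And>y. norm (coeff_profile A B y) \<le> Ma" using coeff_profile_bounded by metis
  define \<psi> where "\<psi> = (\<lambda>x. of_real (x - x0) ^ j * cutoff ((x - x0) / 1))"
  have sm: "smooth (\<lambda>x. of_real (x - x0) ^ j)"
    using smooth_power[OF smooth_diff[OF smooth_of_real smooth_const[of "of_real x0"]], of j] by simp
  have \<psi>: "test_function \<psi>" unfolding \<psi>_def by (rule test_function_mult[OF test_cutoff_scaled sm]) simp
  have \<psi>0: "\<psi> x = 0" if "\<bar>x - x0\<bar> > 3" for x using that by (simp add: \<psi>_def cutoff_0)
  have \<psi>j: "\<psi> x = of_real (x - x0) ^ j" if "\<bar>x - x0\<bar> < 1" for x using that by (simp add: \<psi>_def cutoff_1)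
  define T where "T = (\<lambda>\<epsilon>. LINT x|lebesgue. coeff_profile A B ((x - x0) / \<epsilon>) * dist_conv u (moll \<epsilon>) x * \<psi> x)"
  define S where "S = (\<lambda>\<epsilon>::real. \<Sum>k\<le>N. c k * (-1) ^ k * moment A B j k * (of_real \<epsilon> ^ j * (1 / of_real \<epsilon>) ^ k))"
  define M where "M = Ma * Mf * (LINT x|lebesgue. norm (\<psi> x))"
  have TS: "norm (T \<epsilon> - S \<epsilon>) \<le> M" if "0 < \<epsilon>" "\<epsilon> < 1" for \<epsilon>
    unfolding T_def S_def M_def by (rule regularised_product_expansion[OF u f uf Mf Ma \<psi> \<psi>0 \<psi>j that that(2)])
  have Tlim: "(T \<longlongrightarrow> p \<psi>) (at_right 0)" unfolding T_def by (rule model_product_moll[OF mp \<psi>])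
  \<comment> \<open>multiplied by \<open>\<epsilon>\<^sup>n\<^sup>-\<^sup>j\<close>, the Laurent polynomial becomes a polynomial, while everything bounded tends to \<open>0\<close>\<close>
  define h where "h = (\<lambda>\<epsilon>::real. \<Sum>k\<le>n. c k * (-1) ^ k * moment A B j k * of_real \<epsilon> ^ (n - k))"
  have hS: "h \<epsilon> = of_real \<epsilon> ^ (n - j) * S \<epsilon>" if "\<epsilon> > 0" for \<epsilon>
  proof -
    have S_eq: "S \<epsilon> = (\<Sum>k\<le>n. c k * (-1) ^ k * moment A B j k * (of_real \<epsilon> ^ j * (1 / of_real \<epsilon>) ^ k))"
      unfolding S_def by (rule sum.mono_neutral_right) (use n top in auto)
    have pw: "of_real \<epsilon> ^ (n - j) * (of_real \<epsilon> ^ j * (1 / of_real \<epsilon>) ^ k) = complex_of_real \<epsilon> ^ (n - k)" if "k \<le> n" for k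
    proof -
      have "of_real \<epsilon> ^ (n - j) * (of_real \<epsilon> ^ j * (1 / of_real \<epsilon>) ^ k) = complex_of_real \<epsilon> ^ n * (1 / of_real \<epsilon>) ^ k"
        using j(1) by (simp add: power_add[symmetric] mult.assoc[symmetric])
      then show ?thesis using that \<open>\<epsilon> > 0\<close> by (simp add: power_diff power_divide)
    qed
    show ?thesis unfolding h_def S_eq sum_distrib_left
    proof (rule sum.cong[OF refl])
      fix k assume "k \<in> {..n}"
      then have "c k * (-1) ^ k * moment A B j k * of_real \<epsilon> ^ (n - k)
          = c k * (-1) ^ k * moment A B j k * (of_real \<epsilon> ^ (n - j) * (of_real \<epsilon> ^ j * (1 / of_real \<epsilon>) ^ k))"
        by (simp only: pw atMost_iff)
      then show "c k * (-1) ^ k * moment A B j k * of_real \<epsilon> ^ (n - k)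
          = of_real \<epsilon> ^ (n - j) * (c k * (-1) ^ k * moment A B j k * (of_real \<epsilon> ^ j * (1 / of_real \<epsilon>) ^ k))"
        by (simp only: mult.left_commute)
    qed
  qed
  have e0: "((\<lambda>\<epsilon>. complex_of_real \<epsilon> ^ (n - j)) \<longlongrightarrow> 0) (at_right 0)"
    by (rule tendsto_eq_intros refl)+ (use j in auto)
  have "((\<lambda>\<epsilon>. of_real \<epsilon> ^ (n - j) * (T \<epsilon> - S \<epsilon>)) \<longlongrightarrow> 0) (at_right 0)"
  proof (rule Lim_null_comparison)
    show "eventually (\<lambda>\<epsilon>. norm (of_real \<epsilon> ^ (n - j) * (T \<epsilon> - S \<epsilon>)) \<le> norm (complex_of_real \<epsilon> ^ (n - j)) * M) (at_right 0)"
      by (rule eventually_mono[OF eventually_at_right_real[of 0 1]])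
         (auto simp: norm_mult intro!: mult_left_mono TS)
    show "((\<lambda>\<epsilon>. norm (complex_of_real \<epsilon> ^ (n - j)) * M) \<longlongrightarrow> 0) (at_right 0)"
      using tendsto_mult_right[OF tendsto_norm[OF e0], of M] by simp
  qed
  then have "((\<lambda>\<epsilon>. of_real \<epsilon> ^ (n - j) * T \<epsilon> - of_real \<epsilon> ^ (n - j) * (T \<epsilon> - S \<epsilon>)) \<longlongrightarrow> 0 * p \<psi> - 0) (at_right 0)"
    by (intro tendsto_diff tendsto_mult e0 Tlim)
  then have "((\<lambda>\<epsilon>. of_real \<epsilon> ^ (n - j) * S \<epsilon>) \<longlongrightarrow> 0) (at_right 0)" by (simp add: algebra_simps)
  then have "(h \<longlongrightarrow> 0) (at_right 0)"
    by (rule Lim_transform_eventually) (auto simp: eventually_at_filter hS)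
  moreover have "(h \<longlongrightarrow> h 0) (at_right 0)"
    unfolding h_def by (intro tendsto_intros)
  ultimately have "h 0 = 0" using tendsto_unique[of "at_right (0::real)"] by (metis trivial_limit_at_right_real)
  moreover have "h 0 = c n * (-1) ^ n * moment A B j n"
  proof -
    have "h 0 = (\<Sum>k\<le>n. if k = n then c n * (-1) ^ n * moment A B j n else 0)"
      unfolding h_def by (rule sum.cong) (auto simp: power_0_left)
    then show ?thesis by simp
  qed
  ultimately show "c n = 0" using j(2) by simp
qed

text \<open>A test function equal to \<open>y\<^sup>2 / 2\<close> near \<open>0\<close>.\<close>

definition parabola :: "real \<Rightarrow> complex" where
  "parabola y = of_real y ^ 2 / 2 * cutoff y"

lemma parabola:
  shows "test_function parabola" and "\<And>y. \<bar>y\<bar> < 1 \<Longrightarrow> (vderiv ^^ 2) parabola y = 1"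
    and "\<And>y. \<bar>y\<bar> \<ge> 3 \<Longrightarrow> parabola y = 0" and "parabola 0 = 0"
proof -
  have sm: "smooth (\<lambda>y. of_real y ^ 2 / 2)"
    using smooth_mult[OF smooth_const[of "1/2"] smooth_power[OF smooth_of_real, of 2]] by simp
  show "test_function parabola" unfolding parabola_def[abs_def] by (rule test_function_mult[OF test_cutoff sm])
  show "(vderiv ^^ 2) parabola y = 1" if "\<bar>y\<bar> < 1" for y
  proof -
    have "(vderiv ^^ 2) parabola y = (vderiv ^^ 2) (\<lambda>y. of_real y * (of_real y / 2)) y"
      by (rule funpow_vderiv_local[of "{-1<..<1}"]) (use that in \<open>auto simp: parabola_def cutoff_1 power2_eq_square\<close>)
    also have "(\<lambda>y::real. of_real y * (of_real y / 2)) = (\<lambda>y. (1 / 2) * (of_real y * of_real y :: complex))" by auto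
    also have "(vderiv ^^ 2) (\<lambda>y. (1 / 2) * (of_real y * of_real y)) = (\<lambda>y. 1)"
    proof -
      have s: "smooth (\<lambda>y. of_real y * of_real y)" by (intro smooth_mult smooth_of_real)
      have "vderiv (\<lambda>y. of_real y * of_real y) = (\<lambda>y. of_real y * 1 + 1 * of_real y)"
        unfolding vderiv_mult[OF smooth_of_real smooth_of_real] vderiv_of_real ..
      also have "\<dots> = (\<lambda>y. 2 * of_real y)" by auto
      finally have "(vderiv ^^ 2) (\<lambda>y. of_real y * of_real y) = (\<lambda>y. 2 * 1)"
        by (simp add: numeral_2_eq_2 vderiv_cmult[OF smooth_of_real])
      then show ?thesis unfolding funpow_vderiv_cmult[OF s] by simp
    qed
    finally show ?thesis .
  qed
  show "parabola y = 0" if "\<bar>y\<bar> \<ge> 3" for y using that by (simp add: parabola_def cutoff_0)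
  show "parabola 0 = 0" by (simp add: parabola_def)
qed

text \<open>The equation excludes the delta distribution itself: its second derivative would not be
  balanced by any other term. The test functions are concentrated at the jump and scaled so that
  their second derivative is \<open>1\<close> at the jump.\<close>

lemma no_delta:
  fixes f g :: "real \<Rightarrow> complex" and c0 P :: complex
  assumes AB: "A > 0" "B > 0" and mp: "has_model_product (regular_dist (jump_coeff A B x0)) u p"
    and u: "distribution u" and f: "loc_int f" and g: "loc_int g"
    and uf: "\<And>\<psi>. test_function \<psi> \<Longrightarrow> u \<psi> = regular_dist f \<psi> + c0 * \<psi> x0"
    and Mf: "Mf \<ge> 0" "\<And>y. \<bar>y - x0\<bar> \<le> 4 \<Longrightarrow> norm (f y) \<le> Mf"
    and eq: "\<And>\<psi>. test_function \<psi> \<Longrightarrow> p ((vderiv ^^ 2) \<psi>) + P * u \<psi> = regular_dist g \<psi>"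
  shows "c0 = 0"
proof -
  obtain Ma where Ma: "Ma \<ge> 0" "\<And>y. norm (coeff_profile A B y) \<le> Ma" using coeff_profile_bounded by metis
  obtain X where X: "X \<ge> 0" "\<And>y. norm (parabola y) \<le> X" using test_bounded[OF parabola(1)] by metis
  define R where "R = \<bar>x0\<bar> + 3"
  obtain Cf where Cf: "Cf \<ge> 0" "\<And>\<phi> M. test_function \<phi> \<Longrightarrow> (\<And>x. x \<notin> {-R..R} \<Longrightarrow> \<phi> x = 0) \<Longrightarrow>
      (\<And>x. norm (\<phi> x) \<le> M) \<Longrightarrow> norm (regular_dist f \<phi>) \<le> Cf * M"
    using regular_dist_bound[OF f, of R] by metis
  obtain Cg where Cg: "Cg \<ge> 0" "\<And>\<phi> M. test_function \<phi> \<Longrightarrow> (\<And>x. x \<notin> {-R..R} \<Longrightarrow> \<phi> x = 0) \<Longrightarrow>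
      (\<And>x. norm (\<phi> x) \<le> M) \<Longrightarrow> norm (regular_dist g \<phi>) \<le> Cg * M"
    using regular_dist_bound[OF g, of R] by metis
  define L where "L = (LINT y|lebesgue. norm ((vderiv ^^ 2) parabola y))"
  define K where "K = (Cg + norm P * Cf) * X"
  let ?I = "moment A B 0 0"
  have est: "norm (c0 * ?I) \<le> \<rho> ^ 2 * K + Ma * Mf * (\<rho> * L)" if \<rho>: "0 < \<rho>" "\<rho> < 1" for \<rho>
  proof -
    define \<Psi> where "\<Psi> = (\<lambda>x. of_real (\<rho> ^ 2) * parabola ((x - x0) / \<rho>))"
    have s: "smooth (\<lambda>x. parabola ((x - x0) / \<rho>))" and t: "test_function (\<lambda>x. parabola ((x - x0) / \<rho>))"
      using test_function_affine[OF parabola(1), of "1/\<rho>" "-x0/\<rho>"] smooth_affine[OF test_smooth[OF parabola(1)], of "1/\<rho>" "-x0/\<rho>"] \<rho>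
      by (simp_all add: diff_divide_distrib)
    have \<Psi>: "test_function \<Psi>" unfolding \<Psi>_def by (rule test_function_cmult[OF t])
    have far: "\<bar>(x - x0) / \<rho>\<bar> \<ge> 3" if "\<bar>x - x0\<bar> > 3" for x
    proof -
      have "3 * \<rho> \<le> \<bar>x - x0\<bar>" using that \<rho> by auto
      then show ?thesis using \<rho> by (simp add: abs_divide field_simps)
    qed
    have \<Psi>0: "\<Psi> x = 0" if "\<bar>x - x0\<bar> > 3" for x using parabola(3)[OF far[OF that]] by (simp add: \<Psi>_def)
    have \<Psi>2: "(vderiv ^^ 2) \<Psi> x = (vderiv ^^ 2) parabola ((x - x0) / \<rho>)" for x
    proof -
      have "(\<lambda>x. parabola ((x - x0) / \<rho>)) = (\<lambda>x. parabola ((1/\<rho>) * x + (-x0/\<rho>)))" by (simp add: diff_divide_distrib)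
      then have "(vderiv ^^ 2) (\<lambda>x. parabola ((x - x0) / \<rho>)) x = of_real (1/\<rho>) ^ 2 * (vderiv ^^ 2) parabola ((1/\<rho>) * x + (-x0/\<rho>))"
        by (simp only: funpow_vderiv_affine[OF test_smooth[OF parabola(1)]])
      then show ?thesis unfolding \<Psi>_def funpow_vderiv_cmult[OF s]
        using \<rho> by (simp add: diff_divide_distrib power_divide)
    qed
    let ?\<psi> = "(vderiv ^^ 2) \<Psi>"
    have \<psi>: "test_function ?\<psi>" by (rule test_function_funpow[OF \<Psi>])
    have \<psi>0: "?\<psi> x = 0" if "\<bar>x - x0\<bar> > 3" for x
      by (rule funpow_vderiv_supp[of "x0 - 3" "x0 + 3"]) (use that in \<open>auto intro!: \<Psi>0\<close>)
    have \<psi>1: "?\<psi> x = of_real (x - x0) ^ 0" if "\<bar>x - x0\<bar> < \<rho>" for x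
      unfolding \<Psi>2 using that \<rho> by (simp add: parabola(2) abs_divide)
    have \<psi>L: "(LINT x|lebesgue. norm (?\<psi> x)) = \<rho> * L"
    proof -
      have "(LINT x|lebesgue. norm (?\<psi> x)) = \<bar>\<rho>\<bar> *\<^sub>R (LINT y|lebesgue. norm (?\<psi> (x0 + \<rho> * y)))"
        by (rule LINT_affine_scaleR) (use \<rho> test_borel[OF \<psi>] in \<open>simp_all add: borel_measurable_norm\<close>)
      then show ?thesis using \<rho> by (simp add: \<Psi>2 L_def)
    qed
    let ?T = "\<lambda>\<epsilon>. LINT x|lebesgue. coeff_profile A B ((x - x0) / \<epsilon>) * dist_conv u (moll \<epsilon>) x * ?\<psi> x"
    have uf': "u \<psi> = regular_dist f \<psi> + (\<Sum>k\<le>0. (\<lambda>_. c0) k * (vderiv ^^ k) \<psi> x0)" if "test_function \<psi>" for \<psi>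
      using uf[OF that] by simp
    have "norm (p ?\<psi> - c0 * ?I) \<le> Ma * Mf * (\<rho> * L)"
    proof (rule tendsto_upperbound)
      show "((\<lambda>\<epsilon>. norm (?T \<epsilon> - c0 * ?I)) \<longlongrightarrow> norm (p ?\<psi> - c0 * ?I)) (at_right 0)"
        by (intro tendsto_norm tendsto_diff tendsto_const model_product_moll[OF mp \<psi>])
      show "eventually (\<lambda>\<epsilon>. norm (?T \<epsilon> - c0 * ?I) \<le> Ma * Mf * (\<rho> * L)) (at_right 0)"
      proof (rule eventually_mono[OF eventually_at_right_real[OF \<rho>(1)]])
        fix \<epsilon> assume "\<epsilon> \<in> {0<..<\<rho>}"
        then have "0 < \<epsilon>" "\<epsilon> < \<rho>" "\<epsilon> < 1" using \<rho> by auto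
        from regularised_product_expansion[OF u f uf' Mf Ma \<psi> \<psi>0 \<psi>1 this]
        show "norm (?T \<epsilon> - c0 * ?I) \<le> Ma * Mf * (\<rho> * L)" by (simp add: \<psi>L)
      qed
    qed simp
    moreover have "norm (p ?\<psi>) \<le> \<rho> ^ 2 * K"
    proof -
      have supp: "\<Psi> x = 0" if "x \<notin> {-R..R}" for x using that by (intro \<Psi>0) (auto simp: R_def)
      have le: "norm (\<Psi> x) \<le> \<rho> ^ 2 * X" for x
        using X(2) \<rho> by (simp add: \<Psi>_def norm_mult norm_power mult_left_mono)
      have "u \<Psi> = regular_dist f \<Psi>" using uf[OF \<Psi>] parabola(4) by (simp add: \<Psi>_def)
      then have "p ?\<psi> = regular_dist g \<Psi> - P * regular_dist f \<Psi>" using eq[OF \<Psi>] by (simp add: eq_diff_eq)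
      then have "norm (p ?\<psi>) \<le> norm (regular_dist g \<Psi>) + norm P * norm (regular_dist f \<Psi>)"
        using norm_triangle_ineq4 by (simp flip: norm_mult)
      also have "\<dots> \<le> Cg * (\<rho> ^ 2 * X) + norm P * (Cf * (\<rho> ^ 2 * X))"
        by (intro add_mono mult_left_mono Cg(2)[OF \<Psi> supp le] Cf(2)[OF \<Psi> supp le]) simp_all
      finally show ?thesis by (simp add: K_def algebra_simps)
    qed
    ultimately show ?thesis using norm_triangle_ineq3[of "c0 * ?I" "p ?\<psi>"] by (simp add: norm_minus_commute)
  qed
  have "norm (c0 * ?I) \<le> 0"
  proof (rule tendsto_lowerbound)
    show "((\<lambda>\<rho>. \<rho> ^ 2 * K + Ma * Mf * (\<rho> * L)) \<longlongrightarrow> 0) (at_right 0)"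
      by (rule tendsto_eq_intros refl)+ auto
    show "eventually (\<lambda>\<rho>. norm (c0 * ?I) \<le> \<rho> ^ 2 * K + Ma * Mf * (\<rho> * L)) (at_right 0)"
      by (rule eventually_mono[OF eventually_at_right_real[of 0 1]]) (auto intro!: est)
  qed simp
  moreover have "?I \<noteq> 0" unfolding moment_0_0 using AB by (simp del: of_real_add)
  ultimately show ?thesis by simp
qed

section \<open>Solutions are functions\<close>

lemma loc_int_zero_extension:
  assumes "g absolutely_integrable_on {0..1}" shows "loc_int (zero_extension g)"
proof -
  have "integrable lebesgue (zero_extension g)"
    using assms unfolding set_integrable_def
    by (rule back_subst[where P = "integrable lebesgue"]) (auto simp: zero_extension_def indicator_def)
  then have "set_integrable lebesgue UNIV (zero_extension g)" by (simp add: set_integrable_def)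
  then show ?thesis unfolding loc_int_def by (intro allI) (rule set_integrable_subset, auto)
qed

lemma piecewise_bounded:
  fixes f1 f2 :: "real \<Rightarrow> complex"
  assumes "continuous_on UNIV f1" "continuous_on UNIV f2"
  shows "\<exists>M\<ge>0. \<forall>y. \<bar>y - x0\<bar> \<le> r \<longrightarrow> norm (if y < x0 then f1 y else f2 y) \<le> M"
proof -
  have bd: "\<exists>M. \<forall>y\<in>{x0-r..x0+r}. norm (h y) \<le> M" if "continuous_on UNIV h" for h :: "real \<Rightarrow> complex"
  proof -
    have "compact (h ` {x0-r..x0+r})" by (intro compact_continuous_image continuous_on_subset[OF that]) auto
    from compact_imp_bounded[OF this] show ?thesis unfolding bounded_iff by auto
  qed
  obtain M1 where M1: "\<forall>y\<in>{x0-r..x0+r}. norm (f1 y) \<le> M1" using bd[OF assms(1)] by blast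
  obtain M2 where M2: "\<forall>y\<in>{x0-r..x0+r}. norm (f2 y) \<le> M2" using bd[OF assms(2)] by blast
  have "norm (if y < x0 then f1 y else f2 y) \<le> max 0 (max M1 M2)" if "\<bar>y - x0\<bar> \<le> r" for y
  proof -
    have "y \<in> {x0-r..x0+r}" using that by auto
    then have "norm (f1 y) \<le> M1" "norm (f2 y) \<le> M2" using M1 M2 by blast+
    then show ?thesis by auto
  qed
  then show ?thesis by (intro exI[of _ "max 0 (max M1 M2)"]) auto
qed

theorem theorem2p4:
  fixes A B x0 P :: real
    and g :: "real \<Rightarrow> complex"
    and u :: "(real \<Rightarrow> complex) \<Rightarrow> complex"
  assumes "A > 0" and "B > 0" and "A \<noteq> B"
    and "0 < x0" and "x0 < 1"
    and "g absolutely_integrable_on {0..1}"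
    and "is_solution A B x0 P g u"
  shows "\<exists>f. locally_integrable f \<and> (\<forall>\<psi>. test_function \<psi> \<longrightarrow> u \<psi> = regular_dist f \<psi>)"
proof -
  let ?g = "zero_extension g"
  have g: "loc_int ?g" by (rule loc_int_zero_extension[OF assms(6)])
  obtain p where u: "distribution u" and mp: "has_model_product (regular_dist (jump_coeff A B x0)) u p"
    and eq0: "\<And>\<psi>. test_function \<psi> \<Longrightarrow> dist_deriv (dist_deriv p) \<psi> + of_real P * u \<psi> = regular_dist ?g \<psi>"
    using assms(7) unfolding is_solution_def by blast
  have eq: "p ((vderiv ^^ 2) \<psi>) + of_real P * u \<psi> = regular_dist ?g \<psi>" if "test_function \<psi>" for \<psi>
    using eq0[OF that] by (simp add: dist_deriv_def numeral_2_eq_2)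
  have sub2: "tsupp (vderiv (vderiv \<psi>)) \<subseteq> I" if "tsupp \<psi> \<subseteq> I" for \<psi> I
    using tsupp_vderiv_subset[of "vderiv \<psi>"] tsupp_vderiv_subset[of \<psi>] that by blast
  have "\<exists>F. continuous_on UNIV F \<and> (\<forall>\<psi>. test_function \<psi> \<longrightarrow> tsupp \<psi> \<subseteq> {..<x0} \<longrightarrow> u \<psi> = (LINT x|lebesgue. F x * \<psi> x))"
  proof (rule second_order_regularity[OF _ _ _ u _ g, where a = "of_real A" and P = "of_real P"])
    fix \<psi> assume \<psi>: "test_function \<psi>" "tsupp \<psi> \<subseteq> {..<x0}"
    have "p (vderiv (vderiv \<psi>)) = of_real A * u (vderiv (vderiv \<psi>))"
      by (rule model_product_left[OF mp u test_function_vderiv[OF test_function_vderiv[OF \<psi>(1)]] sub2[OF \<psi>(2)]])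
    then show "of_real A * u (vderiv (vderiv \<psi>)) + of_real P * u \<psi> = (LINT x|lebesgue. ?g x * \<psi> x)"
      using eq[OF \<psi>(1)] by (simp add: regular_dist_def numeral_2_eq_2)
  qed (use assms(1) in \<open>auto simp: is_interval_1 intro: exI[of _ "x0 - 1"]\<close>)
  then obtain f1 where f1: "continuous_on UNIV f1"
    "\<And>\<psi>. test_function \<psi> \<Longrightarrow> tsupp \<psi> \<subseteq> {..<x0} \<Longrightarrow> u \<psi> = (LINT x|lebesgue. f1 x * \<psi> x)" by blast
  have "\<exists>F. continuous_on UNIV F \<and> (\<forall>\<psi>. test_function \<psi> \<longrightarrow> tsupp \<psi> \<subseteq> {x0<..} \<longrightarrow> u \<psi> = (LINT x|lebesgue. F x * \<psi> x))"
  proof (rule second_order_regularity[OF _ _ _ u _ g, where a = "of_real B" and P = "of_real P"])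
    fix \<psi> assume \<psi>: "test_function \<psi>" "tsupp \<psi> \<subseteq> {x0<..}"
    have "p (vderiv (vderiv \<psi>)) = of_real B * u (vderiv (vderiv \<psi>))"
      by (rule model_product_right[OF mp u test_function_vderiv[OF test_function_vderiv[OF \<psi>(1)]] sub2[OF \<psi>(2)]])
    then show "of_real B * u (vderiv (vderiv \<psi>)) + of_real P * u \<psi> = (LINT x|lebesgue. ?g x * \<psi> x)"
      using eq[OF \<psi>(1)] by (simp add: regular_dist_def numeral_2_eq_2)
  qed (use assms(2) in \<open>auto simp: is_interval_1 intro: exI[of _ "x0 + 1"]\<close>)
  then obtain f2 where f2: "continuous_on UNIV f2"
    "\<And>\<psi>. test_function \<psi> \<Longrightarrow> tsupp \<psi> \<subseteq> {x0<..} \<Longrightarrow> u \<psi> = (LINT x|lebesgue. f2 x * \<psi> x)" by blast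
  define f where "f = (\<lambda>x. if x < x0 then f1 x else f2 x)"
  have f: "loc_int f" unfolding f_def by (intro loc_int_piecewise loc_int_continuous f1(1) f2(1))
  obtain Mf where Mf: "Mf \<ge> 0" "\<And>y. \<bar>y - x0\<bar> \<le> 4 \<Longrightarrow> norm (f y) \<le> Mf"
    using piecewise_bounded[OF f1(1) f2(1), of x0 4] unfolding f_def by blast
  define v where "v = (\<lambda>\<psi>. u \<psi> - regular_dist f \<psi>)"
  have v: "distribution v"
    unfolding v_def by (rule distribution_minus_distribution[OF u distribution_regular[OF f]])
  have vl: "v \<psi> = 0" if "test_function \<psi>" "tsupp \<psi> \<subseteq> {..<x0}" for \<psi>
  proof -
    have "f x * \<psi> x = f1 x * \<psi> x" for x
      using that(2) not_in_tsupp[of x \<psi>] by (cases "x \<in> tsupp \<psi>") (auto simp: f_def)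
    then have "(\<lambda>x. f x * \<psi> x) = (\<lambda>x. f1 x * \<psi> x)" by blast
    then show ?thesis using f1(2)[OF that] by (simp add: v_def regular_dist_def)
  qed
  have vr: "v \<psi> = 0" if "test_function \<psi>" "tsupp \<psi> \<subseteq> {x0<..}" for \<psi>
  proof -
    have "f x * \<psi> x = f2 x * \<psi> x" for x
      using that(2) not_in_tsupp[of x \<psi>] by (cases "x \<in> tsupp \<psi>") (auto simp: f_def)
    then have "(\<lambda>x. f x * \<psi> x) = (\<lambda>x. f2 x * \<psi> x)" by blast
    then show ?thesis using f2(2)[OF that] by (simp add: v_def regular_dist_def)
  qed
  obtain N c where c: "\<And>\<psi>. test_function \<psi> \<Longrightarrow> v \<psi> = (\<Sum>k\<le>(N::nat). c k * (vderiv ^^ k) \<psi> x0)"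
    using point_support_structure[OF v vl vr] by blast
  have uf: "u \<psi> = regular_dist f \<psi> + (\<Sum>k\<le>N. c k * (vderiv ^^ k) \<psi> x0)" if "test_function \<psi>" for \<psi>
    using c[OF that] by (simp add: v_def algebra_simps)
  have ck: "c k = 0" if "1 \<le> k" "k \<le> N" for k
    using that
  proof (induction "N - k" arbitrary: k rule: less_induct)
    case less
    show ?case
    proof (rule no_delta_derivatives[OF assms(3) mp u f uf Mf less.prems])
      show "c i = 0" if "k < i" "i \<le> N" for i
        using less.hyps[of i] that less.prems by auto
    qed
  qed
  have sum: "(\<Sum>k\<le>N. c k * (vderiv ^^ k) \<psi> x0) = c 0 * \<psi> x0" for \<psi>
  proof -
    have "(\<Sum>k\<le>N. c k * (vderiv ^^ k) \<psi> x0) = (\<Sum>k\<in>{0}. c k * (vderiv ^^ k) \<psi> x0)"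
      by (rule sum.mono_neutral_right) (use ck in auto)
    then show ?thesis by simp
  qed
  have u0: "u \<psi> = regular_dist f \<psi> + c 0 * \<psi> x0" if "test_function \<psi>" for \<psi>
    using uf[OF that] by (simp only: sum)
  have "c 0 = 0" by (rule no_delta[OF assms(1,2) mp u f g u0 Mf eq])
  then show ?thesis using u0 loc_int_imp_locally_integrable[OF f] by auto
qed

end
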